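(* Let $(X_i)_{i\in\mathbb Z}$ be a strictly stationary sequence of random variables with values in a separable metric space $(S,d)$, let $\mathbb H$ be a separable Hilbert space, and let $h\colon S\times S\to\mathbb H$ be a measurable function ($S\times S$ is endowed with the product $\sigma$-algebra and $\mathbb H$ with the $\sigma$-algebra induced by the norm). Let $X_1'$ be an independent copy of $X_1$ and suppose that, almost surely, $$\mathbb E[h(X_1,X_1')\mid X_1]=\mathbb E[h(X_1,X_1')\mid X_1']=0.$$ Let $1<p<2$ and $\delta>0$ be such that $p+\delta<2$. Assume that $$\mathbb E\bigl[\|h(X_1,X_1')\|_{\mathbb H}^{p+\delta}\bigr]<\infty,\qquad \sup_{j\ge2}\mathbb E\bigl[\|h(X_1,X_j)\|_{\mathbb H}\bigr]<\infty,$$ and that $$\sum_{k=1}^\infty k^{p-1+\frac{p(p-1)}{\delta}}\beta(k)<\infty.$$ Then $$\lim_{n\to\infty}\frac1{n^{2/p}}\|U_n(h)\|_{\mathbb H}=0\quad\text{almost surely.}$$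
   Context: $U_n(h)=\sum_{1\le i<j\le n}h(X_i,X_j)$. For sub-$\sigma$-algebras $\mathcal A,\mathcal B$ of a probability space, $\beta(\mathcal A,\mathcal B)=\frac12\sup\sum_{i=1}^I\sum_{j=1}^J|\mathbb P(A_i\cap B_j)-\mathbb P(A_i)\mathbb P(B_j)|$, the supremum being over all finite partitions $(A_i)_{i=1}^I$, $(B_j)_{j=1}^J$ of $\Omega$ into elements of $\mathcal A$ and $\mathcal B$ respectively. For the sequence, $\beta(k)=\sup_{\ell\ge1}\beta(\mathcal F_1^\ell,\mathcal F_{\ell+k}^\infty)$, where $\mathcal F_u^v=\sigma(X_i,\,u\le i\le v)$ ($\sigma(X_i,\,i\ge u)$ if $v=\infty$). *)

theory Defs
  imports "HOL-Probability.Probability"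
begin

definition strictly_stationary :: "'a measure \<Rightarrow> (int \<Rightarrow> 'a \<Rightarrow> 's::topological_space) \<Rightarrow> bool" where
  "strictly_stationary M X \<longleftrightarrow>
     (\<forall>k. distr M (\<Pi>\<^sub>M i\<in>UNIV. borel) (\<lambda>\<omega> i. X (i + k) \<omega>)
        = distr M (\<Pi>\<^sub>M i\<in>UNIV. borel) (\<lambda>\<omega> i. X i \<omega>))"

text \<open>
  The conditional expectation of a vector-valued \<open>f\<close> given \<open>F\<close> (the library only has the real-valued
  one), as a relation: \<open>g\<close> is a version of it. Thus ``the conditional expectation is \<open>0\<close> almost
  surely'' is the assertion that the zero function is a version.
\<close>

definition is_cond_exp ::
  "'a measure \<Rightarrow> 'a measure \<Rightarrow> ('a \<Rightarrow> 'h::{real_normed_vector, second_countable_topology}) \<Rightarrow> ('a \<Rightarrow> 'h) \<Rightarrow> bool"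
  where
  "is_cond_exp M F f g \<longleftrightarrow>
     subalgebra M F \<and> integrable M f \<and> integrable M g \<and> g \<in> borel_measurable F \<and>
     (\<forall>A\<in>sets F. (LINT \<omega>:A|M. f \<omega>) = (LINT \<omega>:A|M. g \<omega>))"

definition U_stat :: "('s \<Rightarrow> 's \<Rightarrow> 'h::comm_monoid_add) \<Rightarrow> (int \<Rightarrow> 'a \<Rightarrow> 's) \<Rightarrow> nat \<Rightarrow> 'a \<Rightarrow> 'h" where
  "U_stat h X n \<omega> = (\<Sum>(i, j) \<in> {(i, j). 1 \<le> i \<and> i < j \<and> j \<le> int n}. h (X i \<omega>) (X j \<omega>))"

text \<open>Sub-\<open>\<sigma>\<close>-algebras are represented by the \<open>sets\<close> of a measure on the same space.\<close>

definition finite_partitions :: "'a measure \<Rightarrow> 'a set set set" where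
  "finite_partitions F = {P. finite P \<and> partition_on (space F) P \<and> P \<subseteq> sets F}"

text \<open>
  In a probability space the double sums below are at most \<open>2\<close>, so the real-valued suprema here and in
  \<open>beta_mixing\<close> are genuine. The blocks of \<open>partition_on\<close> are nonempty; empty blocks would add \<open>0\<close>.
\<close>

definition beta_coeff :: "'a measure \<Rightarrow> 'a measure \<Rightarrow> 'a measure \<Rightarrow> real" where
  "beta_coeff M F G = 1/2 *
     (SUP (P, Q) \<in> finite_partitions F \<times> finite_partitions G.
        \<Sum>A\<in>P. \<Sum>B\<in>Q. \<bar>measure M (A \<inter> B) - measure M A * measure M B\<bar>)"

definition sigma_gen :: "'a measure \<Rightarrow> (int \<Rightarrow> 'a \<Rightarrow> 's::topological_space) \<Rightarrow> int set \<Rightarrow> 'a measure" where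
  "sigma_gen M X I = sigma (space M) (\<Union>i\<in>I. {X i -` B \<inter> space M | B. B \<in> sets borel})"

definition beta_mixing :: "'a measure \<Rightarrow> (int \<Rightarrow> 'a \<Rightarrow> 's::topological_space) \<Rightarrow> nat \<Rightarrow> real" where
  "beta_mixing M X k = (SUP l\<in>{1..}. beta_coeff M (sigma_gen M X {1..l}) (sigma_gen M X {l + int k..}))"

end

theory Submission
  imports Defs "HOL-Real_Asymp.Real_Asymp"
begin

text \<open>
  Put \<open>t = p + \<delta>\<close> and \<open>s = p (t - 1) / \<delta>\<close>; the mixing condition gives \<open>\<beta>(q) = O(q\<^sup>-\<^sup>s)\<close>. For \<open>n = 2\<^sup>N\<close> the expectation of
  \<open>min (max\<^sub>m\<^sub>\<le>\<^sub>n \<parallel>U\<^sub>m\<parallel>) n\<^sup>2\<^sup>/\<^sup>p\<close> is estimated by halving \<open>{1..n}\<close> repeatedly, which leaves the cross terms between the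
  two halves of each dyadic interval. There the last \<open>2 q\<close> indices of the left half are controlled by the
  first moments \<open>E \<parallel>h(X\<^sub>1, X\<^sub>j)\<parallel>\<close>. The other indices are cut into blocks of length \<open>q\<close>, and in each of the four
  parity classes any two blocks are at distance at least \<open>q\<close>; as a truncated quantity is considered, its
  expectation changes by at most a multiple of \<open>\<beta>(q) n\<^sup>2\<^sup>/\<^sup>p\<close> per block when the blocks are replaced by independent
  ones. Fixing the positions inside the blocks, one is left with a U-statistic of i.i.d. variables, which is
  treated by truncating \<open>h\<close> at a level \<open>a\<close>, recentring it to preserve degeneracy, and the Rademacher--Menshov
  maximal inequality. With \<open>q = n\<^sup>c\<close> and \<open>a = n\<^sup>\<alpha>\<close>, where \<open>1 / (s + 1) < c < 1 / s\<close> and \<open>\<alpha>\<close> is slightly above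
  \<open>2 (p - 1) / (p (t - 1))\<close>, all error terms divided by \<open>n\<^sup>2\<^sup>/\<^sup>p\<close> are summable over \<open>N\<close>.
\<close>

section \<open>Absolute regularity and decoupling\<close>

text \<open>Absolute regularity compares laws in total variation, so it controls bounded functionals
  only, while for dependent pairs nothing beyond a first moment is available. This forces the
  truncation at \<open>L = n powr (2 / p)\<close>; since \<open>min _ L\<close> is subadditive it
  passes through every triangle inequality, and almost surely it is inactive in the limit. Halving
  replaces the triangle \<open>i < j\<close> by rectangles: there the two index sets are disjoint,
  so after decoupling the recentred kernel has orthogonal summands. Up to powers of
  \<open>log n\<close> the costs are: \<open>n q\<close> for indices too close to decouple;
  \<open>L n \<beta>(q) / q\<close>, one \<open>\<beta>(q)\<close> for each of about
  \<open>n / q\<close> blocks; \<open>n q a powr (1 - t / 2)\<close> for the square-integrable part,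
  namely \<open>q^2\<close> pairs of positions times a U-statistic of \<open>n / q\<close>
  variables; and \<open>n^2 a powr (1 - t)\<close> for what the truncation of \<open>h\<close>
  discards. Dividing by \<open>L\<close> gives the conditions on \<open>c\<close> and
  \<open>\<alpha>\<close>; the first cost is dominated by the third because
  \<open>t < 2\<close>.\<close>

lemma abs_joint_sum_le_2:
  assumes "prob_space M" and F: "subalgebra M F" and G: "subalgebra M G"
    and P: "P \<in> finite_partitions F" and Q: "Q \<in> finite_partitions G"
  shows "(\<Sum>A\<in>P. \<Sum>B\<in>Q. \<bar>measure M (A \<inter> B) - measure M A * measure M B\<bar>) \<le> 2"
proof -
  interpret prob_space M by fact
  have P': "finite P" "partition_on (space M) P" "P \<subseteq> sets M"
    using P F by (auto simp: finite_partitions_def subalgebra_def)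
  have Q': "finite Q" "partition_on (space M) Q" "Q \<subseteq> sets M"
    using Q G by (auto simp: finite_partitions_def subalgebra_def)
  have tot: "(\<Sum>A\<in>R. measure M (C \<inter> A)) = measure M C"
    if "finite R" "partition_on (space M) R" "R \<subseteq> sets M" "C \<in> sets M" for R C
  proof -
    have "(\<Sum>A\<in>R. measure M (C \<inter> A)) = measure M (\<Union>A\<in>R. C \<inter> A)"
      using that by (intro finite_measure_finite_Union[symmetric])
        (fastforce simp: disjoint_family_on_def partition_on_def disjoint_def)+
    also have "(\<Union>A\<in>R. C \<inter> A) = C"
      using that sets.sets_into_space[of C M] by (auto simp: partition_on_def)
    finally show ?thesis .
  qed
  have tot1: "(\<Sum>A\<in>R. measure M A) = 1"
    if "finite R" "partition_on (space M) R" "R \<subseteq> sets M" for R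
  proof -
    have "(\<Sum>A\<in>R. measure M A) = (\<Sum>A\<in>R. measure M (space M \<inter> A))"
      using that(3) sets.sets_into_space by (intro sum.cong refl) (simp add: Int_absorb1 subset_eq)
    with tot[OF that, of "space M"] show ?thesis by (simp add: prob_space)
  qed
  have "(\<Sum>A\<in>P. \<Sum>B\<in>Q. \<bar>measure M (A \<inter> B) - measure M A * measure M B\<bar>)
     \<le> (\<Sum>A\<in>P. \<Sum>B\<in>Q. measure M (A \<inter> B) + measure M A * measure M B)"
    by (intro sum_mono) (auto simp: abs_le_iff intro: add_nonneg_nonneg)
  also have "\<dots> = (\<Sum>A\<in>P. measure M A) + (\<Sum>A\<in>P. measure M A * (\<Sum>B\<in>Q. measure M B))"
    using tot[OF Q'] P'(3) by (simp add: sum.distrib sum_distrib_left subset_eq)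
  also have "\<dots> = 2" using tot1[OF P'] tot1[OF Q'] by simp
  finally show ?thesis .
qed

text \<open>A real-valued \<open>SUP\<close> is informative only over a bounded family; lower
  estimates and monotonicity of \<open>beta_coeff\<close> rest on this.\<close>

lemma bdd_above_beta_coeff:
  assumes "prob_space M" "subalgebra M F" "subalgebra M G"
  shows "bdd_above ((\<lambda>(P, Q). \<Sum>A\<in>P. \<Sum>B\<in>Q. \<bar>measure M (A \<inter> B) - measure M A * measure M B\<bar>)
    ` (finite_partitions F \<times> finite_partitions G))"
  using abs_joint_sum_le_2[OF assms] by (intro bdd_aboveI[of _ 2]) auto

lemma beta_coeff_ge:
  assumes "prob_space M" "subalgebra M F" "subalgebra M G"
    and "P \<in> finite_partitions F" "Q \<in> finite_partitions G"
  shows "(\<Sum>A\<in>P. \<Sum>B\<in>Q. \<bar>measure M (A \<inter> B) - measure M A * measure M B\<bar>) \<le> 2 * beta_coeff M F G"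
  using cSUP_upper[OF _ bdd_above_beta_coeff[OF assms(1-3)], of "(P, Q)"] assms(4,5)
  by (simp add: beta_coeff_def)

text \<open>Blocks of \<open>partition_on\<close> are nonempty, so \<open>{}\<close> is removed to
  cover the case of an empty space.\<close>

lemma finite_partitions_trivial: "{space F} - {{}} \<in> finite_partitions F"
  by (auto simp: finite_partitions_def partition_on_def disjoint_def)

lemma finite_partitions_nonempty: "finite_partitions F \<noteq> {}"
  using finite_partitions_trivial by blast

lemma beta_coeff_le_1:
  assumes "prob_space M" "subalgebra M F" "subalgebra M G"
  shows "beta_coeff M F G \<le> 1"
proof -
  have "(SUP (P, Q) \<in> finite_partitions F \<times> finite_partitions G.
        \<Sum>A\<in>P. \<Sum>B\<in>Q. \<bar>measure M (A \<inter> B) - measure M A * measure M B\<bar>) \<le> 2"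
    using abs_joint_sum_le_2[OF assms] finite_partitions_nonempty by (intro cSUP_least) auto
  then show ?thesis by (simp add: beta_coeff_def)
qed

lemma beta_coeff_nonneg:
  assumes "prob_space M" "subalgebra M F" "subalgebra M G"
  shows "0 \<le> beta_coeff M F G"
proof -
  have "0 \<le> (\<Sum>A\<in>{space F} - {{}}. \<Sum>B\<in>{space G} - {{}}. \<bar>measure M (A \<inter> B) - measure M A * measure M B\<bar>)"
    by (intro sum_nonneg) auto
  also note beta_coeff_ge[OF assms finite_partitions_trivial finite_partitions_trivial]
  finally show ?thesis by simp
qed

lemma beta_coeff_mono:
  assumes "prob_space M" "subalgebra M F" "subalgebra M G" "subalgebra F F'" "subalgebra G G'"
  shows "beta_coeff M F' G' \<le> beta_coeff M F G"
  unfolding beta_coeff_def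
proof (intro mult_left_mono cSUP_subset_mono bdd_above_beta_coeff assms)
  show "finite_partitions F' \<times> finite_partitions G' \<noteq> {}" using finite_partitions_nonempty by auto
  show "finite_partitions F' \<times> finite_partitions G' \<subseteq> finite_partitions F \<times> finite_partitions G"
    using assms(4,5) by (auto simp: finite_partitions_def subalgebra_def)
qed auto

text \<open>The level sets of \<open>f\<close> and \<open>g\<close> are the two partitions. An event
  about the pair of values is a disjoint union of rectangles of such level sets, so its error is
  part of the double sum that defines \<open>beta_coeff\<close>.\<close>

lemma simple_rectangles_beta:
  fixes f g :: "'a \<Rightarrow> nat"
  assumes "prob_space M" and F: "subalgebra M F" and G: "subalgebra M G"
    and f: "f \<in> F \<rightarrow>\<^sub>M count_space UNIV" "finite (f ` space M)"
    and g: "g \<in> G \<rightarrow>\<^sub>M count_space UNIV" "finite (g ` space M)"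
  shows "\<bar>measure M {\<omega>\<in>space M. (f \<omega>, g \<omega>) \<in> T} -
      measure (M \<Otimes>\<^sub>M M) {z\<in>space (M \<Otimes>\<^sub>M M). (f (fst z), g (snd z)) \<in> T}\<bar> \<le> 2 * beta_coeff M F G"
proof -
  interpret prob_space M by fact
  interpret MM: pair_prob_space M M ..
  let ?P = "(\<lambda>a. f -` {a} \<inter> space M) ` f ` space M"
  let ?Q = "(\<lambda>b. g -` {b} \<inter> space M) ` g ` space M"
  have spF: "space F = space M" "space G = space M" using F G by (auto simp: subalgebra_def)
  have setF: "f -` {a} \<inter> space M \<in> sets F" for a
    using measurable_sets[OF f(1), of "{a}"] by (simp add: spF)
  have setG: "g -` {a} \<inter> space M \<in> sets G" for a
    using measurable_sets[OF g(1), of "{a}"] by (simp add: spF)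
  have [measurable]: "f \<in> M \<rightarrow>\<^sub>M count_space UNIV" "g \<in> M \<rightarrow>\<^sub>M count_space UNIV"
    using measurable_from_subalg[OF F f(1)] measurable_from_subalg[OF G g(1)] by auto
  have P: "?P \<in> finite_partitions F"
    using f(2) setF by (auto simp: finite_partitions_def partition_on_def disjoint_def spF)
  have Q: "?Q \<in> finite_partitions G"
    using g(2) setG by (auto simp: finite_partitions_def partition_on_def disjoint_def spF)
  have injf: "inj_on (\<lambda>a. f -` {a} \<inter> space M) (f ` space M)" by (auto simp: inj_on_def)
  have injg: "inj_on (\<lambda>b. g -` {b} \<inter> space M) (g ` space M)" by (auto simp: inj_on_def)
  define R where "R = (f ` space M \<times> g ` space M) \<inter> T"
  have finR: "finite R" using f(2) g(2) by (auto simp: R_def)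
  let ?d = "\<lambda>a b. (f -` {a} \<inter> space M) \<inter> (g -` {b} \<inter> space M)"
  have set1: "?d a b \<in> sets M" for a b by measurable
  have "{\<omega>\<in>space M. (f \<omega>, g \<omega>) \<in> T} = (\<Union>x\<in>R. ?d (fst x) (snd x))"
    by (fastforce simp: R_def)
  then have "measure M {\<omega>\<in>space M. (f \<omega>, g \<omega>) \<in> T} = measure M (\<Union>x\<in>R. ?d (fst x) (snd x))"
    by simp
  also have "\<dots> = (\<Sum>x\<in>R. measure M (?d (fst x) (snd x)))"
    using finR set1 by (intro finite_measure_finite_Union) (auto simp: disjoint_family_on_def)
  finally have eq1: "measure M {\<omega>\<in>space M. (f \<omega>, g \<omega>) \<in> T} = (\<Sum>x\<in>R. measure M (?d (fst x) (snd x)))" .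
  let ?e = "\<lambda>a b. (f -` {a} \<inter> space M) \<times> (g -` {b} \<inter> space M)"
  have set2: "?e a b \<in> sets (M \<Otimes>\<^sub>M M)" for a b
    using setF setG F G by (intro pair_measureI) (auto simp: subalgebra_def)
  have "{z\<in>space (M \<Otimes>\<^sub>M M). (f (fst z), g (snd z)) \<in> T} = (\<Union>x\<in>R. ?e (fst x) (snd x))"
    by (fastforce simp: R_def space_pair_measure)
  then have "measure (M \<Otimes>\<^sub>M M) {z\<in>space (M \<Otimes>\<^sub>M M). (f (fst z), g (snd z)) \<in> T}
      = measure (M \<Otimes>\<^sub>M M) (\<Union>x\<in>R. ?e (fst x) (snd x))"
    by simp
  also have "\<dots> = (\<Sum>x\<in>R. measure (M \<Otimes>\<^sub>M M) (?e (fst x) (snd x)))"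
    using finR set2 by (intro MM.finite_measure_finite_Union) (auto simp: disjoint_family_on_def)
  also have "\<dots> = (\<Sum>x\<in>R. measure M (f -` {fst x} \<inter> space M) * measure M (g -` {snd x} \<inter> space M))"
    using setF setG F G
    by (intro sum.cong refl)
      (auto simp: subalgebra_def measure_def emeasure_pair_measure_Times enn2real_mult subset_eq)
  finally have eq2: "measure (M \<Otimes>\<^sub>M M) {z\<in>space (M \<Otimes>\<^sub>M M). (f (fst z), g (snd z)) \<in> T}
     = (\<Sum>x\<in>R. measure M (f -` {fst x} \<inter> space M) * measure M (g -` {snd x} \<inter> space M))" .
  have "\<bar>measure M {\<omega>\<in>space M. (f \<omega>, g \<omega>) \<in> T} -
      measure (M \<Otimes>\<^sub>M M) {z\<in>space (M \<Otimes>\<^sub>M M). (f (fst z), g (snd z)) \<in> T}\<bar>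
     \<le> (\<Sum>x\<in>R. \<bar>measure M (?d (fst x) (snd x)) -
            measure M (f -` {fst x} \<inter> space M) * measure M (g -` {snd x} \<inter> space M)\<bar>)"
    unfolding eq1 eq2 sum_subtractf[symmetric] by (rule sum_abs)
  also have "\<dots> \<le> (\<Sum>x\<in>f ` space M \<times> g ` space M. \<bar>measure M (?d (fst x) (snd x)) -
            measure M (f -` {fst x} \<inter> space M) * measure M (g -` {snd x} \<inter> space M)\<bar>)"
    using f(2) g(2) by (intro sum_mono2) (auto simp: R_def)
  also have "\<dots> = (\<Sum>a\<in>f ` space M. \<Sum>b\<in>g ` space M. \<bar>measure M (?d a b) -
            measure M (f -` {a} \<inter> space M) * measure M (g -` {b} \<inter> space M)\<bar>)"
    by (simp add: sum.cartesian_product case_prod_unfold)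
  also have "\<dots> = (\<Sum>A\<in>?P. \<Sum>B\<in>?Q. \<bar>measure M (A \<inter> B) - measure M A * measure M B\<bar>)"
    by (simp add: sum.reindex[OF injf] sum.reindex[OF injg])
  also have "\<dots> \<le> 2 * beta_coeff M F G"
    by (rule beta_coeff_ge[OF assms(1-3) P Q])
  finally show ?thesis .
qed

text \<open>Induction over \<open>sigma_sets\<close>. One \<open>D\<close> has to serve both
  measures, because the joint law and the product law are later compared through it. In a countable
  union, finitely many members exhaust the union up to \<open>e / 2\<close> under both measures, and
  their own errors share the other \<open>e / 2\<close>.\<close>

lemma sigma_algebra_approx:
  assumes "finite_measure \<mu>" "finite_measure \<nu>" "sets \<mu> = sigma_sets \<Omega> \<A>" "sets \<nu> = sets \<mu>"
    and "algebra \<Omega> \<D>" "\<A> \<subseteq> \<D>" "\<D> \<subseteq> sets \<mu>"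
    and "C \<in> sets \<mu>" "0 < e"
  shows "\<exists>D\<in>\<D>. measure \<mu> (sym_diff C D) < e \<and> measure \<nu> (sym_diff C D) < e"
proof -
  interpret mu: finite_measure \<mu> by fact
  interpret nu: finite_measure \<nu> by fact
  interpret D: algebra \<Omega> \<D> by fact
  have sp: "space \<mu> = \<Omega>"
    using assms(5,7) sets.sets_into_space[of \<Omega> \<mu>] D.top sets.top[of \<mu>] assms(3,6) D.space_closed
    by (metis Pow_iff order.trans sigma_sets_into_sp subset_antisym subset_eq)
  have "C \<in> sigma_sets \<Omega> \<A>" using assms by simp
  then show ?thesis using \<open>0 < e\<close>
  proof (induction arbitrary: e)
    case (Basic a)
    then show ?case using assms(6) by (intro bexI[of _ a]) auto
  next
    case Empty
    then show ?case by (intro bexI[of _ "{}"]) auto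
  next
    case (Compl a)
    then obtain D where D: "D \<in> \<D>" "measure \<mu> (sym_diff a D) < e" "measure \<nu> (sym_diff a D) < e"
      by blast
    have "a \<subseteq> \<Omega>" using Compl.hyps assms(3) sets.sets_into_space sp by metis
    moreover have "D \<subseteq> \<Omega>" using D.space_closed D(1) by auto
    ultimately have "sym_diff (\<Omega> - a) (\<Omega> - D) = sym_diff a D" by auto
    then show ?case using D by (intro bexI[of _ "\<Omega> - D"]) auto
  next
    case (Union a)
    have aS [measurable]: "a i \<in> sets \<mu>" "a i \<in> sets \<nu>" for i
      using Union.hyps assms(3,4) by auto
    let ?T = "\<lambda>n. (\<Union>i. a i) - (\<Union>i<n. a i)"
    have *: "decseq ?T" "(\<Inter>n. ?T n) = {}"
      unfolding decseq_def by fastforce+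
    have "(\<lambda>n. measure \<mu> (?T n)) \<longlonglongrightarrow> measure \<mu> (\<Inter>n. ?T n)"
      using aS * by (intro mu.finite_Lim_measure_decseq) auto
    moreover have "(\<lambda>n. measure \<nu> (?T n)) \<longlonglongrightarrow> measure \<nu> (\<Inter>n. ?T n)"
      using aS * by (intro nu.finite_Lim_measure_decseq) auto
    ultimately have "\<forall>\<^sub>F n in sequentially. measure \<mu> (?T n) < e / 2 \<and> measure \<nu> (?T n) < e / 2"
      using Union.prems unfolding *(2) by (intro eventually_conj order_tendstoD(2)) auto
    then obtain n where n: "measure \<mu> (?T n) < e / 2" "measure \<nu> (?T n) < e / 2"
      by (auto simp: eventually_sequentially)
    have "\<exists>D. D \<in> \<D> \<and> measure \<mu> (sym_diff (a i) D) < e / (2 * Suc n) \<and>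
        measure \<nu> (sym_diff (a i) D) < e / (2 * Suc n)" for i
      using Union.IH[of "e / (2 * Suc n)" i] Union.prems by auto
    then obtain D where D: "\<And>i. D i \<in> \<D>" "\<And>i. measure \<mu> (sym_diff (a i) (D i)) < e / (2 * Suc n)"
        "\<And>i. measure \<nu> (sym_diff (a i) (D i)) < e / (2 * Suc n)"
      by metis
    have DS [measurable]: "D i \<in> sets \<mu>" "D i \<in> sets \<nu>" for i using D(1) assms(4,7) by auto
    have bound: "measure \<rho> (sym_diff (\<Union>i. a i) (\<Union>i<n. D i)) < e"
      if "finite_measure \<rho>" and [measurable_cong]: "sets \<rho> = sets \<mu>" and "measure \<rho> (?T n) < e / 2"
        and d: "\<And>i. measure \<rho> (sym_diff (a i) (D i)) < e / (2 * Suc n)" for \<rho>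
    proof -
      interpret rho: finite_measure \<rho> by fact
      have aS' [measurable]: "a i \<in> sets \<rho>" "D i \<in> sets \<rho>" for i using aS DS that(2) by auto
      have "measure \<rho> (sym_diff (\<Union>i. a i) (\<Union>i<n. D i))
          \<le> measure \<rho> (?T n \<union> (\<Union>i<n. sym_diff (a i) (D i)))"
        by (intro rho.finite_measure_mono) (fastforce, measurable)
      also have "\<dots> \<le> measure \<rho> (?T n) + measure \<rho> (\<Union>i<n. sym_diff (a i) (D i))"
        by (intro measure_Un_le) measurable
      also have "measure \<rho> (\<Union>i<n. sym_diff (a i) (D i)) \<le> (\<Sum>i<n. measure \<rho> (sym_diff (a i) (D i)))"
        by (intro measure_UNION_le) auto
      also have "\<dots> \<le> (\<Sum>i<n. e / (2 * Suc n))" using d by (intro sum_mono less_imp_le)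
      also have "\<dots> \<le> e / 2" using Union.prems by (simp add: field_simps)
      finally show ?thesis using that(3) by simp
    qed
    show ?case
    proof (intro bexI[of _ "\<Union>i<n. D i"] conjI)
      show "measure \<mu> (sym_diff (\<Union>i. a i) (\<Union>i<n. D i)) < e"
        by (intro bound mu.finite_measure_axioms n D refl)
      show "measure \<nu> (sym_diff (\<Union>i. a i) (\<Union>i<n. D i)) < e"
        by (intro bound nu.finite_measure_axioms n D assms(4))
    qed (use D(1) in auto)
  qed
qed


section \<open>Comparison of a joint law with the product law\<close>

lemma measurable_id_subalgebra: "subalgebra M F \<Longrightarrow> (\<lambda>x. x) \<in> M \<rightarrow>\<^sub>M F"
  by (auto simp: subalgebra_def measurable_def)

lemma measurable_diagonal:
  assumes "subalgebra M F" "subalgebra M G"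
  shows "(\<lambda>\<omega>. (\<omega>, \<omega>)) \<in> M \<rightarrow>\<^sub>M F \<Otimes>\<^sub>M G"
  using assms by (intro measurable_Pair measurable_id_subalgebra)

lemma measurable_id_pair:
  assumes "subalgebra M F" "subalgebra M G"
  shows "(\<lambda>z. z) \<in> M \<Otimes>\<^sub>M M \<rightarrow>\<^sub>M F \<Otimes>\<^sub>M G"
  using measurable_Pair[OF measurable_compose[OF measurable_fst measurable_id_subalgebra[OF assms(1)]]
      measurable_compose[OF measurable_snd measurable_id_subalgebra[OF assms(2)]]] by simp

text \<open>The image of \<open>M\<close> on the diagonal is the joint law of \<open>F\<close> and
  \<open>G\<close>. On the algebra of finite unions of rectangles the bound is
  \<open>simple_rectangles_beta\<close>; simultaneous approximation under the joint and the product
  law carries it to every product-measurable set.\<close>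

lemma measure_diagonal_beta:
  assumes "prob_space M" and F: "subalgebra M F" and G: "subalgebra M G"
    and C: "C \<in> sets (F \<Otimes>\<^sub>M G)"
  shows "measure M {\<omega>\<in>space M. (\<omega>, \<omega>) \<in> C} \<le> measure (M \<Otimes>\<^sub>M M) C + 2 * beta_coeff M F G"
proof -
  interpret prob_space M by fact
  interpret MM: pair_prob_space M M ..
  have sp: "space F = space M" "space G = space M" using F G by (auto simp: subalgebra_def)
  note diag = measurable_diagonal[OF F G] and idFG = measurable_id_pair[OF F G]
  define \<mu> where "\<mu> = distr M (F \<Otimes>\<^sub>M G) (\<lambda>\<omega>. (\<omega>, \<omega>))"
  define \<nu> where "\<nu> = distr (M \<Otimes>\<^sub>M M) (F \<Otimes>\<^sub>M G) (\<lambda>z. z)"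
  interpret mu: prob_space \<mu> unfolding \<mu>_def by (rule prob_space_distr[OF diag])
  interpret nu: prob_space \<nu> unfolding \<nu>_def by (rule MM.prob_space_distr[OF idFG])
  have setsmu [measurable_cong]: "sets \<mu> = sets (F \<Otimes>\<^sub>M G)" "sets \<nu> = sets (F \<Otimes>\<^sub>M G)"
    by (simp_all add: \<mu>_def \<nu>_def)
  have mu_eq: "measure \<mu> D = measure M {\<omega>\<in>space M. (\<omega>, \<omega>) \<in> D}" if "D \<in> sets (F \<Otimes>\<^sub>M G)" for D
    unfolding \<mu>_def using that by (subst measure_distr[OF diag]) (auto intro!: arg_cong[of _ _ "measure M"])
  have nu_eq: "measure \<nu> D = measure (M \<Otimes>\<^sub>M M) D" if "D \<in> sets (F \<Otimes>\<^sub>M G)" for D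
  proof -
    have "D \<subseteq> space (M \<Otimes>\<^sub>M M)"
      using sets.sets_into_space[OF that] by (simp add: space_pair_measure sp)
    then show ?thesis
      unfolding \<nu>_def using that by (subst measure_distr[OF idFG]) (auto simp: Int_absorb2)
  qed
  \<comment> \<open>Describing finite unions of rectangles by two simple functions and an arbitrary
    set \<open>T\<close> of values makes complements trivial (\<open>- T\<close>); for unions a
    common refinement is needed, which \<open>prod_encode\<close> supplies.\<close>
  define S where "S f g T = {z\<in>space M \<times> space M. (f (fst z), g (snd z)) \<in> T}"
    for f g :: "'a \<Rightarrow> nat" and T :: "(nat \<times> nat) set"
  define simpleF where "simpleF = {f :: 'a \<Rightarrow> nat. f \<in> F \<rightarrow>\<^sub>M count_space UNIV \<and> finite (f ` space M)}"
  define simpleG where "simpleG = {f :: 'a \<Rightarrow> nat. f \<in> G \<rightarrow>\<^sub>M count_space UNIV \<and> finite (f ` space M)}"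
  define \<D> where "\<D> = {S f g T | f g T. f \<in> simpleF \<and> g \<in> simpleG}"
  have pairing: "(\<lambda>x. prod_encode (f x, f' x)) \<in> simpleF" if "f \<in> simpleF" "f' \<in> simpleF" for f f'
  proof -
    have "(\<lambda>x. prod_encode (f x, f' x)) ` space M \<subseteq> prod_encode ` (f ` space M \<times> f' ` space M)" by auto
    then show ?thesis using that unfolding simpleF_def by (auto dest: finite_subset)
  qed
  have pairing': "(\<lambda>x. prod_encode (f x, f' x)) \<in> simpleG" if "f \<in> simpleG" "f' \<in> simpleG" for f f'
  proof -
    have "(\<lambda>x. prod_encode (f x, f' x)) ` space M \<subseteq> prod_encode ` (f ` space M \<times> f' ` space M)" by auto
    then show ?thesis using that unfolding simpleG_def by (auto dest: finite_subset)
  qed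
  have \<D>_bound: "measure \<mu> D \<le> measure \<nu> D + 2 * beta_coeff M F G \<and> D \<in> sets (F \<Otimes>\<^sub>M G)" if "D \<in> \<D>" for D
  proof -
    obtain f g T where D: "D = S f g T" and f: "f \<in> F \<rightarrow>\<^sub>M count_space UNIV" "finite (f ` space M)"
      and g: "g \<in> G \<rightarrow>\<^sub>M count_space UNIV" "finite (g ` space M)"
      using \<open>D \<in> \<D>\<close> by (auto simp: \<D>_def simpleF_def simpleG_def)
    have [measurable]: "f \<in> F \<rightarrow>\<^sub>M count_space UNIV" "g \<in> G \<rightarrow>\<^sub>M count_space UNIV" by fact+
    have D': "D = {z\<in>space (F \<Otimes>\<^sub>M G). (f (fst z), g (snd z)) \<in> T}"
      by (auto simp: D S_def space_pair_measure sp)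
    have mD: "D \<in> sets (F \<Otimes>\<^sub>M G)" unfolding D' by measurable
    have "measure M {\<omega> \<in> space M. (\<omega>, \<omega>) \<in> D} = measure M {\<omega>\<in>space M. (f \<omega>, g \<omega>) \<in> T}"
      by (auto simp: D S_def intro!: arg_cong[of _ _ "measure M"])
    moreover have "D = {z\<in>space (M \<Otimes>\<^sub>M M). (f (fst z), g (snd z)) \<in> T}"
      by (auto simp: D S_def space_pair_measure)
    ultimately show ?thesis
      using simple_rectangles_beta[OF assms(1) F G f g, of T] mD by (simp add: mu_eq nu_eq)
  qed
  have alg: "algebra (space M \<times> space M) \<D>"
    unfolding algebra_iff_Un
  proof (intro conjI ballI)
    show "\<D> \<subseteq> Pow (space M \<times> space M)" by (auto simp: \<D>_def S_def)
    have z: "(\<lambda>_. 0) \<in> simpleF" "(\<lambda>_. 0) \<in> simpleG" by (auto simp: simpleF_def simpleG_def image_constant_conv)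
    have "{} = S (\<lambda>_. 0) (\<lambda>_. 0) {}" by (auto simp: S_def)
    then show "{} \<in> \<D>" unfolding \<D>_def using z by blast
  next
    fix D assume "D \<in> \<D>"
    then obtain f g T where "D = S f g T" "f \<in> simpleF" "g \<in> simpleG" by (auto simp: \<D>_def)
    moreover have "space M \<times> space M - S f g T = S f g (- T)" by (auto simp: S_def)
    ultimately show "space M \<times> space M - D \<in> \<D>" unfolding \<D>_def by blast
  next
    fix D D' assume "D \<in> \<D>" "D' \<in> \<D>"
    then obtain f g T f' g' T' where D: "D = S f g T" "f \<in> simpleF" "g \<in> simpleG"
        "D' = S f' g' T'" "f' \<in> simpleF" "g' \<in> simpleG" by (auto simp: \<D>_def)
    have "S f g T \<union> S f' g' T' = S (\<lambda>x. prod_encode (f x, f' x)) (\<lambda>x. prod_encode (g x, g' x))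
        {(a, b). (fst (prod_decode a), fst (prod_decode b)) \<in> T \<or> (snd (prod_decode a), snd (prod_decode b)) \<in> T'}"
      by (auto simp: S_def)
    then show "D \<union> D' \<in> \<D>" using D pairing pairing' unfolding \<D>_def by blast
  qed
  let ?\<A> = "{a \<times> b | a b. a \<in> sets F \<and> b \<in> sets G}"
  have sub: "?\<A> \<subseteq> \<D>"
  proof safe
    fix a b assume ab: "a \<in> sets F" "b \<in> sets G"
    have "a \<subseteq> space M" "b \<subseteq> space M" using ab sets.sets_into_space sp by metis+
    then have "a \<times> b = S (\<lambda>x. if x \<in> a then 1 else 0) (\<lambda>x. if x \<in> b then 1 else 0) {(1, 1)}"
      by (auto simp: S_def split: if_splits)
    moreover have "(\<lambda>x. if x \<in> a then 1 else 0) \<in> simpleF"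
    proof -
      have [measurable]: "a \<in> sets F" by fact
      have "(\<lambda>x. if x \<in> a then 1 else 0) ` space M \<subseteq> {0, 1 :: nat}" by auto
      moreover have "(\<lambda>x. if x \<in> a then 1 else 0 :: nat) \<in> F \<rightarrow>\<^sub>M count_space UNIV" by measurable
      ultimately show ?thesis unfolding simpleF_def by (auto dest: finite_subset)
    qed
    moreover have "(\<lambda>x. if x \<in> b then 1 else 0) \<in> simpleG"
    proof -
      have [measurable]: "b \<in> sets G" by fact
      have "(\<lambda>x. if x \<in> b then 1 else 0) ` space M \<subseteq> {0, 1 :: nat}" by auto
      moreover have "(\<lambda>x. if x \<in> b then 1 else 0 :: nat) \<in> G \<rightarrow>\<^sub>M count_space UNIV" by measurable
      ultimately show ?thesis unfolding simpleG_def by (auto dest: finite_subset)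
    qed
    ultimately show "a \<times> b \<in> \<D>" unfolding \<D>_def by blast
  qed
  have "measure \<mu> C \<le> measure \<nu> C + 2 * beta_coeff M F G + e" if "0 < e" for e
  proof -
    have "\<exists>D\<in>\<D>. measure \<mu> (sym_diff C D) < e / 2 \<and> measure \<nu> (sym_diff C D) < e / 2"
    proof (rule sigma_algebra_approx)
      show "sets \<mu> = sigma_sets (space M \<times> space M) ?\<A>"
        using setsmu sets_pair_measure[of F G] by (simp add: sp)
      show "\<D> \<subseteq> sets \<mu>" using \<D>_bound setsmu by auto
    qed (use setsmu alg sub C \<open>0 < e\<close> mu.finite_measure_axioms nu.finite_measure_axioms in auto)
    then obtain D where D: "D \<in> \<D>" "measure \<mu> (sym_diff C D) < e / 2" "measure \<nu> (sym_diff C D) < e / 2"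
      by blast
    have [measurable]: "D \<in> sets (F \<Otimes>\<^sub>M G)" "C \<in> sets (F \<Otimes>\<^sub>M G)" using \<D>_bound D(1) C by auto
    have "measure \<mu> C \<le> measure \<mu> (D \<union> sym_diff C D)"
      by (intro mu.finite_measure_mono) (auto, measurable)
    also have "\<dots> \<le> measure \<mu> D + measure \<mu> (sym_diff C D)" by (intro measure_Un_le) measurable
    finally have 1: "measure \<mu> C \<le> measure \<mu> D + measure \<mu> (sym_diff C D)" .
    have "measure \<nu> D \<le> measure \<nu> (C \<union> sym_diff C D)"
      by (intro nu.finite_measure_mono) (auto, measurable)
    also have "\<dots> \<le> measure \<nu> C + measure \<nu> (sym_diff C D)" by (intro measure_Un_le) measurable
    finally show ?thesis using 1 D \<D>_bound[OF D(1)] by simp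
  qed
  then have "measure \<mu> C \<le> measure \<nu> C + 2 * beta_coeff M F G" by (rule field_le_epsilon)
  then show ?thesis using C by (simp add: mu_eq nu_eq)
qed

text \<open>A discretised layer-cake formula: \<open>f\<close> is approximated from above, up to
  \<open>c = L / (n + 1)\<close>, by \<open>n + 1\<close> superlevel sets of weight
  \<open>c\<close>. Each of them costs \<open>b\<close>, which adds up to \<open>L * b\<close> for
  every \<open>n\<close>.\<close>

lemma nn_integral_le_of_measure_le:
  assumes "prob_space \<mu>" "prob_space \<nu>" "sets \<mu> = sets \<nu>" "0 \<le> b" "0 < L"
    and le: "\<And>C. C \<in> sets \<nu> \<Longrightarrow> measure \<mu> C \<le> measure \<nu> C + b"
    and f [measurable]: "f \<in> borel_measurable \<nu>" and bd: "\<And>x. f x \<le> ennreal L"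
  shows "(\<integral>\<^sup>+x. f x \<partial>\<mu>) \<le> (\<integral>\<^sup>+x. f x \<partial>\<nu>) + ennreal (L * b)"
proof -
  interpret mu: prob_space \<mu> by fact
  interpret nu: prob_space \<nu> by fact
  have [measurable_cong]: "sets \<mu> = sets \<nu>" by fact
  have key: "(\<integral>\<^sup>+x. f x \<partial>\<mu>) \<le> (\<integral>\<^sup>+x. f x \<partial>\<nu>) + ennreal (L * b) + ennreal (L / Suc n)" for n
  proof -
    define c where "c = L / Suc n"
    have c: "0 < c" using \<open>0 < L\<close> by (simp add: c_def)
    define g where "g x = (\<Sum>i<Suc n. ennreal c * indicator {x\<in>space \<nu>. ennreal (real i * c) < f x} x)" for x
    have g: "f x \<le> g x \<and> g x \<le> f x + ennreal c" if x: "x \<in> space \<nu>" for x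
    proof -
      obtain v where v: "f x = ennreal v" "0 \<le> v" "v \<le> L"
        using bd[of x] \<open>0 < L\<close> by (cases "f x") (auto simp: ennreal_le_iff2 top_unique)
      \<comment> \<open>The levels \<open>i * c\<close> strictly below the value \<open>v\<close>
        are exactly those with \<open>i < m\<close>.\<close>
      define m where "m = nat \<lceil>v / c\<rceil>"
      have "v / c \<le> L / c" using v c by (intro divide_right_mono) auto
      also have "L / c = real (Suc n)" using \<open>0 < L\<close> by (simp add: c_def)
      finally have m: "m \<le> Suc n" unfolding m_def by (simp add: nat_le_iff ceiling_le_iff)
      have lt: "real i * c < v \<longleftrightarrow> i < m" for i
      proof -
        have "real i * c < v \<longleftrightarrow> real i < v / c" using c by (simp add: field_simps)
        also have "\<dots> \<longleftrightarrow> int i < \<lceil>v / c\<rceil>" by (simp add: less_ceiling_iff)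
        also have "\<dots> \<longleftrightarrow> i < m" using v c unfolding m_def by (simp add: zless_nat_eq_int_zless)
        finally show ?thesis .
      qed
      have "g x = (\<Sum>i<Suc n. ennreal (c * (if i < m then 1 else 0)))"
        unfolding g_def using x c by (intro sum.cong refl) (auto simp: v ennreal_less_iff lt indicator_def)
      also have "\<dots> = ennreal (\<Sum>i<Suc n. c * (if i < m then 1 else 0))"
        using c by (intro sum_ennreal) auto
      also have "(\<Sum>i<Suc n. c * (if i < m then 1 else 0)) = c * real (card ({..<Suc n} \<inter> {i. i < m}))"
        by (simp add: sum_distrib_left[symmetric] sum.If_cases del: sum.lessThan_Suc)
      also have "{..<Suc n} \<inter> {i. i < m} = {..<m}" using m by auto
      finally have gx: "g x = ennreal (c * real m)" by simp
      have "v / c \<le> real m" "real m < v / c + 1" unfolding m_def using v c by (auto simp: of_nat_nat) linarith+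
      then have "v \<le> c * real m" "c * real m \<le> v + c" using c by (auto simp: field_simps)
      then show ?thesis using v c by (auto simp: gx ennreal_plus[symmetric] simp del: ennreal_plus intro!: ennreal_leI)
    qed
    have [measurable]: "{x \<in> space \<nu>. ennreal (real i * c) < f x} \<in> sets \<nu>" for i by measurable
    have int_g: "(\<integral>\<^sup>+x. g x \<partial>\<rho>) = (\<Sum>i<Suc n. ennreal (c * measure \<rho> {x \<in> space \<nu>. ennreal (real i * c) < f x}))"
      if "prob_space \<rho>" and [measurable_cong]: "sets \<rho> = sets \<nu>" for \<rho>
    proof -
      interpret rho: prob_space \<rho> by fact
      have "(\<integral>\<^sup>+x. g x \<partial>\<rho>) = (\<Sum>i<Suc n. \<integral>\<^sup>+x. ennreal c * indicator {x\<in>space \<nu>. ennreal (real i * c) < f x} x \<partial>\<rho>)"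
        unfolding g_def by (intro nn_integral_sum) measurable
      also have "\<dots> = (\<Sum>i<Suc n. ennreal c * emeasure \<rho> {x \<in> space \<nu>. ennreal (real i * c) < f x})"
        by (intro sum.cong refl nn_integral_cmult_indicator) measurable
      finally show ?thesis using c by (simp add: rho.emeasure_eq_measure ennreal_mult'')
    qed
    have "(\<integral>\<^sup>+x. f x \<partial>\<mu>) \<le> (\<integral>\<^sup>+x. g x \<partial>\<mu>)"
      using g sets_eq_imp_space_eq[OF assms(3)] by (intro nn_integral_mono) auto
    also have "\<dots> = (\<Sum>i<Suc n. ennreal (c * measure \<mu> {x \<in> space \<nu>. ennreal (real i * c) < f x}))"
      by (rule int_g) fact+
    also have "\<dots> \<le> (\<Sum>i<Suc n. ennreal (c * measure \<nu> {x \<in> space \<nu>. ennreal (real i * c) < f x}) + ennreal (c * b))"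
      using c \<open>0 \<le> b\<close> le
      by (intro sum_mono) (auto simp: ennreal_plus[symmetric] distrib_left[symmetric] simp del: ennreal_plus intro!: ennreal_leI mult_left_mono)
    also have "\<dots> = (\<integral>\<^sup>+x. g x \<partial>\<nu>) + (\<Sum>i<Suc n. ennreal (c * b))"
      by (subst int_g) (auto simp: sum.distrib assms)
    also have "(\<Sum>i<Suc n. ennreal (c * b)) = ennreal (\<Sum>i<Suc n. c * b)"
      using c \<open>0 \<le> b\<close> by (intro sum_ennreal) auto
    also have "(\<Sum>i<Suc n. c * b) = L * b" by (simp add: c_def field_simps)
    also have "(\<integral>\<^sup>+x. g x \<partial>\<nu>) \<le> (\<integral>\<^sup>+x. f x + ennreal c \<partial>\<nu>)"
      using g by (intro nn_integral_mono) auto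
    also have "\<dots> = (\<integral>\<^sup>+x. f x \<partial>\<nu>) + ennreal c"
      by (subst nn_integral_add) (auto simp: nu.emeasure_space_1)
    finally show ?thesis by (simp add: c_def add_ac)
  qed
  have "(\<lambda>n. (\<integral>\<^sup>+x. f x \<partial>\<nu>) + ennreal (L * b) + ennreal (L / Suc n))
      \<longlonglongrightarrow> (\<integral>\<^sup>+x. f x \<partial>\<nu>) + ennreal (L * b) + ennreal 0"
    by (intro tendsto_add tendsto_const tendsto_ennrealI LIMSEQ_Suc lim_const_over_n)
  then show ?thesis using key by (intro LIMSEQ_le_const) auto
qed

lemma nn_integral_diagonal_beta:
  assumes "prob_space M" and F: "subalgebra M F" and G: "subalgebra M G"
    and f: "case_prod f \<in> borel_measurable (F \<Otimes>\<^sub>M G)" and "\<And>x y. f x y \<le> ennreal L" "0 < L"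
  shows "(\<integral>\<^sup>+\<omega>. f \<omega> \<omega> \<partial>M) \<le> (\<integral>\<^sup>+\<omega>. \<integral>\<^sup>+\<omega>'. f \<omega> \<omega>' \<partial>M \<partial>M) + ennreal (L * (2 * beta_coeff M F G))"
proof -
  interpret prob_space M by fact
  interpret MM: pair_prob_space M M ..
  have sp: "space F = space M" "space G = space M" using F G by (auto simp: subalgebra_def)
  note diag = measurable_diagonal[OF F G] and idFG = measurable_id_pair[OF F G]
  have "(\<integral>\<^sup>+\<omega>. f \<omega> \<omega> \<partial>M) = (\<integral>\<^sup>+z. case_prod f z \<partial>distr M (F \<Otimes>\<^sub>M G) (\<lambda>\<omega>. (\<omega>, \<omega>)))"
    using f by (subst nn_integral_distr[OF diag]) auto
  also have "\<dots> \<le> (\<integral>\<^sup>+z. case_prod f z \<partial>distr (M \<Otimes>\<^sub>M M) (F \<Otimes>\<^sub>M G) (\<lambda>z. z)) + ennreal (L * (2 * beta_coeff M F G))"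
  proof (rule nn_integral_le_of_measure_le)
    fix C assume "C \<in> sets (distr (M \<Otimes>\<^sub>M M) (F \<Otimes>\<^sub>M G) (\<lambda>z. z))"
    then have C: "C \<in> sets (F \<Otimes>\<^sub>M G)" by simp
    have "C \<subseteq> space (M \<Otimes>\<^sub>M M)"
      using sets.sets_into_space[OF C] by (simp add: space_pair_measure sp)
    then have "measure (distr (M \<Otimes>\<^sub>M M) (F \<Otimes>\<^sub>M G) (\<lambda>z. z)) C = measure (M \<Otimes>\<^sub>M M) C"
      using C by (subst measure_distr[OF idFG]) (auto simp: Int_absorb2)
    moreover have "measure (distr M (F \<Otimes>\<^sub>M G) (\<lambda>\<omega>. (\<omega>, \<omega>))) C = measure M {\<omega>\<in>space M. (\<omega>, \<omega>) \<in> C}"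
      using C by (subst measure_distr[OF diag]) (auto intro!: arg_cong[of _ _ "measure M"])
    ultimately show "measure (distr M (F \<Otimes>\<^sub>M G) (\<lambda>\<omega>. (\<omega>, \<omega>))) C
        \<le> measure (distr (M \<Otimes>\<^sub>M M) (F \<Otimes>\<^sub>M G) (\<lambda>z. z)) C + 2 * beta_coeff M F G"
      using measure_diagonal_beta[OF assms(1) F G C] by simp
  qed (use f assms(5,6) beta_coeff_nonneg[OF assms(1) F G] prob_space_distr[OF diag]
      MM.prob_space_distr[OF idFG] in auto)
  also have "(\<integral>\<^sup>+z. case_prod f z \<partial>distr (M \<Otimes>\<^sub>M M) (F \<Otimes>\<^sub>M G) (\<lambda>z. z)) = (\<integral>\<^sup>+z. case_prod f z \<partial>(M \<Otimes>\<^sub>M M))"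
    using f by (subst nn_integral_distr[OF idFG]) auto
  also have "\<dots> = (\<integral>\<^sup>+\<omega>. \<integral>\<^sup>+\<omega>'. f \<omega> \<omega>' \<partial>M \<partial>M)"
    using measurable_compose[OF idFG f] by (subst nn_integral_fst[symmetric]) auto
  finally show ?thesis .
qed

text \<open>Dependence is encoded by feeding the same \<open>\<omega>\<close> to all coordinates, of
  which coordinate \<open>w\<close> is seen through \<open>G w\<close> only. The last coordinate is
  separated from all earlier ones, which live in \<open>H R\<close>, at the price of one
  coefficient; induction applies to the rest.\<close>

lemma nn_integral_decouple:
  fixes G H :: "nat \<Rightarrow> 'a measure"
  assumes "prob_space M"
    and "\<And>w. w < R \<Longrightarrow> subalgebra M (G w)" "\<And>w. w < R \<Longrightarrow> subalgebra M (H w)"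
    and "\<And>v w. v < w \<Longrightarrow> w < R \<Longrightarrow> subalgebra (H w) (G v)"
    and "\<And>w. w < R \<Longrightarrow> beta_coeff M (H w) (G w) \<le> b"
    and "f \<in> borel_measurable (PiM {..<R} G)"
    and "\<And>x. f x \<le> ennreal L" "0 < L" "0 \<le> b"
  shows "(\<integral>\<^sup>+\<omega>. f (\<lambda>w\<in>{..<R}. \<omega>) \<partial>M) \<le> (\<integral>\<^sup>+x. f x \<partial>PiM {..<R} (\<lambda>_. M)) + ennreal (L * (2 * b * R))"
  using assms(2-7)
proof (induction R arbitrary: f)
  case 0
  interpret prob_space M by fact
  have "(\<lambda>w\<in>{..<0::nat}. \<omega>) = (\<lambda>_. undefined)" for \<omega> :: 'a by (auto simp: restrict_def)
  then show ?case by (simp add: PiM_empty nn_integral_count_space_finite emeasure_space_1)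
next
  case (Suc R)
  interpret prob_space M by fact
  interpret MM: pair_prob_space M M ..
  interpret P: product_sigma_finite "\<lambda>_::nat. M" ..
  interpret PP: prob_space "PiM {..<R} (\<lambda>_. M)" by (intro prob_space_PiM prob_space_axioms)
  note [measurable] = Suc.prems(5)
  have idG: "(\<lambda>x. x) \<in> M \<rightarrow>\<^sub>M G w" if "w < Suc R" for w
    using measurable_id_subalgebra[OF Suc.prems(1)[OF that]] .
  have idHG: "(\<lambda>x. x) \<in> H R \<rightarrow>\<^sub>M G w" if "w < R" for w
    using measurable_id_subalgebra[OF Suc.prems(3)[OF that]] by simp
  have idPi: "(\<lambda>x. x) \<in> PiM {..<Suc R} (\<lambda>_. M) \<rightarrow>\<^sub>M PiM {..<Suc R} G"
  proof (rule measurable_PiM_single')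
    fix w assume "w \<in> {..<Suc R}"
    then show "(\<lambda>x. x w) \<in> PiM {..<Suc R} (\<lambda>_. M) \<rightarrow>\<^sub>M G w"
      using measurable_compose[OF measurable_component_singleton[of w "{..<Suc R}" "\<lambda>_. M"] idG[of w]] by simp
  next
    show "(\<lambda>x i. x i) \<in> space (PiM {..<Suc R} (\<lambda>_. M)) \<rightarrow> (\<Pi>\<^sub>E i\<in>{..<Suc R}. space (G i))"
      using Suc.prems(1) by (auto simp: space_PiM PiE_iff subalgebra_def)
  qed
  define \<Phi> where "\<Phi> x y = f ((\<lambda>w\<in>{..<R}. x)(R := y))" for x y
  have upd: "(\<lambda>w\<in>{..<R}. x)(R := y) = (\<lambda>w\<in>{..<Suc R}. if w < R then x else y)" for x y :: 'a
    by (auto simp: restrict_def fun_eq_iff)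
  have "(\<lambda>z. \<lambda>w\<in>{..<Suc R}. if w < R then fst z else snd z) \<in> H R \<Otimes>\<^sub>M G R \<rightarrow>\<^sub>M PiM {..<Suc R} G"
  proof (rule measurable_restrict)
    fix w assume "w \<in> {..<Suc R}"
    then consider "w < R" | "w = R" by force
    then show "(\<lambda>z. if w < R then fst z else snd z) \<in> H R \<Otimes>\<^sub>M G R \<rightarrow>\<^sub>M G w"
      by cases (auto intro: measurable_compose[OF measurable_fst idHG])
  qed
  from measurable_compose[OF this Suc.prems(5)]
  moreover have "case_prod \<Phi> = (\<lambda>z. f (\<lambda>w\<in>{..<Suc R}. if w < R then fst z else snd z))"
    by (simp add: \<Phi>_def upd case_prod_unfold)
  ultimately have \<Phi>: "case_prod \<Phi> \<in> borel_measurable (H R \<Otimes>\<^sub>M G R)"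
    by (simp only:)
  have "(\<lambda>z. z) \<in> M \<Otimes>\<^sub>M M \<rightarrow>\<^sub>M H R \<Otimes>\<^sub>M G R"
    using Suc.prems(1,2) by (intro measurable_id_pair) auto
  from measurable_compose[OF this \<Phi>] have \<Phi>M: "case_prod \<Phi> \<in> borel_measurable (M \<Otimes>\<^sub>M M)" by simp
  have \<Phi>_le: "\<Phi> x y \<le> ennreal L" for x y unfolding \<Phi>_def by (rule Suc.prems)
  have "(\<integral>\<^sup>+\<omega>. f (\<lambda>w\<in>{..<Suc R}. \<omega>) \<partial>M) = (\<integral>\<^sup>+\<omega>. \<Phi> \<omega> \<omega> \<partial>M)"
    unfolding \<Phi>_def upd by (intro nn_integral_cong arg_cong[of _ _ f]) (auto simp: restrict_def)
  also have "\<dots> \<le> (\<integral>\<^sup>+\<omega>. \<integral>\<^sup>+\<omega>'. \<Phi> \<omega> \<omega>' \<partial>M \<partial>M) + ennreal (L * (2 * beta_coeff M (H R) (G R)))"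
    using Suc.prems(1-3) \<Phi> \<Phi>_le \<open>0 < L\<close> by (intro nn_integral_diagonal_beta prob_space_axioms) auto
  \<comment> \<open>The last coordinate moves to the outer integral, so that the induction
    hypothesis can be used for each frozen value of it.\<close>
  also have "(\<integral>\<^sup>+\<omega>. \<integral>\<^sup>+\<omega>'. \<Phi> \<omega> \<omega>' \<partial>M \<partial>M) = (\<integral>\<^sup>+\<omega>'. \<integral>\<^sup>+\<omega>. \<Phi> \<omega> \<omega>' \<partial>M \<partial>M)"
    using MM.Fubini'[OF \<Phi>M] by simp
  also have "\<dots> \<le> (\<integral>\<^sup>+\<omega>'. (\<integral>\<^sup>+x. f (x(R := \<omega>')) \<partial>PiM {..<R} (\<lambda>_. M)) + ennreal (L * (2 * b * R)) \<partial>M)"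
  proof (rule nn_integral_mono)
    fix y assume y: "y \<in> space M"
    have yG: "y \<in> space (G R)" using y Suc.prems(1)[of R] by (simp add: subalgebra_def)
    have "(\<lambda>x. f (x(R := y))) \<in> borel_measurable (PiM {..<R} G)"
    proof (rule measurable_compose[OF _ Suc.prems(5)])
      show "(\<lambda>x. x(R := y)) \<in> PiM {..<R} G \<rightarrow>\<^sub>M PiM {..<Suc R} G"
        using yG by (intro measurable_fun_upd[where J="{..<R}"]) auto
    qed
    with Suc.prems show "(\<integral>\<^sup>+\<omega>. \<Phi> \<omega> y \<partial>M) \<le> (\<integral>\<^sup>+x. f (x(R := y)) \<partial>PiM {..<R} (\<lambda>_. M)) + ennreal (L * (2 * b * R))"
      unfolding \<Phi>_def by (intro Suc.IH[where f="\<lambda>x. f (x(R := y))"]) auto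
  qed
  also have "\<dots> = (\<integral>\<^sup>+\<omega>'. (\<integral>\<^sup>+x. f (x(R := \<omega>')) \<partial>PiM {..<R} (\<lambda>_. M)) \<partial>M) + ennreal (L * (2 * b * R))"
  proof -
    have [measurable]: "f \<in> borel_measurable (PiM (insert R {..<R}) (\<lambda>_. M))"
      using measurable_compose[OF idPi Suc.prems(5)] by (simp add: lessThan_Suc)
    show ?thesis by (subst nn_integral_add) (auto simp: emeasure_space_1)
  qed
  also have "(\<integral>\<^sup>+\<omega>'. (\<integral>\<^sup>+x. f (x(R := \<omega>')) \<partial>PiM {..<R} (\<lambda>_. M)) \<partial>M) = (\<integral>\<^sup>+x. f x \<partial>PiM {..<Suc R} (\<lambda>_. M))"
    using measurable_compose[OF idPi Suc.prems(5)]
    by (subst P.product_nn_integral_insert_rev[symmetric]) (auto simp: lessThan_Suc)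
  also have "\<dots> + ennreal (L * (2 * b * R)) + ennreal (L * (2 * beta_coeff M (H R) (G R)))
      \<le> \<dots> + ennreal (L * (2 * b * Suc R))"
  proof -
    have "0 \<le> beta_coeff M (H R) (G R)" 
      using beta_coeff_nonneg[OF assms(1) Suc.prems(2)[of R] Suc.prems(1)[of R]] by simp
    moreover have "L * (2 * b * R) + L * (2 * beta_coeff M (H R) (G R)) \<le> L * (2 * b * Suc R)"
      using Suc.prems(4)[of R] \<open>0 < L\<close> by (simp add: algebra_simps)
    ultimately show ?thesis using \<open>0 < L\<close> \<open>0 \<le> b\<close>
      by (auto simp: add.assoc ennreal_plus[symmetric] simp del: ennreal_plus intro!: add_left_mono ennreal_leI)
  qed
  finally show ?case by (simp add: add_right_mono)
qed

text \<open>The maps may vary with the coordinate as long as their laws agree. This turns decoupled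
  blocks, each evaluated at its own time, into i.i.d. variables with law
  \<open>\<mu>\<close>.\<close>

lemma distr_PiM_coordinatewise:
  assumes "finite I" and "prob_space M" and f: "\<And>i. i \<in> I \<Longrightarrow> f i \<in> M \<rightarrow>\<^sub>M N"
    and eq: "\<And>i. i \<in> I \<Longrightarrow> distr M N (f i) = \<mu>"
    and "prob_space \<mu>"
  shows "distr (PiM I (\<lambda>_. M)) (PiM I (\<lambda>_. \<mu>)) (\<lambda>x. \<lambda>i\<in>I. f i (x i)) = PiM I (\<lambda>_. \<mu>)"
proof -
  interpret prob_space M by fact
  interpret mu: prob_space \<mu> by fact
  interpret P: product_prob_space "\<lambda>_. M" I ..
  interpret Q: product_prob_space "\<lambda>_. \<mu>" I ..
  have f': "f i \<in> M \<rightarrow>\<^sub>M \<mu>" if "i \<in> I" for i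
    using f[OF that] eq[OF that] by (metis measurable_distr_eq2 sets_distr measurable_cong_sets)
  have meas: "(\<lambda>x. \<lambda>i\<in>I. f i (x i)) \<in> PiM I (\<lambda>_. M) \<rightarrow>\<^sub>M PiM I (\<lambda>_. \<mu>)"
    using f' by (intro measurable_restrict) auto
  show ?thesis
  proof (rule Q.PiM_eqI[OF \<open>finite I\<close>])
    fix A assume A: "\<And>i. i \<in> I \<Longrightarrow> A i \<in> sets \<mu>"
    have "emeasure (distr (PiM I (\<lambda>_. M)) (PiM I (\<lambda>_. \<mu>)) (\<lambda>x. \<lambda>i\<in>I. f i (x i))) (Pi\<^sub>E I A)
        = emeasure (PiM I (\<lambda>_. M)) ((\<lambda>x. \<lambda>i\<in>I. f i (x i)) -` Pi\<^sub>E I A \<inter> space (PiM I (\<lambda>_. M)))"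
      using A \<open>finite I\<close> by (intro emeasure_distr meas sets_PiM_I_finite) auto
    also have "(\<lambda>x. \<lambda>i\<in>I. f i (x i)) -` Pi\<^sub>E I A \<inter> space (PiM I (\<lambda>_. M)) = (\<Pi>\<^sub>E i\<in>I. f i -` A i \<inter> space M)"
      by (auto simp: space_PiM PiE_iff)
    also have "emeasure (PiM I (\<lambda>_. M)) \<dots> = (\<Prod>i\<in>I. emeasure M (f i -` A i \<inter> space M))"
      using A f' \<open>finite I\<close> by (intro P.emeasure_PiM) (auto intro: measurable_sets)
    also have "\<dots> = (\<Prod>i\<in>I. emeasure \<mu> (A i))"
    proof (intro prod.cong refl)
      fix i assume i: "i \<in> I"
      have "A i \<in> sets N" using A[OF i] eq[OF i] by (metis sets_distr)
      then show "emeasure M (f i -` A i \<inter> space M) = emeasure \<mu> (A i)"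
        using eq[OF i] emeasure_distr[OF f[OF i]] by metis
    qed
    finally show "emeasure (distr (PiM I (\<lambda>_. M)) (PiM I (\<lambda>_. \<mu>)) (\<lambda>x. \<lambda>i\<in>I. f i (x i))) (Pi\<^sub>E I A)
      = (\<Prod>i\<in>I. emeasure \<mu> (A i))" .
  qed simp
qed

section \<open>Maxima of partial sums\<close>

text \<open>\<open>V = 0\<close> is in the range, so the maximum is taken over a nonempty set and is
  nonnegative. The offset \<open>c\<close> serves the induction by halves.\<close>

definition max_partial :: "(nat \<Rightarrow> 'h::real_normed_vector) \<Rightarrow> nat \<Rightarrow> nat \<Rightarrow> real" where
  "max_partial z c n = Max ((\<lambda>V. norm (\<Sum>v\<in>{c..<c+V}. z v)) ` {..n})"

lemma max_partial_nonneg: "0 \<le> max_partial z c n"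
  unfolding max_partial_def by (rule Max_ge_iff[THEN iffD2]) auto

lemma max_partial_ge: "V \<le> n \<Longrightarrow> norm (\<Sum>v\<in>{c..<c+V}. z v) \<le> max_partial z c n"
  unfolding max_partial_def by (rule Max_ge) auto

lemma max_partial_add:
  "max_partial z c (n + m) \<le> max (max_partial z c n) (norm (\<Sum>v\<in>{c..<c+n}. z v) + max_partial z (c + n) m)"
proof -
  have "norm (\<Sum>v\<in>{c..<c+V}. z v)
      \<le> max (max_partial z c n) (norm (\<Sum>v\<in>{c..<c+n}. z v) + max_partial z (c + n) m)"
    if V: "V \<le> n + m" for V
  proof (cases "V \<le> n")
    case True
    then show ?thesis by (intro max.coboundedI1 max_partial_ge)
  next
    case False
    then have "{c..<c+V} = {c..<c+n} \<union> {c+n..<c+n+(V-n)}" by auto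
    then have "(\<Sum>v\<in>{c..<c+V}. z v) = (\<Sum>v\<in>{c..<c+n}. z v) + (\<Sum>v\<in>{c+n..<c+n+(V-n)}. z v)"
      by (simp add: sum.union_disjoint)
    also have "norm \<dots> \<le> norm (\<Sum>v\<in>{c..<c+n}. z v) + norm (\<Sum>v\<in>{c+n..<c+n+(V-n)}. z v)"
      by (rule norm_triangle_ineq)
    also have "\<dots> \<le> norm (\<Sum>v\<in>{c..<c+n}. z v) + max_partial z (c + n) m"
      using V by (intro add_left_mono max_partial_ge) auto
    finally show ?thesis by (rule max.coboundedI2)
  qed
  then show ?thesis by (subst max_partial_def) (intro Max.boundedI, auto)
qed

lemma max_partial_diff_le:
  fixes z z' :: "nat \<Rightarrow> 'c::real_normed_vector"
  shows "max_partial z c n \<le> max_partial z' c n + (\<Sum>v\<in>{c..<c+n}. norm (z v - z' v))"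
proof -
  have "norm (\<Sum>v\<in>{c..<c+V}. z v) \<le> max_partial z' c n + (\<Sum>v\<in>{c..<c+n}. norm (z v - z' v))"
    if V: "V \<le> n" for V
  proof -
    have "(\<Sum>v\<in>{c..<c+V}. z v) = (\<Sum>v\<in>{c..<c+V}. z' v) + (\<Sum>v\<in>{c..<c+V}. z v - z' v)"
      by (simp add: sum_subtractf)
    also have "norm \<dots> \<le> norm (\<Sum>v\<in>{c..<c+V}. z' v) + (\<Sum>v\<in>{c..<c+V}. norm (z v - z' v))"
      by (intro order_trans[OF norm_triangle_ineq] add_left_mono norm_sum)
    also have "\<dots> \<le> max_partial z' c n + (\<Sum>v\<in>{c..<c+n}. norm (z v - z' v))"
      using V by (intro add_mono max_partial_ge sum_mono2) auto
    finally show ?thesis .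
  qed
  then show ?thesis by (subst (1) max_partial_def) (intro Max.boundedI, auto)
qed

lemma measurable_max_partial_le:
  fixes Z :: "nat \<Rightarrow> 'a \<Rightarrow> 'h::{real_normed_vector, second_countable_topology}"
  assumes "\<And>v. c \<le> v \<Longrightarrow> v < c + n \<Longrightarrow> Z v \<in> borel_measurable P"
  shows "(\<lambda>\<omega>. max_partial (\<lambda>v. Z v \<omega>) c n) \<in> borel_measurable P"
proof -
  have "(\<lambda>\<omega>. norm (\<Sum>v\<in>{c..<c+V}. Z v \<omega>)) \<in> borel_measurable P" if "V \<le> n" for V
  proof -
    have [measurable]: "(\<lambda>\<omega>. \<Sum>v\<in>{c..<c+V}. Z v \<omega>) \<in> borel_measurable P"
      using assms that by (intro borel_measurable_sum) auto
    show ?thesis by measurable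
  qed
  then show ?thesis
    unfolding max_partial_def by (intro borel_measurable_Max) auto
qed

lemma measurable_max_partial [measurable]:
  fixes Z :: "nat \<Rightarrow> 'a \<Rightarrow> 'h::{real_normed_vector, second_countable_topology}"
  assumes [measurable]: "\<And>v. Z v \<in> borel_measurable P"
  shows "(\<lambda>\<omega>. max_partial (\<lambda>v. Z v \<omega>) c n) \<in> borel_measurable P"
  by (intro measurable_max_partial_le assms)

lemma max_partial_leI:
  "(\<And>V. V \<le> n \<Longrightarrow> norm (\<Sum>v\<in>{c..<c+V}. z v) \<le> b) \<Longrightarrow> max_partial z c n \<le> b"
  unfolding max_partial_def by (intro Max.boundedI) auto

lemma max_partial_shift: "max_partial (\<lambda>v. z (c + v)) 0 n = max_partial z c n"
proof -
  have "(\<Sum>v\<in>{0..<0 + V}. z (c + v)) = (\<Sum>v\<in>{c..<c + V}. z v)" for V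
    using sum.shift_bounds_nat_ivl[of z 0 c V] by (simp add: add.commute[of c])
  then show ?thesis unfolding max_partial_def by (simp only:)
qed

lemma max_partial_cong: "(\<And>v. c \<le> v \<Longrightarrow> v < c + n \<Longrightarrow> z v = z' v) \<Longrightarrow> max_partial z c n = max_partial z' c n"
  unfolding max_partial_def by (intro arg_cong[of _ _ Max] image_cong refl arg_cong[of _ _ norm] sum.cong) auto

lemma max_partial_plus: "max_partial (\<lambda>v. z v + z' v) c n \<le> max_partial z c n + max_partial z' c n"
proof (rule max_partial_leI)
  fix V assume V: "V \<le> n"
  have "norm (\<Sum>v\<in>{c..<c+V}. z v + z' v) \<le> norm (\<Sum>v\<in>{c..<c+V}. z v) + norm (\<Sum>v\<in>{c..<c+V}. z' v)"
    by (simp add: sum.distrib norm_triangle_ineq)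
  also have "\<dots> \<le> max_partial z c n + max_partial z' c n" using V by (intro add_mono max_partial_ge)
  finally show "norm (\<Sum>v\<in>{c..<c+V}. z v + z' v) \<le> max_partial z c n + max_partial z' c n" .
qed

lemma max_partial_sum: "max_partial (\<lambda>v. \<Sum>x\<in>T. z x v) c n \<le> (\<Sum>x\<in>T. max_partial (z x) c n)"
proof (rule max_partial_leI)
  fix V assume V: "V \<le> n"
  have "norm (\<Sum>v\<in>{c..<c+V}. \<Sum>x\<in>T. z x v) = norm (\<Sum>x\<in>T. \<Sum>v\<in>{c..<c+V}. z x v)"
    by (subst sum.swap) (rule refl)
  also have "\<dots> \<le> (\<Sum>x\<in>T. norm (\<Sum>v\<in>{c..<c+V}. z x v))" by (rule norm_sum)
  also have "\<dots> \<le> (\<Sum>x\<in>T. max_partial (z x) c n)" using V by (intro sum_mono max_partial_ge)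
  finally show "norm (\<Sum>v\<in>{c..<c+V}. \<Sum>x\<in>T. z x v) \<le> (\<Sum>x\<in>T. max_partial (z x) c n)" .
qed

lemma max_partial_le_sum_norm: "max_partial z c n \<le> (\<Sum>v\<in>{c..<c+n}. norm (z v))"
proof (rule max_partial_leI)
  fix V assume V: "V \<le> n"
  have "norm (\<Sum>v\<in>{c..<c+V}. z v) \<le> (\<Sum>v\<in>{c..<c+V}. norm (z v))" by (rule norm_sum)
  also have "\<dots> \<le> (\<Sum>v\<in>{c..<c+n}. norm (z v))" using V by (intro sum_mono2) auto
  finally show "norm (\<Sum>v\<in>{c..<c+V}. z v) \<le> (\<Sum>v\<in>{c..<c+n}. norm (z v))" .
qed

lemma max_partial_append: "max_partial z 0 (n + m) \<le> max_partial z 0 n + max_partial (\<lambda>v. z (n + v)) 0 m"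
proof -
  have "max_partial z 0 (n + m) \<le> max (max_partial z 0 n) (norm (\<Sum>v\<in>{0..<0+n}. z v) + max_partial z (0 + n) m)"
    by (rule max_partial_add)
  also have "\<dots> \<le> max_partial z 0 n + max_partial z n m"
    using max_partial_ge[of n n z 0] max_partial_nonneg[of z n m] by simp
  finally show ?thesis by (simp only: max_partial_shift)
qed

text \<open>The indices below \<open>V\<close> in one residue class modulo \<open>d\<close> form an
  initial segment of that class, so every partial sum is a sum of \<open>d\<close> partial sums, one
  per class.\<close>

lemma max_partial_residues:
  assumes "0 < d"
  shows "max_partial z 0 (r * d) \<le> (\<Sum>y<d. max_partial (\<lambda>v. z (v * d + y)) 0 r)"
proof (rule max_partial_leI)
  fix V assume V: "V \<le> r * d"
  \<comment> \<open>The number of \<open>v\<close> with \<open>v * d + y < V\<close>, that is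
    \<open>(V - y) / d\<close> rounded up; truncated subtraction gives 0 when
    \<open>V \<le> y\<close>.\<close>
  let ?e = "\<lambda>y. (V - y + d - 1) div d"
  have less: "v * d + y < V \<longleftrightarrow> v < ?e y" for v y
  proof -
    have "v < ?e y \<longleftrightarrow> Suc v \<le> ?e y" by (rule Suc_le_eq[symmetric])
    also have "\<dots> \<longleftrightarrow> Suc v * d \<le> V - y + d - 1"
      using assms by (rule less_eq_div_iff_mult_less_eq)
    also have "\<dots> \<longleftrightarrow> v * d + y < V"
      unfolding mult_Suc using assms by arith
    finally show ?thesis by simp
  qed
  have "sum z {0..<0+V} = (\<Sum>j<r * d. if j < V then z j else 0)"
    using V by (intro sum.mono_neutral_cong_left) auto
  also have "\<dots> = (\<Sum>v<r. \<Sum>j\<in>{v * d..<v * d + d}. if j < V then z j else 0)"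
    by (rule sum.nat_group[symmetric])
  also have "\<dots> = (\<Sum>v<r. \<Sum>y<d. if v * d + y < V then z (v * d + y) else 0)"
  proof (rule sum.cong[OF refl])
    fix v
    show "(\<Sum>j\<in>{v * d..<v * d + d}. if j < V then z j else 0) = (\<Sum>y<d. if v * d + y < V then z (v * d + y) else 0)"
      by (rule sum.reindex_bij_witness[of _ "\<lambda>y. v * d + y" "\<lambda>j. j - v * d"]) auto
  qed
  also have "\<dots> = (\<Sum>y<d. \<Sum>v<r. if v * d + y < V then z (v * d + y) else 0)" by (rule sum.swap)
  also have "\<dots> = (\<Sum>y<d. \<Sum>v\<in>{0..<0 + min r (?e y)}. z (v * d + y))"
    by (intro sum.cong refl sum.mono_neutral_cong_right) (auto simp: less)
  finally have eq: "sum z {0..<0+V} = (\<Sum>y<d. \<Sum>v\<in>{0..<0 + min r (?e y)}. z (v * d + y))" .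
  have "norm (sum z {0..<0+V}) \<le> (\<Sum>y<d. norm (\<Sum>v\<in>{0..<0 + min r (?e y)}. z (v * d + y)))"
    unfolding eq by (rule norm_sum)
  also have "\<dots> \<le> (\<Sum>y<d. max_partial (\<lambda>v. z (v * d + y)) 0 r)"
    by (intro sum_mono max_partial_ge) auto
  finally show "norm (\<Sum>v\<in>{0..<0+V}. z v) \<le> (\<Sum>y<d. max_partial (\<lambda>v. z (v * d + y)) 0 r)" .
qed

text \<open>The last \<open>d\<close> left indices are adjacent to the right half and are estimated
  by norms alone. The others are sorted by their position \<open>x\<close> inside groups of length
  \<open>d\<close>, and the right indices by \<open>y\<close>; for fixed \<open>x\<close> and
  \<open>y\<close> a two-sample sum over the group numbers \<open>u\<close> and \<open>v\<close>
  remains.\<close>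

lemma cross_sum_le:
  fixes g :: "nat \<Rightarrow> nat \<Rightarrow> 'h::real_normed_vector"
  assumes "0 < d" "0 < r"
  shows "max_partial (\<lambda>j. \<Sum>i<r * d. g i j) 0 (r * d)
    \<le> (\<Sum>i\<in>{(r - 1) * d..<r * d}. \<Sum>j<r * d. norm (g i j))
      + (\<Sum>x<d. \<Sum>y<d. max_partial (\<lambda>v. \<Sum>u<r - 1. g (u * d + x) (v * d + y)) 0 r)"
proof -
  have split: "(\<Sum>i<r * d. g i j) = (\<Sum>i\<in>{(r - 1) * d..<r * d}. g i j) + (\<Sum>x<d. \<Sum>u<r - 1. g (u * d + x) j)" for j
  proof -
    have "{..<m} = {l..<m} \<union> {..<l}" if "l \<le> m" for l m :: nat using that by auto
    from this[of "(r - 1) * d" "r * d"]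
    have "{..<r * d} = {(r - 1) * d..<r * d} \<union> {..<(r - 1) * d}" by simp
    then have "(\<Sum>i<r * d. g i j) = (\<Sum>i\<in>{(r - 1) * d..<r * d} \<union> {..<(r - 1) * d}. g i j)" by (simp only:)
    also have "\<dots> = (\<Sum>i\<in>{(r - 1) * d..<r * d}. g i j) + (\<Sum>i<(r - 1) * d. g i j)"
      by (intro sum.union_disjoint) auto
    also have "(\<Sum>i<(r - 1) * d. g i j) = (\<Sum>u<r - 1. \<Sum>i\<in>{u * d..<u * d + d}. g i j)"
      by (rule sum.nat_group[symmetric])
    also have "\<dots> = (\<Sum>u<r - 1. \<Sum>x<d. g (u * d + x) j)"
    proof (rule sum.cong[OF refl])
      fix u
      show "(\<Sum>i\<in>{u * d..<u * d + d}. g i j) = (\<Sum>x<d. g (u * d + x) j)"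
        by (rule sum.reindex_bij_witness[of _ "\<lambda>y. u * d + y" "\<lambda>j. j - u * d"]) auto
    qed
    also have "\<dots> = (\<Sum>x<d. \<Sum>u<r - 1. g (u * d + x) j)" by (rule sum.swap)
    finally show ?thesis .
  qed
  have "max_partial (\<lambda>j. \<Sum>i<r * d. g i j) 0 (r * d)
    \<le> max_partial (\<lambda>j. \<Sum>i\<in>{(r - 1) * d..<r * d}. g i j) 0 (r * d)
      + max_partial (\<lambda>j. \<Sum>x<d. \<Sum>u<r - 1. g (u * d + x) j) 0 (r * d)"
    unfolding split by (rule max_partial_plus)
  also have "\<dots> \<le> (\<Sum>j\<in>{0..<0 + r * d}. norm (\<Sum>i\<in>{(r - 1) * d..<r * d}. g i j))
      + (\<Sum>x<d. max_partial (\<lambda>j. \<Sum>u<r - 1. g (u * d + x) j) 0 (r * d))"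
    by (intro add_mono max_partial_le_sum_norm max_partial_sum)
  also have "\<dots> \<le> (\<Sum>j\<in>{0..<0 + r * d}. \<Sum>i\<in>{(r - 1) * d..<r * d}. norm (g i j))
      + (\<Sum>x<d. \<Sum>y<d. max_partial (\<lambda>v. \<Sum>u<r - 1. g (u * d + x) (v * d + y)) 0 r)"
    by (intro add_mono sum_mono norm_sum max_partial_residues assms)
  also have "(\<Sum>j\<in>{0..<0 + r * d}. \<Sum>i\<in>{(r - 1) * d..<r * d}. norm (g i j))
      = (\<Sum>i\<in>{(r - 1) * d..<r * d}. \<Sum>j<r * d. norm (g i j))"
    by (subst sum.swap) (simp add: atLeast0LessThan)
  finally show ?thesis .
qed

lemma sum_lessThan_double: "(\<Sum>x<2 * q. f x) = (\<Sum>x<q. f x) + (\<Sum>x<(q::nat). f (q + x))"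
proof -
  have "{..<2 * q} = {..<q} \<union> {q..<q+q}" by auto
  then have "(\<Sum>x<2 * q. f x) = (\<Sum>x\<in>{..<q} \<union> {q..<q+q}. f x)" by (simp only:)
  also have "\<dots> = (\<Sum>x<q. f x) + (\<Sum>x\<in>{q..<q+q}. f x)"
    by (intro sum.union_disjoint) auto
  also have "(\<Sum>x\<in>{q..<q+q}. f x) = (\<Sum>x<q. f (q + x))"
    by (rule sum.reindex_bij_witness[of _ "\<lambda>y. q + y" "\<lambda>j. j - q"]) auto
  finally show ?thesis .
qed

text \<open>A triangle of side \<open>2 n\<close> consists of two triangles and a square. This is
  the recursion step for the U-statistic, the square being the cross term.\<close>

lemma max_partial_halves:
  fixes f :: "nat \<Rightarrow> nat \<Rightarrow> 'h::real_normed_vector"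
  shows "max_partial (\<lambda>j. \<Sum>i<j. f i j) 0 (n + n)
    \<le> max_partial (\<lambda>j. \<Sum>i<j. f i j) 0 n + max_partial (\<lambda>j. \<Sum>i<j. f (n + i) (n + j)) 0 n
      + max_partial (\<lambda>j. \<Sum>i<n. f i (n + j)) 0 n"
proof -
  have split: "(\<Sum>i<n + j. f i (n + j)) = (\<Sum>i<j. f (n + i) (n + j)) + (\<Sum>i<n. f i (n + j))" for j
  proof -
    have "{..<n + j} = {n..<n + j} \<union> {..<n}" by auto
    then have "(\<Sum>i<n + j. f i (n + j)) = (\<Sum>i\<in>{n..<n + j} \<union> {..<n}. f i (n + j))" by (simp only:)
    also have "\<dots> = (\<Sum>i\<in>{n..<n + j}. f i (n + j)) + (\<Sum>i<n. f i (n + j))"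
      by (intro sum.union_disjoint) auto
    also have "(\<Sum>i\<in>{n..<n + j}. f i (n + j)) = (\<Sum>i<j. f (n + i) (n + j))"
      by (rule sum.reindex_bij_witness[of _ "\<lambda>y. n + y" "\<lambda>j. j - n"]) auto
    finally show ?thesis .
  qed
  have "max_partial (\<lambda>j. \<Sum>i<n + j. f i (n + j)) 0 n
      \<le> max_partial (\<lambda>j. \<Sum>i<j. f (n + i) (n + j)) 0 n + max_partial (\<lambda>j. \<Sum>i<n. f i (n + j)) 0 n"
    unfolding split by (rule max_partial_plus)
  with max_partial_append[of "\<lambda>j. \<Sum>i<j. f i j" n n] show ?thesis by simp
qed

section \<open>The Rademacher--Menshov maximal inequality\<close>

lemma power2_add_le_weighted:
  fixes x y :: real
  shows "(x + y)\<^sup>2 \<le> (real k + 2) * x\<^sup>2 + (real k + 2) / (real k + 1) * y\<^sup>2"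
proof -
  have "(real k + 2) * x\<^sup>2 + (real k + 2) / (real k + 1) * y\<^sup>2 - (x + y)\<^sup>2
      = ((real k + 1) * x - y)\<^sup>2 / (real k + 1)"
    by (simp add: field_simps power2_eq_square)
  also have "\<dots> \<ge> 0" by simp
  finally show ?thesis by simp
qed

text \<open>Induction by halving: the maximum is at most the norm of the full left sum plus the
  larger of the maxima over the two halves, and the square of the larger one is at most the sum of
  the squares. Orthogonality enters only through second moments of windows growing linearly in their
  length; \<open>B\<close> confines that requirement to windows inside the range.\<close>

lemma rademacher_menshov:
  fixes Z :: "nat \<Rightarrow> 'a \<Rightarrow> 'h::{real_normed_vector, second_countable_topology}"
  assumes [measurable]: "\<And>v. Z v \<in> borel_measurable P"
    and bd: "\<And>c n. c + n \<le> B \<Longrightarrow> (\<integral>\<^sup>+\<omega>. ennreal ((norm (\<Sum>v\<in>{c..<c+n}. Z v \<omega>))\<^sup>2) \<partial>P) \<le> ennreal (\<sigma> * n)"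
    and "0 \<le> \<sigma>" "c + 2 ^ k \<le> B"
  shows "(\<integral>\<^sup>+\<omega>. ennreal ((max_partial (\<lambda>v. Z v \<omega>) c (2 ^ k))\<^sup>2) \<partial>P) \<le> ennreal (\<sigma> * (real k + 1)\<^sup>2 * 2 ^ k)"
  using assms(4)
proof (induction k arbitrary: c)
  case 0
  have "{..Suc 0} = {0, 1}" by auto
  then have "max_partial (\<lambda>v. Z v \<omega>) c 1 = norm (\<Sum>v\<in>{c..<c+1}. Z v \<omega>)" for \<omega>
    by (simp add: max_partial_def)
  then show ?case using bd[of c 1] 0 by simp
next
  case (Suc k)
  define m where "m = (2::nat) ^ k"
  have m2: "2 ^ Suc k = m + m" by (simp add: m_def)
  let ?S = "\<lambda>\<omega>. (norm (\<Sum>v\<in>{c..<c+m}. Z v \<omega>))\<^sup>2"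
  let ?A = "\<lambda>\<omega>. (max_partial (\<lambda>v. Z v \<omega>) c m)\<^sup>2"
  let ?B = "\<lambda>\<omega>. (max_partial (\<lambda>v. Z v \<omega>) (c + m) m)\<^sup>2"
  \<comment> \<open>The weights come from
    \<open>(x + y)^2 \<le> (1 + r) x^2 + (1 + 1 / r) y^2\<close> with \<open>r = k + 1\<close>. They
    make the induction close: the new factor is
    \<open>(k + 2) (2 k + 3) \<le> 2 (k + 2)^2\<close>.\<close>
  define w where "w = (real k + 2) / (real k + 1)"
  have w: "0 \<le> w" by (simp add: w_def)
  have pw: "(max_partial (\<lambda>v. Z v \<omega>) c (m + m))\<^sup>2 \<le> (real k + 2) * ?S \<omega> + w * (?A \<omega> + ?B \<omega>)" for \<omega>
  proof -
    have "(max_partial (\<lambda>v. Z v \<omega>) c (m + m))\<^sup>2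
        \<le> (norm (\<Sum>v\<in>{c..<c+m}. Z v \<omega>) + max (max_partial (\<lambda>v. Z v \<omega>) c m) (max_partial (\<lambda>v. Z v \<omega>) (c + m) m))\<^sup>2"
      using max_partial_add[of "\<lambda>v. Z v \<omega>" c m m] by (intro power_mono max_partial_nonneg) (auto simp: max_def split: if_splits intro: order_trans)
    also have "\<dots> \<le> (real k + 2) * ?S \<omega> + w * (max (max_partial (\<lambda>v. Z v \<omega>) c m) (max_partial (\<lambda>v. Z v \<omega>) (c + m) m))\<^sup>2"
      unfolding w_def by (rule power2_add_le_weighted)
    also have "(max (max_partial (\<lambda>v. Z v \<omega>) c m) (max_partial (\<lambda>v. Z v \<omega>) (c + m) m))\<^sup>2 \<le> ?A \<omega> + ?B \<omega>"
      by (auto simp: max_def)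
    finally show ?thesis using w by (simp add: mult_left_mono)
  qed
  have "(\<integral>\<^sup>+\<omega>. ennreal ((max_partial (\<lambda>v. Z v \<omega>) c (m + m))\<^sup>2) \<partial>P)
     \<le> (\<integral>\<^sup>+\<omega>. ennreal (real k + 2) * ennreal (?S \<omega>) + ennreal w * (ennreal (?A \<omega>) + ennreal (?B \<omega>)) \<partial>P)"
    using w by (intro nn_integral_mono)
      (auto simp: ennreal_mult[symmetric] ennreal_plus[symmetric] simp del: ennreal_plus intro!: ennreal_leI pw)
  also have "\<dots> = ennreal (real k + 2) * (\<integral>\<^sup>+\<omega>. ennreal (?S \<omega>) \<partial>P)
      + ennreal w * ((\<integral>\<^sup>+\<omega>. ennreal (?A \<omega>) \<partial>P) + (\<integral>\<^sup>+\<omega>. ennreal (?B \<omega>) \<partial>P))"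
    by (simp add: nn_integral_add nn_integral_cmult)
  also have "\<dots> \<le> ennreal (real k + 2) * ennreal (\<sigma> * m)
      + ennreal w * (ennreal (\<sigma> * (real k + 1)\<^sup>2 * 2 ^ k) + ennreal (\<sigma> * (real k + 1)\<^sup>2 * 2 ^ k))"
    using Suc.prems Suc.IH[of c] Suc.IH[of "c + m"] bd[of c m] unfolding m2
    by (intro add_mono mult_left_mono) (auto simp: m_def)
  also have "\<dots> = ennreal ((real k + 2) * (\<sigma> * m) + w * (\<sigma> * (real k + 1)\<^sup>2 * 2 ^ k + \<sigma> * (real k + 1)\<^sup>2 * 2 ^ k))"
    using w \<open>0 \<le> \<sigma>\<close> by (simp add: ennreal_mult[symmetric] ennreal_plus[symmetric] del: ennreal_plus)
  also have "w * (\<sigma> * (real k + 1)\<^sup>2 * 2 ^ k + \<sigma> * (real k + 1)\<^sup>2 * 2 ^ k) = \<sigma> * 2 ^ k * (2 * (real k + 1) * (real k + 2))"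
    by (simp add: w_def field_simps power2_eq_square)
  also have "(real k + 2) * (\<sigma> * m) + \<dots> = \<sigma> * 2 ^ k * ((real k + 2) * (2 * real k + 3))"
    by (simp add: m_def algebra_simps)
  also have "\<dots> \<le> \<sigma> * 2 ^ k * (2 * (real k + 2)\<^sup>2)"
    using \<open>0 \<le> \<sigma>\<close> by (intro mult_left_mono) (auto simp: power2_eq_square algebra_simps)
  finally show ?case unfolding m2 using ennreal_leI by (fastforce simp: algebra_simps intro: order_trans)
qed

text \<open>Expanding \<open>(f - s)^2 \<ge> 0\<close> gives
  \<open>f \<le> f^2 / (2 s) + s / 2\<close>, which can be integrated directly and takes the place
  of the Cauchy--Schwarz inequality.\<close>

lemma nn_integral_le_of_square:
  assumes [measurable]: "f \<in> borel_measurable P" and "prob_space P" and "0 < s"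
    and "(\<integral>\<^sup>+x. ennreal ((f x)\<^sup>2) \<partial>P) \<le> ennreal (s\<^sup>2)"
  shows "(\<integral>\<^sup>+x. ennreal (f x) \<partial>P) \<le> ennreal s"
proof -
  interpret prob_space P by fact
  have pw: "f x \<le> (1 / (2 * s)) * (f x)\<^sup>2 + s / 2" for x
  proof -
    have "(1 / (2 * s)) * (f x)\<^sup>2 + s / 2 - f x = (f x - s)\<^sup>2 / (2 * s)"
      using \<open>0 < s\<close> by (simp add: field_simps power2_eq_square)
    also have "\<dots> \<ge> 0" using \<open>0 < s\<close> by simp
    finally show ?thesis by simp
  qed
  have "(\<integral>\<^sup>+x. ennreal (f x) \<partial>P) \<le> (\<integral>\<^sup>+x. ennreal (1 / (2 * s)) * ennreal ((f x)\<^sup>2) + ennreal (s / 2) \<partial>P)"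
  proof (rule nn_integral_mono)
    fix x
    show "ennreal (f x) \<le> ennreal (1 / (2 * s)) * ennreal ((f x)\<^sup>2) + ennreal (s / 2)"
      using \<open>0 < s\<close> ennreal_leI[OF pw[of x]] by (simp add: ennreal_mult[symmetric] ennreal_plus)
  qed
  also have "\<dots> = ennreal (1 / (2 * s)) * (\<integral>\<^sup>+x. ennreal ((f x)\<^sup>2) \<partial>P) + ennreal (s / 2)"
    by (simp add: nn_integral_add nn_integral_cmult emeasure_space_1)
  also have "\<dots> \<le> ennreal (1 / (2 * s)) * ennreal (s\<^sup>2) + ennreal (s / 2)"
    using assms(4) by (intro add_mono mult_left_mono) auto
  also have "\<dots> = ennreal s"
    using \<open>0 < s\<close> by (simp add: ennreal_mult[symmetric] ennreal_plus[symmetric] power2_eq_square field_simps del: ennreal_plus)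
  finally show ?thesis .
qed

section \<open>Degenerate kernels of i.i.d. variables\<close>

lemma nn_integral_PiM_two_coordinates:
  assumes "prob_space \<mu>" "finite I" "u \<in> I" "v \<in> I" "u \<noteq> v"
    and [measurable]: "case_prod f \<in> borel_measurable (\<mu> \<Otimes>\<^sub>M \<mu>)"
  shows "(\<integral>\<^sup>+x. f (x u) (x v) \<partial>PiM I (\<lambda>_. \<mu>)) = (\<integral>\<^sup>+y. \<integral>\<^sup>+z. f y z \<partial>\<mu> \<partial>\<mu>)"
proof -
  interpret prob_space \<mu> by fact
  interpret MM: pair_prob_space \<mu> \<mu> ..
  interpret P: product_prob_space "\<lambda>_. \<mu>" I ..
  define J where "J = I - {u}"
  have J: "finite J" "u \<notin> J" "insert u J = I" "v \<in> J" using assms by (auto simp: J_def)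
  interpret PJ: prob_space "PiM J (\<lambda>_. \<mu>)" by (intro prob_space_PiM prob_space_axioms)
  have [measurable]: "v \<in> J" "u \<in> insert u J" "v \<in> insert u J" using J by auto
  have "(\<integral>\<^sup>+x. f (x u) (x v) \<partial>PiM I (\<lambda>_. \<mu>)) = (\<integral>\<^sup>+x. f (x u) (x v) \<partial>PiM (insert u J) (\<lambda>_. \<mu>))"
    using J by simp
  also have "\<dots> = (\<integral>\<^sup>+y. \<integral>\<^sup>+x. f y (x v) \<partial>PiM J (\<lambda>_. \<mu>) \<partial>\<mu>)"
    using J \<open>u \<noteq> v\<close> by (subst P.product_nn_integral_insert_rev) auto
  also have "\<dots> = (\<integral>\<^sup>+y. \<integral>\<^sup>+z. f y z \<partial>\<mu> \<partial>\<mu>)"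
  proof (rule nn_integral_cong)
    fix y assume [measurable]: "y \<in> space \<mu>"
    have "(\<integral>\<^sup>+z. f y z \<partial>\<mu>) = (\<integral>\<^sup>+z. f y z \<partial>distr (PiM J (\<lambda>_. \<mu>)) \<mu> (\<lambda>x. x v))"
      using J prob_space_axioms by (subst distr_PiM_component) auto
    also have "\<dots> = (\<integral>\<^sup>+x. f y (x v) \<partial>PiM J (\<lambda>_. \<mu>))"
      by (intro nn_integral_distr) measurable
    finally show "(\<integral>\<^sup>+x. f y (x v) \<partial>PiM J (\<lambda>_. \<mu>)) = (\<integral>\<^sup>+z. f y z \<partial>\<mu>)" by simp
  qed
  finally show ?thesis .
qed

lemma integral_PiM_eq_0:
  fixes f :: "('i \<Rightarrow> 's) \<Rightarrow> real"
  assumes "prob_space \<mu>" "finite I" "i \<in> I" "integrable (PiM I (\<lambda>_. \<mu>)) f"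
    and "\<And>x. x \<in> space (PiM (I - {i}) (\<lambda>_. \<mu>)) \<Longrightarrow> (\<integral>y. f (x(i := y)) \<partial>\<mu>) = 0"
  shows "(\<integral>x. f x \<partial>PiM I (\<lambda>_. \<mu>)) = 0"
proof -
  interpret prob_space \<mu> by fact
  interpret P: product_prob_space "\<lambda>_. \<mu>" I ..
  have I: "insert i (I - {i}) = I" using assms by auto
  have "(\<integral>x. f x \<partial>PiM I (\<lambda>_. \<mu>)) = (\<integral>x. (\<integral>y. f (x(i:=y)) \<partial>\<mu>) \<partial>PiM (I - {i}) (\<lambda>_. \<mu>))"
    using P.product_integral_insert[of "I - {i}" i f] assms I by simp
  also have "\<dots> = (\<integral>x. 0 \<partial>PiM (I - {i}) (\<lambda>_. \<mu>))"
    using assms(5) by (intro Bochner_Integration.integral_cong refl)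
  finally show ?thesis by simp
qed

lemma integral_norm_sum_orthogonal:
  fixes f :: "'i \<Rightarrow> 'a \<Rightarrow> 'h::{real_inner, second_countable_topology}"
  assumes "finite T"
    and "\<And>p r. p \<in> T \<Longrightarrow> r \<in> T \<Longrightarrow> integrable P (\<lambda>x. inner (f p x) (f r x))"
    and "\<And>p r. p \<in> T \<Longrightarrow> r \<in> T \<Longrightarrow> p \<noteq> r \<Longrightarrow> (\<integral>x. inner (f p x) (f r x) \<partial>P) = 0"
  shows "integrable P (\<lambda>x. (norm (\<Sum>p\<in>T. f p x))\<^sup>2)"
    and "(\<integral>x. (norm (\<Sum>p\<in>T. f p x))\<^sup>2 \<partial>P) = (\<Sum>p\<in>T. \<integral>x. (norm (f p x))\<^sup>2 \<partial>P)"
proof -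
  have eq: "(norm (\<Sum>p\<in>T. f p x))\<^sup>2 = (\<Sum>p\<in>T. \<Sum>r\<in>T. inner (f p x) (f r x))" for x
    unfolding power2_norm_eq_inner inner_sum_left by (simp add: inner_sum_right)
  show "integrable P (\<lambda>x. (norm (\<Sum>p\<in>T. f p x))\<^sup>2)"
    unfolding eq using assms(2) by (intro Bochner_Integration.integrable_sum) auto
  have "(\<integral>x. (norm (\<Sum>p\<in>T. f p x))\<^sup>2 \<partial>P) = (\<Sum>p\<in>T. \<Sum>r\<in>T. \<integral>x. inner (f p x) (f r x) \<partial>P)"
    unfolding eq using assms(2) by (simp add: Bochner_Integration.integral_sum)
  also have "\<dots> = (\<Sum>p\<in>T. \<Sum>r\<in>T. if p = r then \<integral>x. (norm (f p x))\<^sup>2 \<partial>P else 0)"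
    using assms(3) by (intro sum.cong refl) (auto simp: power2_norm_eq_inner)
  also have "\<dots> = (\<Sum>p\<in>T. \<integral>x. (norm (f p x))\<^sup>2 \<partial>P)"
    using \<open>finite T\<close> by (simp add: sum.delta')
  finally show "(\<integral>x. (norm (\<Sum>p\<in>T. f p x))\<^sup>2 \<partial>P) = (\<Sum>p\<in>T. \<integral>x. (norm (f p x))\<^sup>2 \<partial>P)" .
qed

text \<open>Jensen's inequality, obtained from the nonnegative variance of
  \<open>norm (f x)\<close>.\<close>

lemma (in prob_space) norm_integral_power2_le:
  fixes f :: "'a \<Rightarrow> 'h::{banach, second_countable_topology}"
  assumes [measurable]: "f \<in> borel_measurable M" and bd: "\<And>x. norm (f x) \<le> b"
  shows "ennreal ((norm (\<integral>x. f x \<partial>M))\<^sup>2) \<le> (\<integral>\<^sup>+x. ennreal ((norm (f x))\<^sup>2) \<partial>M)"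
proof -
  have b: "0 \<le> b" using bd[of undefined] norm_ge_zero order_trans by blast
  have int: "integrable M (\<lambda>x. norm (f x))"
    using bd by (intro integrable_const_bound[of _ b]) auto
  have int2: "integrable M (\<lambda>x. (norm (f x))\<^sup>2)"
    using bd b by (intro integrable_const_bound[of _ "b\<^sup>2"]) (auto intro: power_mono)
  have "(norm (\<integral>x. f x \<partial>M))\<^sup>2 \<le> (\<integral>x. norm (f x) \<partial>M)\<^sup>2"
    by (intro power_mono integral_norm_bound) auto
  also have "\<dots> \<le> (\<integral>x. (norm (f x))\<^sup>2 \<partial>M)"
    using variance_eq[OF int int2] variance_positive[of "\<lambda>x. norm (f x)"] by simp
  finally have "ennreal ((norm (\<integral>x. f x \<partial>M))\<^sup>2) \<le> ennreal (\<integral>x. (norm (f x))\<^sup>2 \<partial>M)"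
    by (rule ennreal_leI)
  also have "\<dots> = (\<integral>\<^sup>+x. ennreal ((norm (f x))\<^sup>2) \<partial>M)"
    using int2 by (intro nn_integral_eq_integral[symmetric]) auto
  finally show ?thesis .
qed

text \<open>Different pairs give orthogonal summands: they differ in one of their two indices, and
  integrating over the corresponding coordinate kills the inner product by degeneracy. The bound
  \<open>b\<close> makes all inner products integrable.\<close>

lemma bounded_degenerate_sum_square:
  fixes g :: "'s \<Rightarrow> 's \<Rightarrow> 'h::{real_inner, banach, second_countable_topology}"
  assumes "prob_space \<mu>" and [measurable]: "case_prod g \<in> borel_measurable (\<mu> \<Otimes>\<^sub>M \<mu>)"
    and bd: "\<And>x y. norm (g x y) \<le> b"
    and g1: "\<And>y. y \<in> space \<mu> \<Longrightarrow> (\<integral>x. g x y \<partial>\<mu>) = 0"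
    and g2: "\<And>x. x \<in> space \<mu> \<Longrightarrow> (\<integral>y. g x y \<partial>\<mu>) = 0"
    and sq: "(\<integral>\<^sup>+x. \<integral>\<^sup>+y. ennreal ((norm (g x y))\<^sup>2) \<partial>\<mu> \<partial>\<mu>) \<le> ennreal \<sigma>" "0 \<le> \<sigma>"
    and I: "finite I" "A \<subseteq> I" "B \<subseteq> I" "A \<inter> B = {}"
  shows "(\<integral>\<^sup>+x. ennreal ((norm (\<Sum>(u, v)\<in>A \<times> B. g (x u) (x v)))\<^sup>2) \<partial>PiM I (\<lambda>_. \<mu>)) \<le> ennreal (\<sigma> * (card A * card B))"
proof -
  interpret prob_space \<mu> by fact
  interpret PP: prob_space "PiM I (\<lambda>_. \<mu>)" by (intro prob_space_PiM prob_space_axioms)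
  have b: "0 \<le> b" using bd[of undefined undefined] norm_ge_zero order_trans by blast
  let ?T = "A \<times> B" and ?f = "\<lambda>p x. g (x (fst p)) (x (snd p))"
  have fin: "finite ?T" using I finite_subset by blast
  have mf: "?f p \<in> borel_measurable (PiM I (\<lambda>_. \<mu>))" if "p \<in> ?T" for p
  proof -
    have [measurable]: "fst p \<in> I" "snd p \<in> I" using that I by auto
    show ?thesis by measurable
  qed
  have int: "integrable (PiM I (\<lambda>_. \<mu>)) (\<lambda>x. inner (?f p x) (?f r x))" if "p \<in> ?T" "r \<in> ?T" for p r
  proof (rule PP.integrable_const_bound[of _ "b * b"])
    have "\<bar>inner (?f p x) (?f r x)\<bar> \<le> b * b" for x
      by (rule order_trans[OF Cauchy_Schwarz_ineq2]) (intro mult_mono bd b norm_ge_zero)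
    then show "AE x in PiM I (\<lambda>_. \<mu>). norm (inner (?f p x) (?f r x)) \<le> b * b" by simp
  qed (use mf that in measurable)
  have gi1: "integrable \<mu> (\<lambda>x. g x y)" if [measurable]: "y \<in> space \<mu>" for y
    using bd by (intro integrable_const_bound[of _ b]) auto
  have gi2: "integrable \<mu> (\<lambda>y. g x y)" if [measurable]: "x \<in> space \<mu>" for x
    using bd by (intro integrable_const_bound[of _ b]) auto
  have orth: "(\<integral>x. inner (?f p x) (?f r x) \<partial>PiM I (\<lambda>_. \<mu>)) = 0" if "p \<in> ?T" "r \<in> ?T" "p \<noteq> r" for p r
  proof -
    obtain u v u' v' where pr: "p = (u, v)" "r = (u', v')" by (cases p, cases r)
    have mem: "u \<in> A" "u' \<in> A" "v \<in> B" "v' \<in> B" using that pr by auto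
    \<comment> \<open>Disjointness of \<open>A\<close> and \<open>B\<close> is used here: a
      coordinate that distinguishes the two pairs occurs in one factor only.\<close>
    have ne: "u \<noteq> v" "u \<noteq> v'" "u' \<noteq> v" "u' \<noteq> v'" using mem I by auto
    have "u \<noteq> u' \<or> v \<noteq> v'" using that pr by auto
    then show ?thesis
    proof
      assume uu: "u \<noteq> u'"
      show ?thesis
      proof (rule integral_PiM_eq_0[where i=u])
        fix x assume x: "x \<in> space (PiM (I - {u}) (\<lambda>_. \<mu>))"
        have "x v \<in> space \<mu>" using x mem ne I by (auto simp: space_PiM PiE_iff)
        then show "(\<integral>y. inner (?f p (x(u := y))) (?f r (x(u := y))) \<partial>\<mu>) = 0"
          using uu ne gi1 g1 by (simp add: pr)
      qed (use int that I mem prob_space_axioms in auto)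
    next
      assume vv: "v \<noteq> v'"
      show ?thesis
      proof (rule integral_PiM_eq_0[where i=v])
        fix x assume x: "x \<in> space (PiM (I - {v}) (\<lambda>_. \<mu>))"
        have "x u \<in> space \<mu>" using x mem ne I by (auto simp: space_PiM PiE_iff)
        then show "(\<integral>y. inner (?f p (x(v := y))) (?f r (x(v := y))) \<partial>\<mu>) = 0"
          using vv ne gi2 g2 by (simp add: pr)
      qed (use int that I mem prob_space_axioms in auto)
    qed
  qed
  have each: "(\<integral>x. (norm (?f p x))\<^sup>2 \<partial>PiM I (\<lambda>_. \<mu>)) \<le> \<sigma>" if "p \<in> ?T" for p
  proof -
    have "ennreal (\<integral>x. (norm (?f p x))\<^sup>2 \<partial>PiM I (\<lambda>_. \<mu>)) = (\<integral>\<^sup>+x. ennreal ((norm (?f p x))\<^sup>2) \<partial>PiM I (\<lambda>_. \<mu>))"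
      using int[OF that that] by (intro nn_integral_eq_integral[symmetric]) (auto simp: power2_norm_eq_inner)
    also have "\<dots> = (\<integral>\<^sup>+x. \<integral>\<^sup>+y. ennreal ((norm (g x y))\<^sup>2) \<partial>\<mu> \<partial>\<mu>)"
      using that I by (intro nn_integral_PiM_two_coordinates[where f="\<lambda>x y. ennreal ((norm (g x y))\<^sup>2)"] prob_space_axioms) auto
    also note sq(1)
    finally show ?thesis using \<open>0 \<le> \<sigma>\<close> by (simp add: ennreal_le_iff)
  qed
  have "(\<integral>\<^sup>+x. ennreal ((norm (\<Sum>p\<in>?T. ?f p x))\<^sup>2) \<partial>PiM I (\<lambda>_. \<mu>))
      = ennreal (\<integral>x. (norm (\<Sum>p\<in>?T. ?f p x))\<^sup>2 \<partial>PiM I (\<lambda>_. \<mu>))"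
    by (intro nn_integral_eq_integral integral_norm_sum_orthogonal fin int orth) auto
  also have "(\<integral>x. (norm (\<Sum>p\<in>?T. ?f p x))\<^sup>2 \<partial>PiM I (\<lambda>_. \<mu>)) = (\<Sum>p\<in>?T. \<integral>x. (norm (?f p x))\<^sup>2 \<partial>PiM I (\<lambda>_. \<mu>))"
    by (intro integral_norm_sum_orthogonal fin int orth) auto
  also have "\<dots> \<le> (\<Sum>p\<in>?T. \<sigma>)" by (intro sum_mono each)
  also have "\<dots> = \<sigma> * (card A * card B)" by (simp add: card_cartesian_product)
  finally show ?thesis by (simp add: case_prod_unfold ennreal_leI)
qed

section \<open>Truncation and recentring of a degenerate kernel\<close>

locale degenerate_kernel = prob_space \<mu> for \<mu> :: "'s measure" +
  fixes h :: "'s \<Rightarrow> 's \<Rightarrow> 'h::{real_inner, banach, second_countable_topology}" and t C :: real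
  assumes h_meas [measurable]: "case_prod h \<in> borel_measurable (\<mu> \<Otimes>\<^sub>M \<mu>)"
    and h_int: "integrable (\<mu> \<Otimes>\<^sub>M \<mu>) (case_prod h)"
    and deg1: "AE y in \<mu>. (\<integral>x. h x y \<partial>\<mu>) = 0"
    and deg2: "AE x in \<mu>. (\<integral>y. h x y \<partial>\<mu>) = 0"
    and moment: "(\<integral>\<^sup>+x. \<integral>\<^sup>+y. ennreal (norm (h x y) powr t) \<partial>\<mu> \<partial>\<mu>) \<le> ennreal C"
    and t: "1 < t" "t < 2" and C: "0 < C"
begin

definition low :: "real \<Rightarrow> 's \<Rightarrow> 's \<Rightarrow> 'h" where
  "low a x y = (if norm (h x y) \<le> a then h x y else 0)"

definition high :: "real \<Rightarrow> 's \<Rightarrow> 's \<Rightarrow> 'h" where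
  "high a x y = (if norm (h x y) \<le> a then 0 else h x y)"

text \<open>The completely degenerate term in the Hoeffding decomposition of \<open>low a\<close>;
  truncation alone destroys degeneracy.\<close>

definition recentred :: "real \<Rightarrow> 's \<Rightarrow> 's \<Rightarrow> 'h" where
  "recentred a x y = low a x y - (\<integral>x'. low a x' y \<partial>\<mu>) - (\<integral>y'. low a x y' \<partial>\<mu>)
     + (\<integral>y'. \<integral>x'. low a x' y' \<partial>\<mu> \<partial>\<mu>)"

lemma measurable_low [measurable]: "case_prod (low a) \<in> borel_measurable (\<mu> \<Otimes>\<^sub>M \<mu>)"
  unfolding low_def by measurable

lemma measurable_high [measurable]: "case_prod (high a) \<in> borel_measurable (\<mu> \<Otimes>\<^sub>M \<mu>)"
  unfolding high_def by measurable

lemma measurable_recentred [measurable]: "case_prod (recentred a) \<in> borel_measurable (\<mu> \<Otimes>\<^sub>M \<mu>)"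
  unfolding recentred_def by measurable

lemma low_bound: "0 \<le> a \<Longrightarrow> norm (low a x y) \<le> a"
  by (simp add: low_def)

lemma high_eq: "high a x y = h x y - low a x y"
  by (simp add: low_def high_def)

lemma integrable_low1: "0 \<le> a \<Longrightarrow> y \<in> space \<mu> \<Longrightarrow> integrable \<mu> (\<lambda>x. low a x y)"
  by (rule integrable_const_bound[of _ a]) (auto simp: low_bound)

lemma integrable_low2: "0 \<le> a \<Longrightarrow> x \<in> space \<mu> \<Longrightarrow> integrable \<mu> (\<lambda>y. low a x y)"
  by (rule integrable_const_bound[of _ a]) (auto simp: low_bound)

lemma norm_integral_le_const:
  fixes f :: "'s \<Rightarrow> 'h"
  assumes "f \<in> borel_measurable \<mu>" "\<And>x. x \<in> space \<mu> \<Longrightarrow> norm (f x) \<le> a"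
  shows "norm (\<integral>x. f x \<partial>\<mu>) \<le> a"
proof -
  have "norm (\<integral>x. f x \<partial>\<mu>) \<le> (\<integral>x. norm (f x) \<partial>\<mu>)" by (rule integral_norm_bound)
  also have "\<dots> \<le> a"
    using assms by (intro integral_le_const integrable_norm integrable_const_bound[of _ a]) auto
  finally show ?thesis .
qed

text \<open>For \<open>y\<close> outside \<open>space \<mu>\<close> the section may fail to be
  measurable; then its integral is 0 by convention. This yields bounds for all arguments, as
  \<open>bounded_degenerate_sum_square\<close> requires.\<close>

lemma norm_mean1: "0 \<le> a \<Longrightarrow> norm (\<integral>x. low a x y \<partial>\<mu>) \<le> a"
  by (cases "integrable \<mu> (\<lambda>x. low a x y)")
     (auto intro!: norm_integral_le_const simp: low_bound not_integrable_integral_eq)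

lemma norm_mean2: "0 \<le> a \<Longrightarrow> norm (\<integral>y. low a x y \<partial>\<mu>) \<le> a"
  by (cases "integrable \<mu> (\<lambda>y. low a x y)")
     (auto intro!: norm_integral_le_const simp: low_bound not_integrable_integral_eq)

lemma norm_mean12: "0 \<le> a \<Longrightarrow> norm (\<integral>y. \<integral>x. low a x y \<partial>\<mu> \<partial>\<mu>) \<le> a"
  by (intro norm_integral_le_const norm_mean1) auto

lemma recentred_bound:
  assumes "0 \<le> a"
  shows "norm (recentred a x y) \<le> 4 * a"
proof -
  have "norm (recentred a x y) \<le> norm (low a x y) + norm (\<integral>x'. low a x' y \<partial>\<mu>)
      + norm (\<integral>y'. low a x y' \<partial>\<mu>) + norm (\<integral>y'. \<integral>x'. low a x' y' \<partial>\<mu> \<partial>\<mu>)"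
    unfolding recentred_def by (intro order_trans[OF norm_triangle_ineq] add_mono order_trans[OF norm_triangle_ineq4] order_refl)
  with low_bound[OF assms, of x y] norm_mean1[OF assms, of y] norm_mean2[OF assms, of x] norm_mean12[OF assms]
  show ?thesis by linarith
qed

lemma integrable_means:
  assumes "0 \<le> a"
  shows "integrable \<mu> (\<lambda>y. \<integral>x. low a x y \<partial>\<mu>)" "integrable \<mu> (\<lambda>x. \<integral>y. low a x y \<partial>\<mu>)"
  using norm_mean1[OF assms] norm_mean2[OF assms]
  by (auto intro!: integrable_const_bound[of _ a])

text \<open>The constant in \<open>recentred\<close> integrates in one order, whereas averaging
  \<open>recentred\<close> over \<open>x\<close> produces the other one.\<close>

lemma mean_swap:
  assumes "0 \<le> a"
  shows "(\<integral>x. \<integral>y. low a x y \<partial>\<mu> \<partial>\<mu>) = (\<integral>y. \<integral>x. low a x y \<partial>\<mu> \<partial>\<mu>)"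
proof -
  interpret MM: pair_prob_space \<mu> \<mu> ..
  have "integrable (\<mu> \<Otimes>\<^sub>M \<mu>) (case_prod (low a))"
    by (rule MM.integrable_const_bound[of _ a]) (auto simp: low_bound assms)
  then show ?thesis by (intro MM.Fubini_integral[symmetric])
qed

lemma recentred_degenerate1:
  assumes "0 \<le> a" "y \<in> space \<mu>"
  shows "(\<integral>x. recentred a x y \<partial>\<mu>) = 0"
  unfolding recentred_def
  using integrable_low1[OF assms] integrable_means[OF assms(1)] mean_swap[OF assms(1)]
  by (simp add: prob_space)

lemma recentred_degenerate2:
  assumes "0 \<le> a" "x \<in> space \<mu>"
  shows "(\<integral>y. recentred a x y \<partial>\<mu>) = 0"
  unfolding recentred_def
  using integrable_low2[OF assms] integrable_means[OF assms(1)]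
  by (simp add: prob_space)

lemma nn_integral_le_moment:
  assumes "\<And>x y. f x y \<le> ennreal K * ennreal (norm (h x y) powr t)" "0 \<le> K"
  shows "(\<integral>\<^sup>+x. \<integral>\<^sup>+y. f x y \<partial>\<mu> \<partial>\<mu>) \<le> ennreal (K * C)"
proof -
  have "(\<integral>\<^sup>+x. \<integral>\<^sup>+y. f x y \<partial>\<mu> \<partial>\<mu>) \<le> (\<integral>\<^sup>+x. \<integral>\<^sup>+y. ennreal K * ennreal (norm (h x y) powr t) \<partial>\<mu> \<partial>\<mu>)"
    by (intro nn_integral_mono assms)
  also have "\<dots> = ennreal K * (\<integral>\<^sup>+x. \<integral>\<^sup>+y. ennreal (norm (h x y) powr t) \<partial>\<mu> \<partial>\<mu>)"
    by (simp add: nn_integral_cmult cong: nn_integral_cong)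
  also have "\<dots> \<le> ennreal K * ennreal C"
    by (intro mult_left_mono moment) auto
  finally show ?thesis using C \<open>0 \<le> K\<close> by (simp add: ennreal_mult)
qed

text \<open>Where \<open>norm (h x y) > a\<close>, the factor
  \<open>norm (h x y) powr (1 - t)\<close> is at most \<open>a powr (1 - t)\<close>, since
  \<open>t > 1\<close>.\<close>

lemma high_moment:
  assumes "0 < a"
  shows "(\<integral>\<^sup>+x. \<integral>\<^sup>+y. ennreal (norm (high a x y)) \<partial>\<mu> \<partial>\<mu>) \<le> ennreal (a powr (1 - t) * C)"
proof (rule nn_integral_le_moment)
  show "ennreal (norm (high a x y)) \<le> ennreal (a powr (1 - t)) * ennreal (norm (h x y) powr t)" for x y
  proof (cases "norm (h x y) \<le> a")
    case False
    then have "norm (h x y) = norm (h x y) powr (1 - t) * norm (h x y) powr t"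
      using assms by (simp add: powr_add[symmetric])
    also have "\<dots> \<le> a powr (1 - t) * norm (h x y) powr t"
      using False assms t by (intro mult_right_mono powr_mono2') auto
    finally show ?thesis using False by (simp add: high_def ennreal_mult[symmetric] ennreal_leI)
  qed (simp add: high_def)
qed simp

text \<open>Where \<open>norm (h x y) \<le> a\<close>, the factor
  \<open>norm (h x y) powr (2 - t)\<close> is at most \<open>a powr (2 - t)\<close>, since
  \<open>t < 2\<close>.\<close>

lemma low_moment:
  assumes "0 < a"
  shows "(\<integral>\<^sup>+x. \<integral>\<^sup>+y. ennreal ((norm (low a x y))\<^sup>2) \<partial>\<mu> \<partial>\<mu>) \<le> ennreal (a powr (2 - t) * C)"
proof (rule nn_integral_le_moment)
  show "ennreal ((norm (low a x y))\<^sup>2) \<le> ennreal (a powr (2 - t)) * ennreal (norm (h x y) powr t)" for x y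
  proof (cases "norm (h x y) \<le> a \<and> h x y \<noteq> 0")
    case True
    then have "(norm (h x y))\<^sup>2 = norm (h x y) powr (2 - t) * norm (h x y) powr t"
      by (simp add: powr_add[symmetric])
    also have "\<dots> \<le> a powr (2 - t) * norm (h x y) powr t"
      using True t by (intro mult_right_mono powr_mono2) auto
    finally show ?thesis using True by (simp add: low_def ennreal_mult[symmetric] ennreal_leI)
  qed (auto simp: low_def)
qed simp

lemma nn_integral_swap:
  assumes "case_prod f \<in> borel_measurable (\<mu> \<Otimes>\<^sub>M \<mu>)"
  shows "(\<integral>\<^sup>+x. \<integral>\<^sup>+y. f x y \<partial>\<mu> \<partial>\<mu>) = (\<integral>\<^sup>+y. \<integral>\<^sup>+x. f x y \<partial>\<mu> \<partial>\<mu>)"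
proof -
  interpret MM: pair_prob_space \<mu> \<mu> ..
  show ?thesis using MM.Fubini'[OF assms] by simp
qed

lemma norm_integral_le_complement:
  fixes f k :: "'s \<Rightarrow> 'h"
  assumes "integrable \<mu> f" "integrable \<mu> k" "(\<integral>x. f x \<partial>\<mu>) = 0"
  shows "ennreal (norm (\<integral>x. k x \<partial>\<mu>)) \<le> (\<integral>\<^sup>+x. ennreal (norm (f x - k x)) \<partial>\<mu>)"
  using integral_norm_bound_ennreal[OF Bochner_Integration.integrable_diff[OF assms(1,2)]] assms by simp

text \<open>As \<open>h\<close> is degenerate, the mean of \<open>low a\<close> is minus that of
  \<open>high a\<close>; hence the corrections made by recentring are as small as the discarded
  tail. Sections of \<open>h\<close> are integrable only almost everywhere, so the estimate is an
  \<open>AE\<close> one.\<close>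

lemma norm_mean1_le_high:
  assumes "0 \<le> a"
  shows "AE y in \<mu>. ennreal (norm (\<integral>x. low a x y \<partial>\<mu>)) \<le> (\<integral>\<^sup>+x. ennreal (norm (high a x y)) \<partial>\<mu>)"
proof -
  interpret MM: pair_prob_space \<mu> \<mu> ..
  have "AE y in \<mu>. integrable \<mu> (\<lambda>x. h x y)"
    using MM.AE_integrable_snd[OF h_int] by simp
  with deg1 AE_space show ?thesis
    by eventually_elim (use norm_integral_le_complement integrable_low1[OF assms] in \<open>fastforce simp: high_eq\<close>)
qed

lemma norm_mean2_le_high:
  assumes "0 \<le> a"
  shows "AE x in \<mu>. ennreal (norm (\<integral>y. low a x y \<partial>\<mu>)) \<le> (\<integral>\<^sup>+y. ennreal (norm (high a x y)) \<partial>\<mu>)"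
proof -
  interpret MM: pair_prob_space \<mu> \<mu> ..
  have "AE x in \<mu>. integrable \<mu> (\<lambda>y. h x y)"
    using MM.AE_integrable_fst'[OF h_int] by simp
  with deg2 AE_space show ?thesis
    by eventually_elim (use norm_integral_le_complement integrable_low2[OF assms] in \<open>fastforce simp: high_eq\<close>)
qed

text \<open>The difference consists of \<open>high a\<close> and the three correction terms; each of
  the four has first moment at most that of \<open>high a\<close>, whence the factor 4.\<close>

lemma recentred_error:
  assumes "0 < a"
  shows "(\<integral>\<^sup>+x. \<integral>\<^sup>+y. ennreal (norm (h x y - recentred a x y)) \<partial>\<mu> \<partial>\<mu>) \<le> ennreal (4 * (a powr (1 - t) * C))"
proof -
  let ?H = "\<lambda>x y. ennreal (norm (high a x y))"
  let ?m1 = "\<lambda>y. \<integral>x. low a x y \<partial>\<mu>" and ?m2 = "\<lambda>x. \<integral>y. low a x y \<partial>\<mu>"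
  let ?m = "\<integral>y. \<integral>x. low a x y \<partial>\<mu> \<partial>\<mu>"
  have a: "0 \<le> a" using assms by simp
  define D where "D = (\<integral>\<^sup>+x. \<integral>\<^sup>+y. ?H x y \<partial>\<mu> \<partial>\<mu>)"
  have D: "D \<le> ennreal (a powr (1 - t) * C)" unfolding D_def by (rule high_moment[OF assms])
  have m1: "(\<integral>\<^sup>+y. ennreal (norm (?m1 y)) \<partial>\<mu>) \<le> D"
  proof -
    have "(\<integral>\<^sup>+y. ennreal (norm (?m1 y)) \<partial>\<mu>) \<le> (\<integral>\<^sup>+y. \<integral>\<^sup>+x. ?H x y \<partial>\<mu> \<partial>\<mu>)"
      by (intro nn_integral_mono_AE norm_mean1_le_high a)
    also have "\<dots> = D" unfolding D_def by (intro nn_integral_swap[symmetric]) measurable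
    finally show ?thesis .
  qed
  have m2: "(\<integral>\<^sup>+x. ennreal (norm (?m2 x)) \<partial>\<mu>) \<le> D"
    unfolding D_def by (intro nn_integral_mono_AE norm_mean2_le_high a)
  have m: "ennreal (norm ?m) \<le> D"
    using integral_norm_bound_ennreal[OF integrable_means(1)[OF a]] m1 by (rule order_trans)
  have pw: "ennreal (norm (h x y - recentred a x y))
      \<le> ?H x y + ennreal (norm (?m1 y)) + ennreal (norm (?m2 x)) + ennreal (norm ?m)" for x y
  proof -
    have eq: "h x y - recentred a x y = high a x y + ?m1 y + ?m2 x - ?m"
      by (simp add: recentred_def high_eq)
    have "norm (h x y - recentred a x y) \<le> norm (high a x y) + norm (?m1 y) + norm (?m2 x) + norm ?m"
      unfolding eq
      by (intro order_trans[OF norm_triangle_ineq4] order_trans[OF norm_triangle_ineq] add_mono order_refl)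
    then have "ennreal (norm (h x y - recentred a x y))
        \<le> ennreal (norm (high a x y) + norm (?m1 y) + norm (?m2 x) + norm ?m)"
      by (rule ennreal_leI)
    then show ?thesis by (simp add: ennreal_plus)
  qed
  have "(\<integral>\<^sup>+x. \<integral>\<^sup>+y. ennreal (norm (h x y - recentred a x y)) \<partial>\<mu> \<partial>\<mu>)
      \<le> (\<integral>\<^sup>+x. \<integral>\<^sup>+y. ?H x y + ennreal (norm (?m1 y)) + ennreal (norm (?m2 x)) + ennreal (norm ?m) \<partial>\<mu> \<partial>\<mu>)"
    by (intro nn_integral_mono pw)
  also have "\<dots> = D + (\<integral>\<^sup>+y. ennreal (norm (?m1 y)) \<partial>\<mu>) + (\<integral>\<^sup>+x. ennreal (norm (?m2 x)) \<partial>\<mu>) + ennreal (norm ?m)"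
    unfolding D_def by (simp add: nn_integral_add emeasure_space_1 cong: nn_integral_cong)
  also have "\<dots> \<le> D + D + D + D" by (intro add_mono m1 m2 m order_refl)
  also have "\<dots> \<le> ennreal (a powr (1 - t) * C) + ennreal (a powr (1 - t) * C)
      + ennreal (a powr (1 - t) * C) + ennreal (a powr (1 - t) * C)"
    by (intro add_mono D)
  also have "\<dots> = ennreal (4 * (a powr (1 - t) * C))"
    using C by (simp add: ennreal_plus[symmetric] del: ennreal_plus)
  finally show ?thesis .
qed

text \<open>By Jensen's inequality each of the four terms of \<open>recentred a\<close> has second
  moment at most that of \<open>low a\<close>. One factor 4 counts the terms, the other comes from
  squaring a sum of four.\<close>

lemma recentred_square:
  assumes "0 < a"
  shows "(\<integral>\<^sup>+x. \<integral>\<^sup>+y. ennreal ((norm (recentred a x y))\<^sup>2) \<partial>\<mu> \<partial>\<mu>) \<le> ennreal (16 * (a powr (2 - t) * C))"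
proof -
  let ?Q = "\<lambda>x y. ennreal ((norm (low a x y))\<^sup>2)"
  let ?m1 = "\<lambda>y. \<integral>x. low a x y \<partial>\<mu>" and ?m2 = "\<lambda>x. \<integral>y. low a x y \<partial>\<mu>"
  let ?m = "\<integral>y. \<integral>x. low a x y \<partial>\<mu> \<partial>\<mu>"
  have a: "0 \<le> a" using assms by simp
  define D where "D = (\<integral>\<^sup>+x. \<integral>\<^sup>+y. ?Q x y \<partial>\<mu> \<partial>\<mu>)"
  have D: "D \<le> ennreal (a powr (2 - t) * C)" unfolding D_def by (rule low_moment[OF assms])
  have m1: "(\<integral>\<^sup>+y. ennreal ((norm (?m1 y))\<^sup>2) \<partial>\<mu>) \<le> D"
  proof -
    have "(\<integral>\<^sup>+y. ennreal ((norm (?m1 y))\<^sup>2) \<partial>\<mu>) \<le> (\<integral>\<^sup>+y. \<integral>\<^sup>+x. ?Q x y \<partial>\<mu> \<partial>\<mu>)"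
      by (intro nn_integral_mono norm_integral_power2_le[where b=a] low_bound a) measurable
    also have "\<dots> = D" unfolding D_def by (intro nn_integral_swap[symmetric]) measurable
    finally show ?thesis .
  qed
  have m2: "(\<integral>\<^sup>+x. ennreal ((norm (?m2 x))\<^sup>2) \<partial>\<mu>) \<le> D"
    unfolding D_def by (intro nn_integral_mono norm_integral_power2_le[where b=a] low_bound a) measurable
  have m: "ennreal ((norm ?m)\<^sup>2) \<le> D"
    by (rule order_trans[OF norm_integral_power2_le[where b=a] m1]) (use norm_mean1[OF a] in auto)
  have pw: "ennreal ((norm (recentred a x y))\<^sup>2)
      \<le> 4 * (?Q x y + ennreal ((norm (?m1 y))\<^sup>2) + ennreal ((norm (?m2 x))\<^sup>2) + ennreal ((norm ?m)\<^sup>2))" for x y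
  proof -
    have sq: "(p + q + r + s)\<^sup>2 \<le> 4 * (p\<^sup>2 + q\<^sup>2 + r\<^sup>2 + s\<^sup>2)" for p q r s :: real
    proof -
      have "0 \<le> (p - q)\<^sup>2 + (p - r)\<^sup>2 + (p - s)\<^sup>2 + (q - r)\<^sup>2 + (q - s)\<^sup>2 + (r - s)\<^sup>2" by simp
      then show ?thesis by (simp add: power2_eq_square algebra_simps)
    qed
    have "norm (recentred a x y) \<le> norm (low a x y) + norm (?m1 y) + norm (?m2 x) + norm ?m"
      unfolding recentred_def by (intro order_trans[OF norm_triangle_ineq] add_mono order_trans[OF norm_triangle_ineq4] order_refl)
    then have "(norm (recentred a x y))\<^sup>2 \<le> (norm (low a x y) + norm (?m1 y) + norm (?m2 x) + norm ?m)\<^sup>2"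
      by (intro power_mono) auto
    also note sq
    finally have "ennreal ((norm (recentred a x y))\<^sup>2)
        \<le> ennreal (4 * ((norm (low a x y))\<^sup>2 + (norm (?m1 y))\<^sup>2 + (norm (?m2 x))\<^sup>2 + (norm ?m)\<^sup>2))"
      by (rule ennreal_leI)
    then show ?thesis by (simp add: ennreal_mult ennreal_plus)
  qed
  have "(\<integral>\<^sup>+x. \<integral>\<^sup>+y. ennreal ((norm (recentred a x y))\<^sup>2) \<partial>\<mu> \<partial>\<mu>)
      \<le> (\<integral>\<^sup>+x. \<integral>\<^sup>+y. 4 * (?Q x y + ennreal ((norm (?m1 y))\<^sup>2) + ennreal ((norm (?m2 x))\<^sup>2) + ennreal ((norm ?m)\<^sup>2)) \<partial>\<mu> \<partial>\<mu>)"
    by (intro nn_integral_mono pw)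
  also have "\<dots> = 4 * (D + (\<integral>\<^sup>+y. ennreal ((norm (?m1 y))\<^sup>2) \<partial>\<mu>) + (\<integral>\<^sup>+x. ennreal ((norm (?m2 x))\<^sup>2) \<partial>\<mu>) + ennreal ((norm ?m)\<^sup>2))"
    unfolding D_def by (simp add: nn_integral_add nn_integral_cmult emeasure_space_1 cong: nn_integral_cong)
  also have "\<dots> \<le> 4 * (D + D + D + D)" by (intro mult_left_mono add_mono m1 m2 m order_refl) auto
  also have "\<dots> \<le> 4 * (ennreal (a powr (2 - t) * C) + ennreal (a powr (2 - t) * C)
      + ennreal (a powr (2 - t) * C) + ennreal (a powr (2 - t) * C))"
    by (intro mult_left_mono add_mono D) auto
  also have "\<dots> = ennreal 4 * ennreal (4 * (a powr (2 - t) * C))"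
    using C by (simp add: ennreal_plus[symmetric] mult_ac del: ennreal_plus)
  also have "\<dots> = ennreal (16 * (a powr (2 - t) * C))"
    using C by (subst ennreal_mult[symmetric]) auto
  finally show ?thesis .
qed

text \<open>The kernel is replaced by \<open>recentred a\<close>. The replacement costs a first
  moment for each of at most \<open>(2 ^ k)^2\<close> pairs; for the recentred sums, windows of
  \<open>n\<close> columns have second moment linear in \<open>n\<close>, so the maximal inequality
  applies.\<close>

lemma iid_maximal:
  assumes "0 < a" and I: "finite I" "A \<subseteq> I" "{c..<c + 2 ^ k} \<subseteq> I" "A \<inter> {c..<c + 2 ^ k} = {}"
    and cA: "card A \<le> 2 ^ k"
  shows "(\<integral>\<^sup>+x. ennreal (max_partial (\<lambda>v. \<Sum>u\<in>A. h (x u) (x v)) c (2 ^ k)) \<partial>PiM I (\<lambda>_. \<mu>))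
     \<le> ennreal (4 * (2 ^ k)\<^sup>2 * (a powr (1 - t) * C) + 4 * (real k + 1) * 2 ^ k * (a powr (1 - t / 2) * sqrt C))"
proof -
  let ?P = "PiM I (\<lambda>_. \<mu>)"
  interpret PP: prob_space ?P by (intro prob_space_PiM prob_space_axioms)
  \<comment> \<open>Extended by 0 outside \<open>I\<close>, because the maximal inequality asks for
    measurability at every index.\<close>
  define Z where "Z v x = (if v \<in> I then \<Sum>u\<in>A. h (x u) (x v) else 0)" for v and x :: "nat \<Rightarrow> 's"
  define Y where "Y v x = (if v \<in> I then \<Sum>u\<in>A. recentred a (x u) (x v) else 0)" for v and x :: "nat \<Rightarrow> 's"
  have AI: "u \<in> I" if "u \<in> A" for u using that I by auto
  have mZ [measurable]: "Z v \<in> borel_measurable ?P" for v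
  proof (cases "v \<in> I")
    case True
    then have "(\<lambda>x. \<Sum>u\<in>A. h (x u) (x v)) \<in> borel_measurable ?P"
      using AI by (intro borel_measurable_sum) measurable
    then show ?thesis using True by (simp add: Z_def[abs_def])
  qed (simp add: Z_def[abs_def])
  have mY [measurable]: "Y v \<in> borel_measurable ?P" for v
  proof (cases "v \<in> I")
    case True
    then have "(\<lambda>x. \<Sum>u\<in>A. recentred a (x u) (x v)) \<in> borel_measurable ?P"
      using AI by (intro borel_measurable_sum) measurable
    then show ?thesis using True by (simp add: Y_def[abs_def])
  qed (simp add: Y_def[abs_def])
  \<comment> \<open>The square root of the maximal inequality's bound with variance parameter
    \<open>16 * (a powr (2 - t) * C) * 2 ^ k\<close> per column; \<open>0 < C\<close> makes it
    positive, as needed for passing from second to first moments.\<close>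
  define s where "s = 4 * (real k + 1) * 2 ^ k * (a powr (1 - t / 2) * sqrt C)"
  have s: "0 < s" using C \<open>0 < a\<close> by (simp add: s_def)
  have s2: "s\<^sup>2 = (16 * (a powr (2 - t) * C)) * (2 ^ k) * (real k + 1)\<^sup>2 * 2 ^ k"
  proof -
    have "(a powr (1 - t / 2))\<^sup>2 = a powr (2 - t)"
      by (simp add: power2_eq_square powr_add[symmetric])
    have sq4: "(4 * K * m * (p * q))\<^sup>2 = 16 * K\<^sup>2 * m\<^sup>2 * (p\<^sup>2 * q\<^sup>2)" for K m p q :: real
      by (simp add: power_mult_distrib)
    have "s\<^sup>2 = 16 * (real k + 1)\<^sup>2 * (2 ^ k)\<^sup>2 * ((a powr (1 - t / 2))\<^sup>2 * (sqrt C)\<^sup>2)"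
      unfolding s_def by (rule sq4)
    with \<open>(a powr (1 - t / 2))\<^sup>2 = a powr (2 - t)\<close> have "s\<^sup>2 = 16 * (real k + 1)\<^sup>2 * (2 ^ k)\<^sup>2 * (a powr (2 - t) * C)" using C by simp
    then show ?thesis by (simp add: power2_eq_square)
  qed
  have sq: "(\<integral>\<^sup>+x. ennreal ((norm (\<Sum>v\<in>{c + d..<c + d + n}. Y v x))\<^sup>2) \<partial>?P)
      \<le> ennreal ((16 * (a powr (2 - t) * C)) * (2 ^ k) * n)" if dn: "d + n \<le> 2 ^ k" for d n
  proof -
    let ?B = "{c + d..<c + d + n}"
    have B: "?B \<subseteq> {c..<c + 2 ^ k}" using dn by auto
    have eq: "(\<Sum>v\<in>?B. Y v x) = (\<Sum>(u, v)\<in>A \<times> ?B. recentred a (x u) (x v))" for x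
    proof -
      have "(\<Sum>v\<in>?B. Y v x) = (\<Sum>v\<in>?B. \<Sum>u\<in>A. recentred a (x u) (x v))"
        using B I(3) by (intro sum.cong refl) (auto simp: Y_def subset_eq)
      also have "\<dots> = (\<Sum>u\<in>A. \<Sum>v\<in>?B. recentred a (x u) (x v))" by (rule sum.swap)
      finally show ?thesis by (simp add: sum.cartesian_product)
    qed
    have "(\<integral>\<^sup>+x. ennreal ((norm (\<Sum>v\<in>?B. Y v x))\<^sup>2) \<partial>?P) \<le> ennreal ((16 * (a powr (2 - t) * C)) * (card A * card ?B))"
      unfolding eq
    proof (rule bounded_degenerate_sum_square[where b="4 * a"])
      show "(\<integral>\<^sup>+x. \<integral>\<^sup>+y. ennreal ((norm (recentred a x y))\<^sup>2) \<partial>\<mu> \<partial>\<mu>) \<le> ennreal (16 * (a powr (2 - t) * C))"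
        by (rule recentred_square) fact
    qed (use recentred_bound recentred_degenerate1 recentred_degenerate2 I B C \<open>0 < a\<close> prob_space_axioms in auto)
    also have "(16 * (a powr (2 - t) * C)) * (card A * card ?B) \<le> (16 * (a powr (2 - t) * C)) * (2 ^ k * n)"
      using cA C by (intro mult_left_mono) (auto intro!: mult_right_mono simp flip: of_nat_le_iff)
    finally show ?thesis by (simp add: mult_ac ennreal_leI)
  qed
  \<comment> \<open>The shift by \<open>c\<close> matters: with offset 0 the second-moment
    hypothesis covers only windows inside \<open>{c..<c + 2 ^ k}\<close>, and none to the left that
    could meet \<open>A\<close>.\<close>
  have Ysq: "(\<integral>\<^sup>+x. ennreal ((max_partial (\<lambda>v. Y (c + v) x) 0 (2 ^ k))\<^sup>2) \<partial>?P) \<le> ennreal (s\<^sup>2)"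
    unfolding s2
  proof (rule rademacher_menshov[where B="2 ^ k"])
    fix d n :: nat assume dn: "d + n \<le> 2 ^ k"
    have "(\<Sum>v\<in>{d..<d+n}. Y (c + v) x) = (\<Sum>v\<in>{c + d..<c + d + n}. Y v x)" for x
      using sum.shift_bounds_nat_ivl[of "\<lambda>v. Y v x" d c "d + n"] by (simp add: add_ac)
    then show "(\<integral>\<^sup>+x. ennreal ((norm (\<Sum>v\<in>{d..<d+n}. Y (c + v) x))\<^sup>2) \<partial>?P)
        \<le> ennreal ((16 * (a powr (2 - t) * C)) * (2 ^ k) * n)"
      using sq[OF dn] by simp
  qed (use C in auto)
  have "max_partial (\<lambda>v. Y (c + v) x) 0 (2 ^ k) = max_partial (\<lambda>v. Y v x) c (2 ^ k)" for x
    by (rule max_partial_shift)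
  then have "(\<integral>\<^sup>+x. ennreal ((max_partial (\<lambda>v. Y v x) c (2 ^ k))\<^sup>2) \<partial>?P)
      = (\<integral>\<^sup>+x. ennreal ((max_partial (\<lambda>v. Y (c + v) x) 0 (2 ^ k))\<^sup>2) \<partial>?P)"
    by (intro nn_integral_cong) simp
  with Ysq have Ysq': "(\<integral>\<^sup>+x. ennreal ((max_partial (\<lambda>v. Y v x) c (2 ^ k))\<^sup>2) \<partial>?P) \<le> ennreal (s\<^sup>2)"
    by (rule ord_eq_le_trans[rotated])
  have mYmax: "(\<lambda>x. max_partial (\<lambda>v. Y v x) c (2 ^ k)) \<in> borel_measurable ?P"
    by (rule measurable_max_partial) (rule mY)
  have Ymax: "(\<integral>\<^sup>+x. ennreal (max_partial (\<lambda>v. Y v x) c (2 ^ k)) \<partial>?P) \<le> ennreal s"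
    by (rule nn_integral_le_of_square[OF mYmax PP.prob_space_axioms s Ysq'])
  have err: "(\<integral>\<^sup>+x. ennreal (\<Sum>v\<in>{c..<c + 2 ^ k}. norm (Z v x - Y v x)) \<partial>?P)
      \<le> ennreal (4 * (2 ^ k)\<^sup>2 * (a powr (1 - t) * C))"
  proof -
    let ?T = "{c..<c + 2 ^ k} \<times> A"
    let ?e = "\<lambda>x u v. ennreal (norm (h (x u) (x v) - recentred a (x u) (x v)))"
    have "ennreal (\<Sum>v\<in>{c..<c + 2 ^ k}. norm (Z v x - Y v x)) \<le> (\<Sum>(v, u)\<in>?T. ?e x u v)" for x
    proof -
      have "(\<Sum>v\<in>{c..<c + 2 ^ k}. norm (Z v x - Y v x))
          \<le> (\<Sum>v\<in>{c..<c + 2 ^ k}. \<Sum>u\<in>A. norm (h (x u) (x v) - recentred a (x u) (x v)))"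
        using I by (intro sum_mono) (auto simp: Z_def Y_def sum_subtractf[symmetric] intro: norm_sum)
      then have "ennreal (\<Sum>v\<in>{c..<c + 2 ^ k}. norm (Z v x - Y v x))
          \<le> ennreal (\<Sum>v\<in>{c..<c + 2 ^ k}. \<Sum>u\<in>A. norm (h (x u) (x v) - recentred a (x u) (x v)))"
        by (rule ennreal_leI)
      also have "\<dots> = (\<Sum>v\<in>{c..<c + 2 ^ k}. \<Sum>u\<in>A. ?e x u v)"
        by (simp add: sum_nonneg)
      finally show ?thesis by (simp only: sum.cartesian_product)
    qed
    then have "(\<integral>\<^sup>+x. ennreal (\<Sum>v\<in>{c..<c + 2 ^ k}. norm (Z v x - Y v x)) \<partial>?P)
        \<le> (\<integral>\<^sup>+x. (\<Sum>p\<in>?T. ?e x (snd p) (fst p)) \<partial>?P)"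
      by (intro nn_integral_mono) (simp add: case_prod_unfold)
    also have "\<dots> = (\<Sum>p\<in>?T. \<integral>\<^sup>+x. ?e x (snd p) (fst p) \<partial>?P)"
    proof (rule nn_integral_sum)
      fix p assume "p \<in> ?T"
      then have [measurable]: "fst p \<in> I" "snd p \<in> I" using I by auto
      show "(\<lambda>x. ?e x (snd p) (fst p)) \<in> borel_measurable ?P" by measurable
    qed
    also have "\<dots> = (\<Sum>p\<in>?T. (\<integral>\<^sup>+x. \<integral>\<^sup>+y. ennreal (norm (h x y - recentred a x y)) \<partial>\<mu> \<partial>\<mu>))"
      using I by (intro sum.cong refl nn_integral_PiM_two_coordinates[where f="\<lambda>x y. ennreal (norm (h x y - recentred a x y))"]
          prob_space_axioms) auto
    also have "\<dots> \<le> (\<Sum>p\<in>?T. ennreal (4 * (a powr (1 - t) * C)))"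
      by (intro sum_mono recentred_error[OF assms(1)])
    also have "\<dots> = ennreal (card ?T * (4 * (a powr (1 - t) * C)))"
      using C by (simp add: ennreal_mult ennreal_of_nat_eq_real_of_nat)
    also have "card ?T * (4 * (a powr (1 - t) * C)) \<le> 4 * (2 ^ k)\<^sup>2 * (a powr (1 - t) * C)"
    proof -
      have "real (card ?T) \<le> (2 ^ k)\<^sup>2"
        using cA by (simp add: card_cartesian_product power2_eq_square flip: of_nat_le_iff)
      then have "real (card ?T) * (4 * (a powr (1 - t) * C)) \<le> (2 ^ k)\<^sup>2 * (4 * (a powr (1 - t) * C))"
        using C by (intro mult_right_mono) auto
      then show ?thesis by (simp add: mult_ac)
    qed
    finally show ?thesis by (simp add: ennreal_leI)
  qed
  have eqZ: "max_partial (\<lambda>v. \<Sum>u\<in>A. h (x u) (x v)) c (2 ^ k) = max_partial (\<lambda>v. Z v x) c (2 ^ k)" for x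
    unfolding max_partial_def using I
    by (intro arg_cong[of _ _ Max] image_cong refl arg_cong[of _ _ norm] sum.cong) (auto simp: Z_def subset_eq)
  have "(\<integral>\<^sup>+x. ennreal (max_partial (\<lambda>v. Z v x) c (2 ^ k)) \<partial>?P)
      \<le> (\<integral>\<^sup>+x. ennreal (\<Sum>v\<in>{c..<c + 2 ^ k}. norm (Z v x - Y v x)) + ennreal (max_partial (\<lambda>v. Y v x) c (2 ^ k)) \<partial>?P)"
  proof (rule nn_integral_mono)
    fix x
    show "ennreal (max_partial (\<lambda>v. Z v x) c (2 ^ k))
      \<le> ennreal (\<Sum>v\<in>{c..<c + 2 ^ k}. norm (Z v x - Y v x)) + ennreal (max_partial (\<lambda>v. Y v x) c (2 ^ k))"
      using ennreal_leI[OF max_partial_diff_le[of "\<lambda>v. Z v x" c "2 ^ k" "\<lambda>v. Y v x"]]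
      by (simp add: ennreal_plus sum_nonneg max_partial_nonneg add.commute)
  qed
  also have "\<dots> = (\<integral>\<^sup>+x. ennreal (\<Sum>v\<in>{c..<c + 2 ^ k}. norm (Z v x - Y v x)) \<partial>?P)
      + (\<integral>\<^sup>+x. ennreal (max_partial (\<lambda>v. Y v x) c (2 ^ k)) \<partial>?P)"
    using mYmax by (intro nn_integral_add measurable_compose[OF _ measurable_ennreal] borel_measurable_sum) measurable
  also have "\<dots> \<le> ennreal (4 * (2 ^ k)\<^sup>2 * (a powr (1 - t) * C)) + ennreal s"
    by (intro add_mono err Ymax)
  also have "\<dots> = ennreal (4 * (2 ^ k)\<^sup>2 * (a powr (1 - t) * C) + s)"
    using C s by (intro ennreal_plus[symmetric]) auto
  finally show ?thesis by (simp add: eqZ s_def)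
qed

end

section \<open>Mixing sequences\<close>

text \<open>Subadditivity of truncation, which allows each term of a decomposition to be truncated
  separately at the same level.\<close>

lemma min_add_le_ennreal:
  fixes x y c :: ennreal
  shows "min (x + y) c \<le> min x c + min y c"
  by (cases "x \<le> c"; cases "y \<le> c") (auto simp: min_def add_increasing add_increasing2)

lemma min_sum_le_ennreal:
  fixes c :: ennreal
  assumes "finite T"
  shows "min (\<Sum>x\<in>T. f x) c \<le> (\<Sum>x\<in>T. min (f x) c)"
  using assms
proof (induction T)
  case (insert x T)
  have "min (\<Sum>x\<in>insert x T. f x) c \<le> min (f x) c + min (\<Sum>x\<in>T. f x) c"
    using insert by (simp add: min_add_le_ennreal)
  also have "\<dots> \<le> min (f x) c + (\<Sum>x\<in>T. min (f x) c)" using insert by (intro add_left_mono)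
  finally show ?case using insert by simp
qed simp

section \<open>Generated sub-algebras and their mixing coefficients\<close>

lemma subalgebra_sigma_gen:
  assumes "\<And>i. X i \<in> M \<rightarrow>\<^sub>M borel"
  shows "subalgebra M (sigma_gen M X I)"
proof -
  have "(\<Union>i\<in>I. {X i -` B \<inter> space M |B. B \<in> sets borel}) \<subseteq> sets M"
    using assms by (auto intro: measurable_sets)
  moreover have "(\<Union>i\<in>I. {X i -` B \<inter> space M |B. B \<in> sets borel}) \<subseteq> Pow (space M)" by auto
  ultimately show ?thesis
    by (simp add: subalgebra_def sigma_gen_def sets.sigma_sets_subset)
qed

lemma subalgebra_sigma_gen_mono:
  assumes "I \<subseteq> J"
  shows "subalgebra (sigma_gen M X J) (sigma_gen M X I)"
proof -
  have "(\<Union>i\<in>I. {X i -` B \<inter> space M |B. B \<in> sets borel}) \<subseteq> (\<Union>i\<in>J. {X i -` B \<inter> space M |B. B \<in> sets borel})"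
    using assms by blast
  moreover have "(\<Union>i\<in>J. {X i -` B \<inter> space M |B. B \<in> sets borel}) \<subseteq> Pow (space M)" by auto
  ultimately show ?thesis
    by (simp add: subalgebra_def sigma_gen_def sigma_sets_mono')
qed

lemma measurable_sigma_gen:
  assumes "i \<in> I"
  shows "X i \<in> sigma_gen M X I \<rightarrow>\<^sub>M borel"
proof (rule measurableI)
  fix B :: "'b::topological_space set" assume "B \<in> sets borel"
  then have "X i -` B \<inter> space M \<in> (\<Union>i\<in>I. {X i -` B \<inter> space M |B. B \<in> sets borel})" using assms by blast
  moreover have "(\<Union>i\<in>I. {X i -` B \<inter> space M |B. B \<in> sets borel}) \<subseteq> Pow (space M)" by auto
  ultimately show "X i -` B \<inter> space (sigma_gen M X I) \<in> sets (sigma_gen M X I)"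
    by (auto simp: sigma_gen_def)
qed simp

text \<open>The empty set and the whole space are independent of every event. This covers the first
  block of a decoupling, whose past is empty and thus not among the pasts \<open>{1..l}\<close> with
  \<open>l \<ge> 1\<close> in \<open>beta_mixing\<close>.\<close>

lemma beta_coeff_trivial:
  assumes "prob_space M" and X: "\<And>i. X i \<in> M \<rightarrow>\<^sub>M borel" and G: "subalgebra M G"
  shows "beta_coeff M (sigma_gen M X {}) G = 0"
proof -
  interpret prob_space M by fact
  have "(\<Sum>A\<in>P. \<Sum>B\<in>Q. \<bar>measure M (A \<inter> B) - measure M A * measure M B\<bar>) = 0"
    if P: "P \<in> finite_partitions (sigma_gen M X {})" and Q: "Q \<in> finite_partitions G" for P Q
  proof -
    have "A = {} \<or> A = space M" if "A \<in> P" for A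
      using P that by (auto simp: finite_partitions_def sigma_gen_def sigma_sets_empty_eq)
    moreover have "B \<subseteq> space M" if "B \<in> Q" for B
      using Q that G by (auto simp: finite_partitions_def subalgebra_def dest: sets.sets_into_space)
    ultimately have "\<bar>measure M (A \<inter> B) - measure M A * measure M B\<bar> = 0" if "A \<in> P" "B \<in> Q" for A B
    proof -
      have B: "space M \<inter> B = B" using \<open>\<And>B. B \<in> Q \<Longrightarrow> B \<subseteq> space M\<close>[OF that(2)] by blast
      from \<open>\<And>A. A \<in> P \<Longrightarrow> A = {} \<or> A = space M\<close>[OF that(1)] show ?thesis
        by (elim disjE) (simp_all add: B prob_space)
    qed
    then show ?thesis by (intro sum.neutral ballI)
  qed
  then have "(SUP (P, Q) \<in> finite_partitions (sigma_gen M X {}) \<times> finite_partitions G.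
        \<Sum>A\<in>P. \<Sum>B\<in>Q. \<bar>measure M (A \<inter> B) - measure M A * measure M B\<bar>)
      = (SUP z \<in> finite_partitions (sigma_gen M X {}) \<times> finite_partitions G. 0)"
    by (intro SUP_cong refl) auto
  also have "\<dots> = 0"
    using finite_partitions_nonempty by (intro cSUP_const) auto
  finally show ?thesis unfolding beta_coeff_def by simp
qed

lemma beta_mixing_ge:
  assumes "prob_space M" and X: "\<And>i. X i \<in> M \<rightarrow>\<^sub>M borel" and "1 \<le> l"
  shows "beta_coeff M (sigma_gen M X {1..l}) (sigma_gen M X {l + int k..}) \<le> beta_mixing M X k"
  unfolding beta_mixing_def
  using assms beta_coeff_le_1[OF assms(1) subalgebra_sigma_gen subalgebra_sigma_gen, OF X X]
  by (intro cSUP_upper bdd_aboveI[of _ 1]) auto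

lemma beta_mixing_nonneg:
  assumes "prob_space M" and X: "\<And>i. X i \<in> M \<rightarrow>\<^sub>M borel"
  shows "0 \<le> beta_mixing M X k"
  using beta_coeff_nonneg[OF assms(1) subalgebra_sigma_gen subalgebra_sigma_gen, OF X X]
    beta_mixing_ge[OF assms order_refl, where k=k] by (rule order_trans)

lemma beta_mixing_antimono:
  assumes "prob_space M" and X: "\<And>i. X i \<in> M \<rightarrow>\<^sub>M borel" and "k \<le> k'"
  shows "beta_mixing M X k' \<le> beta_mixing M X k"
  unfolding beta_mixing_def
proof (rule cSUP_mono)
  show "bdd_above ((\<lambda>l. beta_coeff M (sigma_gen M X {1..l}) (sigma_gen M X {l + int k..})) ` {1..})"
    using beta_coeff_le_1[OF assms(1) subalgebra_sigma_gen subalgebra_sigma_gen, OF X X]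
    by (intro bdd_aboveI[of _ 1]) auto
  fix l :: int assume l: "l \<in> {1..}"
  have "beta_coeff M (sigma_gen M X {1..l}) (sigma_gen M X {l + int k'..})
      \<le> beta_coeff M (sigma_gen M X {1..l}) (sigma_gen M X {l + int k..})"
    using assms by (intro beta_coeff_mono subalgebra_sigma_gen subalgebra_sigma_gen_mono) auto
  with l show "\<exists>m\<in>{1..}. beta_coeff M (sigma_gen M X {1..l}) (sigma_gen M X {l + int k'..})
      \<le> beta_coeff M (sigma_gen M X {1..m}) (sigma_gen M X {m + int k..})" by blast
qed simp

text \<open>Starts that are \<open>2 q\<close> apart leave a free stretch of length \<open>q\<close>
  before each block of length \<open>q\<close>: all earlier blocks lie in
  \<open>{1..s w - q}\<close>, at distance \<open>q\<close> from \<open>s w\<close>.\<close>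

lemma block_decouple:
  fixes X :: "int \<Rightarrow> 'a \<Rightarrow> 's::topological_space" and s :: "nat \<Rightarrow> int"
  assumes "prob_space M" and X: "\<And>i. X i \<in> M \<rightarrow>\<^sub>M borel"
    and s1: "\<And>w. 1 \<le> s w" and gap: "\<And>v w. v < w \<Longrightarrow> w < R \<Longrightarrow> s v + 2 * int q \<le> s w"
    and f: "f \<in> borel_measurable (PiM {..<R} (\<lambda>w. sigma_gen M X {s w..<s w + int q}))"
    and bd: "\<And>x. f x \<le> ennreal L" "0 < L"
  shows "(\<integral>\<^sup>+\<omega>. f (\<lambda>w\<in>{..<R}. \<omega>) \<partial>M)
    \<le> (\<integral>\<^sup>+x. f x \<partial>PiM {..<R} (\<lambda>_. M)) + ennreal (L * (2 * beta_mixing M X q * R))"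
proof (rule nn_integral_decouple[where G="\<lambda>w. sigma_gen M X {s w..<s w + int q}"
      and H="\<lambda>w. sigma_gen M X {1..if w = 0 then 0 else s w - int q}"])
  fix v w assume "v < w" "w < R"
  with gap[of v w] s1[of v] show "subalgebra (sigma_gen M X {1..if w = 0 then 0 else s w - int q}) (sigma_gen M X {s v..<s v + int q})"
    by (intro subalgebra_sigma_gen_mono) auto
next
  fix w assume w: "w < R"
  show "beta_coeff M (sigma_gen M X {1..if w = 0 then 0 else s w - int q}) (sigma_gen M X {s w..<s w + int q}) \<le> beta_mixing M X q"
  \<comment> \<open>The first block has no predecessor; the empty interval \<open>{1..0}\<close>
    stands for its past.\<close>
  proof (cases "w = 0")
    case True
    then show ?thesis
      using beta_coeff_trivial[where X=X, OF assms(1) X subalgebra_sigma_gen, OF X] beta_mixing_nonneg[OF assms(1) X] by simp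
  next
    case False
    define l where "l = s w - int q"
    have l: "1 \<le> l" using gap[of 0 w] s1[of 0] False w by (simp add: l_def)
    have "beta_coeff M (sigma_gen M X {1..l}) (sigma_gen M X {s w..<s w + int q})
        \<le> beta_coeff M (sigma_gen M X {1..l}) (sigma_gen M X {l + int q..})"
      using assms by (intro beta_coeff_mono subalgebra_sigma_gen subalgebra_sigma_gen_mono) (auto simp: l_def)
    also have "\<dots> \<le> beta_mixing M X q" by (rule beta_mixing_ge[OF assms(1) X l])
    finally show ?thesis using False by (simp add: l_def)
  qed
qed (intro assms(1) subalgebra_sigma_gen X f bd beta_mixing_nonneg[OF assms(1) X])+

text \<open>Stationarity enters the estimates as a common law \<open>\<mu>\<close> and as one
  first-moment bound for all pairs \<open>i < j\<close>; uniformity in \<open>i\<close> is essential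
  because halving produces shifted stretches.\<close>

locale mixing_kernel = degenerate_kernel \<mu> h t C
  for \<mu> :: "'s::topological_space measure"
    and h :: "'s \<Rightarrow> 's \<Rightarrow> 'h::{real_inner, banach, second_countable_topology}" and t C :: real +
  fixes M :: "'a measure" and X :: "int \<Rightarrow> 'a \<Rightarrow> 's" and C0 :: real
  assumes prob_M: "prob_space M"
    and X_meas [measurable]: "\<And>i. X i \<in> M \<rightarrow>\<^sub>M borel"
    and X_distr: "\<And>i. distr M borel (X i) = \<mu>"
    and near: "\<And>i j. i < j \<Longrightarrow> (\<integral>\<^sup>+\<omega>. ennreal (norm (h (X i \<omega>) (X j \<omega>))) \<partial>M) \<le> ennreal C0"
    and C0: "0 \<le> C0"
begin

lemma sets_mu [measurable_cong]: "sets \<mu> = sets borel"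
  using X_distr[of 0] by (metis sets_distr)

lemma measurable_h:
  assumes "f \<in> P \<rightarrow>\<^sub>M borel" "g \<in> P \<rightarrow>\<^sub>M borel"
  shows "(\<lambda>x. h (f x) (g x)) \<in> borel_measurable P"
proof -
  have "f \<in> P \<rightarrow>\<^sub>M \<mu>" "g \<in> P \<rightarrow>\<^sub>M \<mu>"
    using assms measurable_cong_sets[OF refl sets_mu] by auto
  then have "(\<lambda>x. (f x, g x)) \<in> P \<rightarrow>\<^sub>M \<mu> \<Otimes>\<^sub>M \<mu>" by (rule measurable_Pair)
  from measurable_compose[OF this h_meas] show ?thesis by simp
qed

definition iid_bound :: "nat \<Rightarrow> real \<Rightarrow> real" where
  "iid_bound k a = 4 * (2 ^ k)\<^sup>2 * (a powr (1 - t) * C) + 4 * (real k + 1) * 2 ^ k * (a powr (1 - t / 2) * sqrt C)"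

lemma iid_bound_nonneg: "0 \<le> iid_bound k a"
  using C by (auto simp: iid_bound_def)

text \<open>The functional is truncated at \<open>L\<close> only to be decoupled. Under the product
  measure the truncation is dropped, and for each of the \<open>q^2\<close> pairs of positions
  \<open>x\<close>, \<open>y\<close> a U-statistic with one i.i.d. variable per block
  remains.\<close>

lemma separated_blocks_bound:
  fixes s :: "nat \<Rightarrow> int"
  assumes r: "r = 2 ^ k" and s1: "\<And>w. 1 \<le> s w"
    and gap: "\<And>v w. v < w \<Longrightarrow> w < r - 1 + r \<Longrightarrow> s v + 2 * int q \<le> s w"
    and L: "0 < L" and a: "0 < a"
  shows "(\<integral>\<^sup>+\<omega>. min (\<Sum>x<q. \<Sum>y<q. ennreal (max_partial (\<lambda>v. \<Sum>u<r - 1.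
            h (X (s u + int x) \<omega>) (X (s (r - 1 + v) + int y) \<omega>)) 0 r)) (ennreal L) \<partial>M)
    \<le> ennreal ((real q)\<^sup>2 * iid_bound k a + L * (2 * beta_mixing M X q * (2 * r)))"
proof -
  interpret MP: prob_space M by (rule prob_M)
  \<comment> \<open>There are \<open>r - 1\<close> left blocks, the group next to the right half
    having been removed, and \<open>r\<close> right ones. Coordinate \<open>w\<close> of the product
    carries block \<open>w\<close>.\<close>
  define R where "R = r - 1 + r"
  have r0: "0 < r" by (simp add: r)
  define T where "T x y w = ennreal (max_partial (\<lambda>v. \<Sum>u<r - 1.
     h (X (s u + int x) (w u)) (X (s (r - 1 + v) + int y) (w (r - 1 + v)))) 0 r)" for x y and w :: "nat \<Rightarrow> 'a"
  define f where "f w = min (\<Sum>x<q. \<Sum>y<q. T x y w) (ennreal L)" for w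
  have T_meas: "T x y \<in> borel_measurable (PiM {..<R} (\<lambda>w. G w))"
    if G: "\<And>w z. w < R \<Longrightarrow> z < q \<Longrightarrow> X (s w + int z) \<in> G w \<rightarrow>\<^sub>M borel" and "x < q" "y < q" for x y G
  proof -
    have comp: "(\<lambda>w. X (s i + int z) (w i)) \<in> PiM {..<R} (\<lambda>w. G w) \<rightarrow>\<^sub>M borel" if "i < R" "z < q" for i z
      using measurable_compose[OF measurable_component_singleton[of i "{..<R}" G] G[OF that]] that by simp
    show ?thesis
      unfolding T_def using that(2,3) r0
      by (intro measurable_compose[OF _ measurable_ennreal] measurable_max_partial_le borel_measurable_sum
          measurable_h comp) (auto simp: R_def)
  qed
  have "(\<integral>\<^sup>+\<omega>. f (\<lambda>w\<in>{..<R}. \<omega>) \<partial>M)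
      \<le> (\<integral>\<^sup>+w. f w \<partial>PiM {..<R} (\<lambda>_. M)) + ennreal (L * (2 * beta_mixing M X q * R))"
  proof (rule block_decouple[where s=s])
    show "f \<in> borel_measurable (PiM {..<R} (\<lambda>w. sigma_gen M X {s w..<s w + int q}))"
      unfolding f_def
      by (intro borel_measurable_min borel_measurable_sum borel_measurable_const T_meas measurable_sigma_gen) auto
  qed (use prob_M X_meas s1 gap L in \<open>auto simp: f_def R_def\<close>)
  also have "(\<integral>\<^sup>+w. f w \<partial>PiM {..<R} (\<lambda>_. M)) \<le> (\<integral>\<^sup>+w. (\<Sum>x<q. \<Sum>y<q. T x y w) \<partial>PiM {..<R} (\<lambda>_. M))"
    by (intro nn_integral_mono) (simp add: f_def)
  also have "\<dots> = (\<Sum>x<q. \<Sum>y<q. \<integral>\<^sup>+w. T x y w \<partial>PiM {..<R} (\<lambda>_. M))"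
    by (subst nn_integral_sum; (intro sum.cong refl nn_integral_sum)?)
      (auto intro!: borel_measurable_sum T_meas)
  also have "\<dots> \<le> (\<Sum>x<q. \<Sum>y<q. ennreal (iid_bound k a))"
  proof (intro sum_mono)
    fix x y assume xy: "x \<in> {..<q}" "y \<in> {..<q}"
    \<comment> \<open>Once the positions are fixed, each block contributes a single variable:
      position \<open>x\<close> in left blocks, \<open>y\<close> in right ones.\<close>
    define \<xi> where "\<xi> i = X (s i + int (if i < r - 1 then x else y))" for i
    let ?\<phi> = "\<lambda>w. \<lambda>i\<in>{..<R}. \<xi> i (w i)"
    let ?g = "\<lambda>z. ennreal (max_partial (\<lambda>v. \<Sum>u<r - 1. h (z u) (z v)) (r - 1) r)"
    have dist: "distr (PiM {..<R} (\<lambda>_. M)) (PiM {..<R} (\<lambda>_. \<mu>)) ?\<phi> = PiM {..<R} (\<lambda>_. \<mu>)"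
      using X_distr by (intro distr_PiM_coordinatewise[where N=borel] prob_M prob_space_axioms) (auto simp: \<xi>_def)
    have \<phi>: "?\<phi> \<in> PiM {..<R} (\<lambda>_. M) \<rightarrow>\<^sub>M PiM {..<R} (\<lambda>_. \<mu>)"
    proof (rule measurable_restrict)
      fix i assume i: "i \<in> {..<R}"
      have "(\<lambda>w. \<xi> i (w i)) \<in> PiM {..<R} (\<lambda>_. M) \<rightarrow>\<^sub>M borel"
        unfolding \<xi>_def using i by (intro measurable_compose[OF measurable_component_singleton[of i "{..<R}" "\<lambda>_. M"] X_meas])
      then show "(\<lambda>w. \<xi> i (w i)) \<in> PiM {..<R} (\<lambda>_. M) \<rightarrow>\<^sub>M \<mu>"
        using measurable_cong_sets[OF refl sets_mu] by auto
    qed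
    have comp: "(\<lambda>z. z i) \<in> PiM {..<R} (\<lambda>_. \<mu>) \<rightarrow>\<^sub>M borel" if "i < R" for i
      using measurable_component_singleton[of i "{..<R}" "\<lambda>_. \<mu>"] that measurable_cong_sets[OF refl sets_mu] by auto
    have g: "?g \<in> borel_measurable (PiM {..<R} (\<lambda>_. \<mu>))"
      using r0 by (intro measurable_compose[OF _ measurable_ennreal] measurable_max_partial_le borel_measurable_sum
          measurable_h comp) (auto simp: R_def)
    have "(\<integral>\<^sup>+w. T x y w \<partial>PiM {..<R} (\<lambda>_. M)) = (\<integral>\<^sup>+w. ?g (?\<phi> w) \<partial>PiM {..<R} (\<lambda>_. M))"
    proof (rule nn_integral_cong)
      fix w
      have "max_partial (\<lambda>v. \<Sum>u<r - 1. h (?\<phi> w u) (?\<phi> w v)) (r - 1) r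
          = max_partial (\<lambda>v. \<Sum>u<r - 1. h (?\<phi> w u) (?\<phi> w (r - 1 + v))) 0 r"
        by (rule max_partial_shift[symmetric])
      also have "\<dots> = max_partial (\<lambda>v. \<Sum>u<r - 1.
            h (X (s u + int x) (w u)) (X (s (r - 1 + v) + int y) (w (r - 1 + v)))) 0 r"
        by (intro max_partial_cong sum.cong refl) (auto simp: \<xi>_def R_def)
      finally show "T x y w = ?g (?\<phi> w)" by (simp only: T_def)
    qed
    also have "\<dots> = (\<integral>\<^sup>+z. ?g z \<partial>distr (PiM {..<R} (\<lambda>_. M)) (PiM {..<R} (\<lambda>_. \<mu>)) ?\<phi>)"
      by (rule nn_integral_distr[symmetric, OF \<phi>]) (use g in simp)
    also have "\<dots> = (\<integral>\<^sup>+z. ?g z \<partial>PiM {..<R} (\<lambda>_. \<mu>))" by (simp only: dist)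
    also have "\<dots> \<le> ennreal (iid_bound k a)"
      unfolding r iid_bound_def by (rule iid_maximal[OF a]) (auto simp: R_def r)
    finally show "(\<integral>\<^sup>+w. T x y w \<partial>PiM {..<R} (\<lambda>_. M)) \<le> ennreal (iid_bound k a)" .
  qed
  also have "(\<Sum>x<q. \<Sum>y<q. ennreal (iid_bound k a)) = ennreal ((real q)\<^sup>2 * iid_bound k a)"
    using iid_bound_nonneg[of k a]
    by (simp add: ennreal_of_nat_eq_real_of_nat ennreal_mult power2_eq_square mult.assoc)
  also have "\<dots> + ennreal (L * (2 * beta_mixing M X q * R)) \<le> \<dots> + ennreal (L * (2 * beta_mixing M X q * (2 * r)))"
    using L beta_mixing_nonneg[OF prob_M X_meas]
    by (intro add_left_mono ennreal_leI mult_left_mono) (auto simp: R_def)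
  also have "\<dots> = ennreal ((real q)\<^sup>2 * iid_bound k a + L * (2 * beta_mixing M X q * (2 * r)))"
    using L beta_mixing_nonneg[OF prob_M X_meas, where k=q] iid_bound_nonneg[of k a] by (intro ennreal_plus[symmetric]) auto
  also have "(\<integral>\<^sup>+\<omega>. f (\<lambda>w\<in>{..<R}. \<omega>) \<partial>M) = (\<integral>\<^sup>+\<omega>. min (\<Sum>x<q. \<Sum>y<q. ennreal (max_partial (\<lambda>v. \<Sum>u<r - 1.
            h (X (s u + int x) \<omega>) (X (s (r - 1 + v) + int y) \<omega>)) 0 r)) (ennreal L) \<partial>M)"
    unfolding f_def T_def
    by (intro nn_integral_cong arg_cong2[of _ _ _ _ min] refl sum.cong arg_cong[of _ _ ennreal] max_partial_cong)
      (auto simp: R_def)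
  finally show ?thesis by (simp add: add_right_mono)
qed

text \<open>Groups of length \<open>2 q\<close> are cut in half. Choosing one half, \<open>e\<close>
  or \<open>e'\<close> in \<open>{0, q}\<close>, uniformly for all left groups and for all right
  groups gives the four parity classes, in each of which consecutive blocks start at least
  \<open>2 q\<close> apart.\<close>

lemma cross_bound:
  assumes r: "r = 2 ^ k" and a0: "1 \<le> a0" and q: "0 < q" and L: "0 < L" and a: "0 < a"
  shows "(\<integral>\<^sup>+\<omega>. min (ennreal (max_partial (\<lambda>j. \<Sum>i<r * (2 * q).
            h (X (a0 + int i) \<omega>) (X (a0 + int (r * (2 * q) + j)) \<omega>)) 0 (r * (2 * q)))) (ennreal L) \<partial>M)
    \<le> ennreal (2 * real q * (real r * (2 * real q)) * C0
        + 4 * ((real q)\<^sup>2 * iid_bound k a + L * (2 * beta_mixing M X q * (2 * r))))"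
proof -
  define d where "d = 2 * q"
  have d0: "0 < d" and r0: "0 < r" using q by (auto simp: d_def r)
  define g where "g \<omega> i j = h (X (a0 + int i) \<omega>) (X (a0 + int (r * d + j)) \<omega>)" for \<omega> i j
  have g_meas [measurable]: "(\<lambda>\<omega>. g \<omega> i j) \<in> borel_measurable M" for i j
    unfolding g_def by (intro measurable_h X_meas)
  let ?near = "\<lambda>\<omega>. \<Sum>i\<in>{(r - 1) * d..<r * d}. \<Sum>j<r * d. ennreal (norm (g \<omega> i j))"
  define F where "F \<omega> x y = ennreal (max_partial (\<lambda>v. \<Sum>u<r - 1. g \<omega> (u * d + x) (v * d + y)) 0 r)" for \<omega> x y
  have F_meas [measurable]: "(\<lambda>\<omega>. F \<omega> x y) \<in> borel_measurable M" for x y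
    unfolding F_def by measurable
  define cl where "cl \<omega> e e' = (\<Sum>x<q. \<Sum>y<q. F \<omega> (e + x) (e' + y))" for \<omega> e e'
  have pw: "min (ennreal (max_partial (\<lambda>j. \<Sum>i<r * d. g \<omega> i j) 0 (r * d))) (ennreal L)
      \<le> ?near \<omega> + (\<Sum>e\<in>{0, q}. \<Sum>e'\<in>{0, q}. min (cl \<omega> e e') (ennreal L))" for \<omega>
  proof -
    have "ennreal (max_partial (\<lambda>j. \<Sum>i<r * d. g \<omega> i j) 0 (r * d))
        \<le> ennreal ((\<Sum>i\<in>{(r - 1) * d..<r * d}. \<Sum>j<r * d. norm (g \<omega> i j))
      + (\<Sum>x<d. \<Sum>y<d. max_partial (\<lambda>v. \<Sum>u<r - 1. g \<omega> (u * d + x) (v * d + y)) 0 r))"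
      by (intro ennreal_leI cross_sum_le d0 r0)
    also have "\<dots> = ?near \<omega> + (\<Sum>x<d. \<Sum>y<d. F \<omega> x y)"
      unfolding F_def by (simp add: ennreal_plus sum_nonneg max_partial_nonneg)
    also have "(\<Sum>x<d. \<Sum>y<d. F \<omega> x y) = (\<Sum>e\<in>{0, q}. \<Sum>e'\<in>{0, q}. cl \<omega> e e')"
      using q unfolding d_def cl_def by (simp add: sum_lessThan_double sum.distrib add_ac)
    finally have "min (ennreal (max_partial (\<lambda>j. \<Sum>i<r * d. g \<omega> i j) 0 (r * d))) (ennreal L)
        \<le> min (?near \<omega> + (\<Sum>e\<in>{0, q}. \<Sum>e'\<in>{0, q}. cl \<omega> e e')) (ennreal L)"
      by (rule min.mono) simp
    also have "\<dots> \<le> min (?near \<omega>) (ennreal L) + min (\<Sum>e\<in>{0, q}. \<Sum>e'\<in>{0, q}. cl \<omega> e e') (ennreal L)"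
      by (rule min_add_le_ennreal)
    also have "\<dots> \<le> ?near \<omega> + (\<Sum>e\<in>{0, q}. min (\<Sum>e'\<in>{0, q}. cl \<omega> e e') (ennreal L))"
      by (intro add_mono min_sum_le_ennreal) auto
    also have "\<dots> \<le> ?near \<omega> + (\<Sum>e\<in>{0, q}. \<Sum>e'\<in>{0, q}. min (cl \<omega> e e') (ennreal L))"
      by (intro add_left_mono sum_mono min_sum_le_ennreal) auto
    finally show ?thesis .
  qed
  have near_int: "(\<integral>\<^sup>+\<omega>. ?near \<omega> \<partial>M) \<le> ennreal (2 * real q * (real r * (2 * real q)) * C0)"
  proof -
    have "(\<integral>\<^sup>+\<omega>. ?near \<omega> \<partial>M) = (\<Sum>i\<in>{(r - 1) * d..<r * d}. \<Sum>j<r * d. \<integral>\<^sup>+\<omega>. ennreal (norm (g \<omega> i j)) \<partial>M)"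
      by (simp add: nn_integral_sum del: sum_ennreal)
    also have "\<dots> \<le> (\<Sum>i\<in>{(r - 1) * d..<r * d}. \<Sum>j<r * d. ennreal C0)"
      unfolding g_def by (intro sum_mono near) (simp del: of_nat_add of_nat_mult)
    also have "\<dots> = ennreal (real d * (real r * real d) * C0)"
    proof -
      have "r * d - (r - 1) * d = d" using r0 by (cases r) auto
      then show ?thesis using C0
        by (simp add: ennreal_of_nat_eq_real_of_nat ennreal_mult mult.assoc)
    qed
    finally show ?thesis by (simp add: d_def)
  qed
  have cl_int: "(\<integral>\<^sup>+\<omega>. min (cl \<omega> e e') (ennreal L) \<partial>M)
      \<le> ennreal ((real q)\<^sup>2 * iid_bound k a + L * (2 * beta_mixing M X q * (2 * r)))"
    if e: "e \<in> {0, q}" "e' \<in> {0, q}" for e e'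
  proof -
    define s where "s w = (if w < r - 1 then a0 + int (w * d + e) else a0 + int (r * d + (w - (r - 1)) * d + e'))" for w
    have gap: "s v + 2 * int q \<le> s w" if "v < w" "w < r - 1 + r" for v w
    proof -
      have d: "int d = 2 * int q" by (simp add: d_def)
      consider "w < r - 1" | "v < r - 1" "r - 1 \<le> w" | "r - 1 \<le> v" using \<open>v < w\<close> by linarith
      then show ?thesis
      proof cases
        case 1
        have "int (Suc v * d) \<le> int (w * d)" using that by (intro of_nat_mono mult_le_mono1) auto
        then show ?thesis using 1 that by (simp add: s_def d)
      next
        case 2
        \<comment> \<open>The critical gap, between a left and a right block. With the last left
          group kept, the choice \<open>e = q\<close>, \<open>e' = 0\<close> would leave a gap of
          length 0; its removal provides a whole extra group.\<close>
        have "Suc (Suc v) * d \<le> r * d" using 2 by (intro mult_le_mono1) auto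
        then have "d + (d + v * d) \<le> r * d" by (simp only: mult_Suc)
        moreover have "e \<le> q" using e by auto
        ultimately have "v * d + e + 2 * q \<le> r * d + (w - (r - 1)) * d + e'" unfolding d_def by linarith
        then have "a0 + int (v * d + e + 2 * q) \<le> a0 + int (r * d + (w - (r - 1)) * d + e')"
          by (intro add_left_mono) (simp only: of_nat_le_iff)
        moreover have "s v + 2 * int q = a0 + int (v * d + e + 2 * q)" "s w = a0 + int (r * d + (w - (r - 1)) * d + e')"
          using 2 by (simp_all add: s_def)
        ultimately show ?thesis by simp
      next
        case 3
        have "int (Suc (v - (r - 1)) * d) \<le> int ((w - (r - 1)) * d)"
          using that 3 by (intro of_nat_mono mult_le_mono1) auto
        then show ?thesis using 3 that by (simp add: s_def d)
      qed
    qed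
    have s1: "1 \<le> s w" for w
    proof -
      have "a0 \<le> s w" by (simp add: s_def del: of_nat_add of_nat_mult)
      with a0 show ?thesis by simp
    qed
    have eq: "cl \<omega> e e' = (\<Sum>x<q. \<Sum>y<q. ennreal (max_partial (\<lambda>v. \<Sum>u<r - 1.
            h (X (s u + int x) \<omega>) (X (s (r - 1 + v) + int y) \<omega>)) 0 r))" for \<omega>
      unfolding cl_def F_def
    proof (intro sum.cong refl arg_cong[of _ _ ennreal] max_partial_cong)
      fix x y v u assume "u \<in> {..<r - 1}"
      then have "s u + int x = a0 + int (u * d + (e + x))" by (simp add: s_def)
      moreover have "s (r - 1 + v) + int y = a0 + int (r * d + (v * d + (e' + y)))" by (simp add: s_def)
      ultimately show "g \<omega> (u * d + (e + x)) (v * d + (e' + y)) = h (X (s u + int x) \<omega>) (X (s (r - 1 + v) + int y) \<omega>)"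
        by (simp only: g_def)
    qed
    show ?thesis
      unfolding eq by (rule separated_blocks_bound[OF r _ gap L a]) (rule s1)
  qed
  have cl_meas [measurable]: "(\<lambda>\<omega>. cl \<omega> e e') \<in> borel_measurable M" for e e'
    unfolding cl_def by measurable
  have nn: "0 \<le> (real q)\<^sup>2 * iid_bound k a + L * (2 * beta_mixing M X q * (2 * r))"
    using L iid_bound_nonneg beta_mixing_nonneg[OF prob_M X_meas] by simp
  have "(\<integral>\<^sup>+\<omega>. min (ennreal (max_partial (\<lambda>j. \<Sum>i<r * d. g \<omega> i j) 0 (r * d))) (ennreal L) \<partial>M)
      \<le> (\<integral>\<^sup>+\<omega>. ?near \<omega> + (\<Sum>e\<in>{0, q}. \<Sum>e'\<in>{0, q}. min (cl \<omega> e e') (ennreal L)) \<partial>M)"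
    by (intro nn_integral_mono pw)
  also have "\<dots> = (\<integral>\<^sup>+\<omega>. ?near \<omega> \<partial>M) + (\<Sum>e\<in>{0, q}. \<Sum>e'\<in>{0, q}. \<integral>\<^sup>+\<omega>. min (cl \<omega> e e') (ennreal L) \<partial>M)"
    by (subst nn_integral_add) (auto simp: nn_integral_sum simp del: sum_ennreal)
  also have "\<dots> \<le> ennreal (2 * real q * (real r * (2 * real q)) * C0)
      + (\<Sum>e\<in>{0, q}. \<Sum>e'\<in>{0, q}. ennreal ((real q)\<^sup>2 * iid_bound k a + L * (2 * beta_mixing M X q * (2 * r))))"
    by (intro add_mono near_int sum_mono cl_int)
  also have "\<dots> = ennreal (2 * real q * (real r * (2 * real q)) * C0
      + (\<Sum>e\<in>{0, q}. \<Sum>e'\<in>{0, q}. (real q)\<^sup>2 * iid_bound k a + L * (2 * beta_mixing M X q * (2 * r))))"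
    using nn C0 by (simp add: ennreal_plus sum_nonneg del: sum_constant)
  also have "(\<Sum>e\<in>{0, q}. \<Sum>e'\<in>{0, q}. (real q)\<^sup>2 * iid_bound k a + L * (2 * beta_mixing M X q * (2 * r)))
      = 4 * ((real q)\<^sup>2 * iid_bound k a + L * (2 * beta_mixing M X q * (2 * r)))"
    using q by simp
  finally show ?thesis by (simp only: g_def d_def)
qed

section \<open>Recursion over dyadic segments\<close>

definition segment_max :: "int \<Rightarrow> nat \<Rightarrow> 'a \<Rightarrow> real" where
  "segment_max a0 n \<omega> = max_partial (\<lambda>j. \<Sum>i<j. h (X (a0 + int i) \<omega>) (X (a0 + int j) \<omega>)) 0 n"

lemma segment_max_meas [measurable]: "segment_max a0 n \<in> borel_measurable M"
  unfolding segment_max_def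
  by (intro measurable_max_partial borel_measurable_sum measurable_h X_meas)

text \<open>Partial sums over \<open>j\<close> in \<open>segment_max\<close> are the U-statistics of
  the stretch starting at \<open>a0\<close>. Halving gives
  \<open>V (k + 1) \<le> 2 V k + 2 ^ (k + 1) e\<close>, which is solved by
  \<open>V k = 2 ^ k (V 0 + k e)\<close>. The final depth \<open>K\<close> appears in
  \<open>e\<close> so that the same \<open>e\<close> serves all levels; \<open>V 0\<close> counts at
  most \<open>(2 q)^2\<close> pairs by first moments.\<close>

lemma segment_bound:
  assumes q: "0 < q" and L: "0 < L" and a: "0 < a" and "k \<le> K" "1 \<le> a0"
  shows "(\<integral>\<^sup>+\<omega>. min (ennreal (segment_max a0 (2 ^ k * (2 * q)) \<omega>)) (ennreal L) \<partial>M)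
    \<le> ennreal (2 ^ k * (4 * (real q)\<^sup>2 * C0 + k * (2 * (real q)\<^sup>2 * C0 + 8 * beta_mixing M X q * L
        + (real q)\<^sup>2 * (8 * 2 ^ K * (a powr (1 - t) * C) + 8 * (real K + 1) * (a powr (1 - t / 2) * sqrt C)))))"
  using assms(4,5)
proof (induction k arbitrary: a0)
  case 0
  let ?N = "\<lambda>\<omega> i j. ennreal (norm (h (X (a0 + int i) \<omega>) (X (a0 + int j) \<omega>)))"
  have hm [measurable]: "(\<lambda>\<omega>. h (X i \<omega>) (X j \<omega>)) \<in> borel_measurable M" for i j
    by (intro measurable_h X_meas)
  have "min (ennreal (segment_max a0 (2 * q) \<omega>)) (ennreal L) \<le> (\<Sum>j<2 * q. \<Sum>i<j. ?N \<omega> i j)" for \<omega>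
  proof -
    have "segment_max a0 (2 * q) \<omega> \<le> (\<Sum>j\<in>{0..<0 + 2 * q}. norm (\<Sum>i<j. h (X (a0 + int i) \<omega>) (X (a0 + int j) \<omega>)))"
      unfolding segment_max_def by (rule max_partial_le_sum_norm)
    also have "\<dots> \<le> (\<Sum>j\<in>{0..<0 + 2 * q}. \<Sum>i<j. norm (h (X (a0 + int i) \<omega>) (X (a0 + int j) \<omega>)))"
      by (intro sum_mono norm_sum)
    finally have "ennreal (segment_max a0 (2 * q) \<omega>)
        \<le> ennreal (\<Sum>j\<in>{0..<0 + 2 * q}. \<Sum>i<j. norm (h (X (a0 + int i) \<omega>) (X (a0 + int j) \<omega>)))"
      by (rule ennreal_leI)
    also have "\<dots> = (\<Sum>j<2 * q. \<Sum>i<j. ?N \<omega> i j)" by (simp add: sum_nonneg atLeast0LessThan)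
    finally show ?thesis by (simp add: min.coboundedI1)
  qed
  then have "(\<integral>\<^sup>+\<omega>. min (ennreal (segment_max a0 (2 * q) \<omega>)) (ennreal L) \<partial>M)
      \<le> (\<integral>\<^sup>+\<omega>. (\<Sum>j<2 * q. \<Sum>i<j. ?N \<omega> i j) \<partial>M)"
    by (intro nn_integral_mono)
  also have "\<dots> = (\<Sum>j<2 * q. \<Sum>i<j. \<integral>\<^sup>+\<omega>. ?N \<omega> i j \<partial>M)"
    by (simp add: nn_integral_sum del: sum_ennreal)
  also have "\<dots> \<le> (\<Sum>j<2 * q. \<Sum>i<j. ennreal C0)" by (intro sum_mono near) auto
  also have "\<dots> \<le> (\<Sum>j<2 * q. \<Sum>i<2 * q. ennreal C0)" by (intro sum_mono sum_mono2) auto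
  also have "\<dots> = ennreal (4 * (real q)\<^sup>2 * C0)"
    using C0 by (simp add: ennreal_of_nat_eq_real_of_nat ennreal_mult[symmetric] power2_eq_square mult.assoc)
  finally show ?case by simp
next
  case (Suc k)
  define r where "r = (2::nat) ^ k"
  define n where "n = r * (2 * q)"
  define e where "e = 2 * (real q)\<^sup>2 * C0 + 8 * beta_mixing M X q * L
        + (real q)\<^sup>2 * (8 * 2 ^ K * (a powr (1 - t) * C) + 8 * (real K + 1) * (a powr (1 - t / 2) * sqrt C))"
  have n2: "2 ^ Suc k * (2 * q) = n + n" by (simp add: n_def r_def)
  have e0: "0 \<le> e" using C0 C L beta_mixing_nonneg[OF prob_M X_meas] by (simp add: e_def)
  let ?cross = "\<lambda>\<omega>. max_partial (\<lambda>j. \<Sum>i<n. h (X (a0 + int i) \<omega>) (X (a0 + int (n + j)) \<omega>)) 0 n"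
  have cross_meas [measurable]: "?cross \<in> borel_measurable M"
    by (intro measurable_max_partial borel_measurable_sum measurable_h X_meas)
  have pw: "min (ennreal (segment_max a0 (n + n) \<omega>)) (ennreal L)
     \<le> min (ennreal (segment_max a0 n \<omega>)) (ennreal L) + min (ennreal (segment_max (a0 + int n) n \<omega>)) (ennreal L)
       + min (ennreal (?cross \<omega>)) (ennreal L)" for \<omega>
  proof -
    have "segment_max a0 (n + n) \<omega> \<le> segment_max a0 n \<omega> + segment_max (a0 + int n) n \<omega> + ?cross \<omega>"
      using max_partial_halves[of "\<lambda>i j. h (X (a0 + int i) \<omega>) (X (a0 + int j) \<omega>)" n]
      by (simp add: segment_max_def add.assoc)
    then have "ennreal (segment_max a0 (n + n) \<omega>)
        \<le> ennreal (segment_max a0 n \<omega>) + ennreal (segment_max (a0 + int n) n \<omega>) + ennreal (?cross \<omega>)"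
      using ennreal_leI by (fastforce simp: segment_max_def max_partial_nonneg ennreal_plus[symmetric] simp del: ennreal_plus)
    then have "min (ennreal (segment_max a0 (n + n) \<omega>)) (ennreal L)
        \<le> min (ennreal (segment_max a0 n \<omega>) + ennreal (segment_max (a0 + int n) n \<omega>) + ennreal (?cross \<omega>)) (ennreal L)"
      by (rule min.mono) simp
    also have "\<dots> \<le> min (ennreal (segment_max a0 n \<omega>) + ennreal (segment_max (a0 + int n) n \<omega>)) (ennreal L)
        + min (ennreal (?cross \<omega>)) (ennreal L)"
      by (rule min_add_le_ennreal)
    also have "\<dots> \<le> min (ennreal (segment_max a0 n \<omega>)) (ennreal L) + min (ennreal (segment_max (a0 + int n) n \<omega>)) (ennreal L)
        + min (ennreal (?cross \<omega>)) (ennreal L)"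
      by (intro add_right_mono min_add_le_ennreal)
    finally show ?thesis .
  qed
  let ?V = "2 ^ k * (4 * (real q)\<^sup>2 * C0 + k * e)"
  have V0: "0 \<le> ?V" using e0 C0 by simp
  have IH: "(\<integral>\<^sup>+\<omega>. min (ennreal (segment_max a n \<omega>)) (ennreal L) \<partial>M) \<le> ennreal ?V" if "1 \<le> a" for a
    using Suc.IH[OF _ that] Suc.prems(1) by (simp add: e_def n_def r_def)
  have cr: "(\<integral>\<^sup>+\<omega>. min (ennreal (?cross \<omega>)) (ennreal L) \<partial>M) \<le> ennreal (2 * r * e)"
  proof -
    have rK: "real r \<le> 2 ^ K" using Suc.prems(1) by (simp add: r_def power_increasing)
    let ?A = "a powr (1 - t) * C" and ?B = "a powr (1 - t / 2) * sqrt C"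
    have A0: "0 \<le> ?A" and B0: "0 \<le> ?B" using C by auto
    have "(\<integral>\<^sup>+\<omega>. min (ennreal (?cross \<omega>)) (ennreal L) \<partial>M) \<le> ennreal (2 * real q * (real r * (2 * real q)) * C0
        + 4 * ((real q)\<^sup>2 * iid_bound k a + L * (2 * beta_mixing M X q * (2 * r))))"
      unfolding n_def by (rule cross_bound[OF r_def Suc.prems(2) q L a])
    also have "2 * real q * (real r * (2 * real q)) * C0
        + 4 * ((real q)\<^sup>2 * iid_bound k a + L * (2 * beta_mixing M X q * (2 * r)))
      = 2 * r * (2 * (real q)\<^sup>2 * C0 + 8 * beta_mixing M X q * L + (real q)\<^sup>2 * (8 * real r * ?A + 8 * (real k + 1) * ?B))"
      by (simp add: iid_bound_def r_def algebra_simps power2_eq_square)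
    also have "\<dots> \<le> 2 * r * e"
      unfolding e_def using rK A0 B0 Suc.prems(1)
      by (intro mult_left_mono add_left_mono add_mono mult_right_mono) auto
    finally show ?thesis by (simp add: ennreal_leI)
  qed
  have "(\<integral>\<^sup>+\<omega>. min (ennreal (segment_max a0 (n + n) \<omega>)) (ennreal L) \<partial>M)
      \<le> (\<integral>\<^sup>+\<omega>. min (ennreal (segment_max a0 n \<omega>)) (ennreal L) + min (ennreal (segment_max (a0 + int n) n \<omega>)) (ennreal L)
       + min (ennreal (?cross \<omega>)) (ennreal L) \<partial>M)"
    by (intro nn_integral_mono pw)
  also have "\<dots> = (\<integral>\<^sup>+\<omega>. min (ennreal (segment_max a0 n \<omega>)) (ennreal L) \<partial>M)
      + (\<integral>\<^sup>+\<omega>. min (ennreal (segment_max (a0 + int n) n \<omega>)) (ennreal L) \<partial>M)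
      + (\<integral>\<^sup>+\<omega>. min (ennreal (?cross \<omega>)) (ennreal L) \<partial>M)"
    by (simp add: nn_integral_add)
  also have "\<dots> \<le> ennreal ?V + ennreal ?V + ennreal (2 * r * e)"
    using Suc.prems(2) by (intro add_mono IH cr) auto
  also have "\<dots> = ennreal (?V + ?V + 2 * r * e)"
    using V0 e0 by (simp add: ennreal_plus[symmetric] del: ennreal_plus)
  also have "?V + ?V + 2 * r * e = 2 ^ Suc k * (4 * (real q)\<^sup>2 * C0 + Suc k * e)"
    by (simp add: r_def algebra_simps)
  finally show ?case unfolding n2 e_def .
qed

end

section \<open>Choice of the exponents and almost sure convergence\<close>

text \<open>Integrating over the set where \<open>inner (g x) e\<close> is positive shows that this
  set is null. Applied to \<open>e\<close> and \<open>- e\<close> for all \<open>e\<close> in a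
  countable dense set, this makes \<open>g x\<close> orthogonal to a dense set almost
  everywhere.\<close>

lemma AE_zero_of_set_integrals:
  fixes g :: "'s \<Rightarrow> 'h::{real_inner, banach, second_countable_topology}"
  assumes g: "integrable \<mu> g" and z: "\<And>B. B \<in> sets \<mu> \<Longrightarrow> (\<integral>x. indicator B x *\<^sub>R g x \<partial>\<mu>) = 0"
  shows "AE x in \<mu>. g x = 0"
proof -
  have [measurable]: "g \<in> borel_measurable \<mu>" using g by simp
  obtain D :: "'h set" where D: "countable D" "\<And>U. open U \<Longrightarrow> U \<noteq> {} \<Longrightarrow> \<exists>d\<in>D. d \<in> U"
    using countable_dense_exists by blast
  have le: "AE x in \<mu>. inner (g x) e \<le> 0" for e
  proof -
    let ?B = "{x\<in>space \<mu>. 0 < inner (g x) e}"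
    have B: "?B \<in> sets \<mu>" by measurable
    have int: "integrable \<mu> (\<lambda>x. indicator ?B x *\<^sub>R g x)"
      using g B by (intro integrable_mult_indicator)
    have "(\<integral>x. inner (indicator ?B x *\<^sub>R g x) e \<partial>\<mu>) = inner (\<integral>x. indicator ?B x *\<^sub>R g x \<partial>\<mu>) e"
      using int by (intro integral_inner_left)
    also have "\<dots> = 0" using z[OF B] by simp
    finally have zero: "(\<integral>x. inner (indicator ?B x *\<^sub>R g x) e \<partial>\<mu>) = 0" .
    have int': "integrable \<mu> (\<lambda>x. inner (indicator ?B x *\<^sub>R g x) e)"
      using int by (intro integrable_inner_left)
    have "AE x in \<mu>. 0 \<le> inner (indicator ?B x *\<^sub>R g x) e"
      by (intro AE_I2) (auto simp: indicator_def)
    from integral_nonneg_eq_0_iff_AE[OF int' this] zero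
    have "AE x in \<mu>. inner (indicator ?B x *\<^sub>R g x) e = 0" by simp
    then show ?thesis
      using AE_space by eventually_elim (auto simp: indicator_def split: if_splits)
  qed
  have "AE x in \<mu>. \<forall>e\<in>D. inner (g x) e \<le> 0 \<and> inner (g x) (- e) \<le> 0"
    by (intro AE_ball_countable' eventually_conj le D(1))
  then show ?thesis
  proof eventually_elim
    fix x assume x: "\<forall>e\<in>D. inner (g x) e \<le> 0 \<and> inner (g x) (- e) \<le> 0"
    show "g x = 0"
    proof (rule ccontr)
      assume "g x \<noteq> 0"
      \<comment> \<open>A point of the dense set closer to \<open>g x\<close> than 0 is; by
        Pythagoras an orthogonal vector cannot be closer.\<close>
      then obtain e where e: "e \<in> D" "e \<in> ball (g x) (norm (g x))"
        using D(2)[of "ball (g x) (norm (g x))"] by auto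
      have "inner (g x) e = 0" using x e(1) by (auto intro: antisym)
      then have "(norm (g x - e))\<^sup>2 = (norm (g x))\<^sup>2 + (norm e)\<^sup>2"
        by (simp add: power2_norm_eq_inner inner_diff_left inner_diff_right inner_commute)
      moreover have "(norm (g x - e))\<^sup>2 < (norm (g x))\<^sup>2"
        using e(2) by (intro power_strict_mono) (auto simp: dist_norm)
      ultimately show False by (smt (verit) zero_le_power2)
    qed
  qed
qed

text \<open>In the upper half \<open>m / 2 < k \<le> m\<close> of the sum there are at least
  \<open>m / 2\<close> terms, each at least \<open>(m / 2) powr (s - 1) * b m\<close> by
  monotonicity. Comparison with the whole sum yields the constant \<open>2 powr s\<close>.\<close>

lemma antimono_summable_decay:
  fixes b :: "nat \<Rightarrow> real"
  assumes s: "1 \<le> s" and sm: "summable (\<lambda>k. real (Suc k) powr (s - 1) * b (Suc k))"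
    and anti: "\<And>k k'. k \<le> k' \<Longrightarrow> b k' \<le> b k" and b0: "\<And>k. 0 \<le> b k"
  obtains B where "0 \<le> B" "\<And>m. 0 < m \<Longrightarrow> b m \<le> B * real m powr (- s)"
proof
  let ?S = "\<Sum>k. real (Suc k) powr (s - 1) * b (Suc k)"
  have S0: "0 \<le> ?S" using sm b0 by (intro suminf_nonneg) auto
  then show "0 \<le> 2 powr s * ?S" by simp
  fix m :: nat assume m: "0 < m"
  have half: "real m / 2 \<le> real (m - m div 2)" by linarith
  have "(real m / 2) powr s * b m = (real m / 2) * ((real m / 2) powr (s - 1) * b m)"
    using m by (simp add: powr_diff)
  also have "\<dots> \<le> real (m - m div 2) * ((real m / 2) powr (s - 1) * b m)"
    using half b0 by (intro mult_right_mono) auto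
  also have "\<dots> = (\<Sum>k\<in>{m div 2..<m}. (real m / 2) powr (s - 1) * b m)" by simp
  also have "\<dots> \<le> (\<Sum>k\<in>{m div 2..<m}. real (Suc k) powr (s - 1) * b (Suc k))"
  proof (intro sum_mono mult_mono powr_mono2)
    fix k assume k: "k \<in> {m div 2..<m}"
    show "real m / 2 \<le> real (Suc k)" using k by auto
    show "b m \<le> b (Suc k)" using k by (intro anti) auto
  qed (use s b0 in auto)
  also have "\<dots> \<le> ?S" using sm b0 by (intro sum_le_suminf) auto
  finally have "(real m / 2) powr s * b m \<le> ?S" .
  then have le: "2 powr s * real m powr (- s) * ((real m / 2) powr s * b m) \<le> 2 powr s * real m powr (- s) * ?S"
    by (rule mult_left_mono) simp
  have "2 powr s * real m powr (- s) * (real m / 2) powr s = 1"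
    using m by (simp add: powr_divide powr_minus field_simps)
  then have "b m = 2 powr s * real m powr (- s) * ((real m / 2) powr s * b m)"
    by (metis mult.assoc mult_1)
  with le have "b m \<le> 2 powr s * real m powr (- s) * ?S" by simp
  then show "b m \<le> 2 powr s * ?S * real m powr (- s)" by (simp only: mult_ac)
qed

text \<open>
  At \<open>c = 1/s\<close> and \<open>\<alpha> = 2 (p - 1) / (p (t - 1))\<close>, where \<open>s = p (t - 1) / \<delta>\<close>, the first and the
  third exponent vanish, while the second one is negative; the witnesses are a small perturbation.
\<close>

lemma exponents_exist:
  fixes p \<delta> :: real
  assumes p: "1 < p" "p < 2" and d: "0 < \<delta>" "p + \<delta> < 2"
  defines "t \<equiv> p + \<delta>" and "s \<equiv> p + p * (p - 1) / \<delta>"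
  obtains c \<alpha> \<eta> :: real where "0 < c" "c < 1" "0 < \<alpha>" "0 < \<eta>"
    "1 + c - 2 / p + \<alpha> * (1 - t / 2) \<le> - \<eta>" "1 - c - s * c \<le> - \<eta>" "2 - 2 / p + \<alpha> * (1 - t) \<le> - \<eta>"
proof -
  have t: "1 < t" "t < 2" using p d by (auto simp: t_def)
  have s_eq: "s = p * (t - 1) / \<delta>" using d by (simp add: s_def t_def field_simps)
  have s1: "1 < s"
  proof -
    have "0 < p * (p - 1) / \<delta>" using p d by simp
    then show ?thesis using p by (simp add: s_def)
  qed
  \<comment> \<open>At \<open>c = 1 / s\<close> the second exponent is \<open>- 1 / s\<close>;
    lowering \<open>c\<close> by \<open>\<kappa>\<close> raises it by
    \<open>(s + 1) * \<kappa>\<close>, and this choice spends half of the slack. Adding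
    \<open>\<kappa>\<close> to \<open>\<alpha>0\<close> as well makes the other two exponents
    negative.\<close>
  define \<kappa> where "\<kappa> = 1 / (2 * s * (s + 1))"
  define \<alpha>0 where "\<alpha>0 = 2 * (p - 1) / (p * (t - 1))"
  have k0: "0 < \<kappa>" using s1 by (simp add: \<kappa>_def)
  have a0: "0 < \<alpha>0" using p t by (simp add: \<alpha>0_def)
  have ks: "s * \<kappa> * (s + 1) * 2 = 1" using s1 by (simp add: \<kappa>_def)
  let ?c = "1 / s - \<kappa>" and ?\<alpha> = "\<alpha>0 + \<kappa>"
  have inv_s: "1 / s = \<delta> / (p * (t - 1))" using d by (simp add: s_eq)
  \<comment> \<open>After multiplication by \<open>p * (t - 1)\<close> this is
    \<open>p + \<delta> - t = 0\<close>; it explains the value of \<open>s\<close> and hence the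
    exponent in the mixing condition.\<close>
  have crit: "1 + 1 / s - 2 / p + \<alpha>0 * (1 - t / 2) = 0"
  proof -
    have "(1 + 1 / s - 2 / p + \<alpha>0 * (1 - t / 2)) * (p * (t - 1))
        = p * (t - 1) + \<delta> - 2 * (t - 1) + 2 * (p - 1) * (1 - t / 2)"
    proof -
      have expand: "(1 + x - y + z * v) * W = W + x * W - y * W + z * W * v" for x y z v W :: real
        by (simp add: algebra_simps)
      have W: "\<delta> / (p * (t - 1)) * (p * (t - 1)) = \<delta>" "2 / p * (p * (t - 1)) = 2 * (t - 1)"
          "\<alpha>0 * (p * (t - 1)) = 2 * (p - 1)"
        using p t by (simp_all add: \<alpha>0_def)
      have "(1 + 1 / s - 2 / p + \<alpha>0 * (1 - t / 2)) * (p * (t - 1))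
        = p * (t - 1) + \<delta> / (p * (t - 1)) * (p * (t - 1)) - 2 / p * (p * (t - 1))
          + \<alpha>0 * (p * (t - 1)) * (1 - t / 2)"
        unfolding inv_s by (rule expand)
      then show ?thesis by (simp only: W)
    qed
    also have "\<dots> = 0" unfolding t_def by (simp add: field_simps)
    finally show ?thesis using p t by simp
  qed
  have e1: "1 + ?c - 2 / p + ?\<alpha> * (1 - t / 2) = - (\<kappa> * t / 2)"
    using crit by (simp add: algebra_simps)
  have e2: "1 - ?c - s * ?c = - (1 / (2 * s))"
  proof -
    have "(s + 1) * \<kappa> = 1 / (2 * s)" using s1 by (simp add: \<kappa>_def)
    then have "s * \<kappa> + \<kappa> = 1 / (2 * s)" by (simp add: distrib_right)
    moreover have "1 - ?c - s * ?c = - (1 / s) + (s * \<kappa> + \<kappa>)" using s1 by (simp add: algebra_simps)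
    ultimately show ?thesis using s1 by simp
  qed
  have e3: "2 - 2 / p + ?\<alpha> * (1 - t) = - (\<kappa> * (t - 1))"
  proof -
    have "\<alpha>0 * (1 - t) = - (2 * (p - 1) / p)" using p t by (simp add: \<alpha>0_def field_simps)
    then show ?thesis using p by (simp add: algebra_simps diff_divide_distrib)
  qed
  have c0: "0 < ?c"
  proof -
    have "1 / (2 * (s + 1)) < 1" using s1 by simp
    then have "1 / s * (1 / (2 * (s + 1))) < 1 / s * 1" using s1 by (intro mult_strict_left_mono) auto
    then have "\<kappa> < 1 / s" by (simp add: \<kappa>_def mult_ac)
    then show ?thesis by simp
  qed
  have c1: "?c < 1"
  proof -
    have "1 / s < 1" using s1 by simp
    with k0 show ?thesis by linarith
  qed
  define \<eta> where "\<eta> = min (\<kappa> * t / 2) (min (1 / (2 * s)) (\<kappa> * (t - 1)))"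
  have "0 < \<eta>" using k0 t s1 by (simp add: \<eta>_def)
  then show ?thesis
    using c0 c1 a0 k0 by (intro that[of ?c ?\<alpha> \<eta>]) (auto simp: e1 e2 e3 \<eta>_def)
qed

lemma summable_square_geometric:
  assumes "0 < \<eta>"
  shows "summable (\<lambda>N. A * ((real N)\<^sup>2 * 2 powr (- \<eta> * real N)))"
proof -
  have eq: "(2 powr (- \<eta> / 2)) ^ N = 2 powr (- \<eta> / 2 * real N)" for N
    by (subst powr_realpow[symmetric]) (simp_all add: powr_powr)
  have "summable (\<lambda>N. (2 powr (- \<eta> / 2)) ^ N)"
    using assms by (intro summable_geometric) (simp add: powr_less_one)
  then have "summable (\<lambda>N. norm (2 powr (- \<eta> / 2 * real N)))" unfolding eq by simp
  moreover have "(\<lambda>N. (real N)\<^sup>2 * 2 powr (- \<eta> * real N)) \<in> O(\<lambda>N. 2 powr (- \<eta> / 2 * real N))"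
    using assms by real_asymp
  ultimately have "summable (\<lambda>N. (real N)\<^sup>2 * 2 powr (- \<eta> * real N))"
    by (rule summable_comparison_test_bigo)
  then show ?thesis by (rule summable_mult)
qed

section \<open>Laws of stationary sequences and the shape of the U-statistic\<close>

lemma stationary_distr_pair:
  fixes X :: "int \<Rightarrow> 'a \<Rightarrow> 's::{metric_space, second_countable_topology}"
  assumes X: "\<And>i. X i \<in> M \<rightarrow>\<^sub>M borel" and st: "strictly_stationary M X"
  shows "distr M (borel \<Otimes>\<^sub>M borel) (\<lambda>\<omega>. (X (i + k) \<omega>, X (j + k) \<omega>))
    = distr M (borel \<Otimes>\<^sub>M borel) (\<lambda>\<omega>. (X i \<omega>, X j \<omega>))"
proof -
  let ?S = "PiM (UNIV :: int set) (\<lambda>_. borel :: 's measure)"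
  have seq: "(\<lambda>\<omega> i. X (i + k) \<omega>) \<in> M \<rightarrow>\<^sub>M ?S" for k
    using measurable_restrict[of UNIV "\<lambda>i. X (i + k)" M "\<lambda>_. borel", OF X] by (simp add: restrict_def)
  have pr: "(\<lambda>z. (z i, z j)) \<in> ?S \<rightarrow>\<^sub>M borel \<Otimes>\<^sub>M borel"
    by (intro measurable_Pair measurable_component_singleton) auto
  have "distr (distr M ?S (\<lambda>\<omega> i. X (i + k) \<omega>)) (borel \<Otimes>\<^sub>M borel) (\<lambda>z. (z i, z j))
      = distr (distr M ?S (\<lambda>\<omega> i. X (i + 0) \<omega>)) (borel \<Otimes>\<^sub>M borel) (\<lambda>z. (z i, z j))"
    using st by (simp add: strictly_stationary_def)
  then show ?thesis
    unfolding distr_distr[OF pr seq] by (simp add: comp_def)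
qed

lemma stationary_distr:
  fixes X :: "int \<Rightarrow> 'a \<Rightarrow> 's::{metric_space, second_countable_topology}"
  assumes X: "\<And>i. X i \<in> M \<rightarrow>\<^sub>M borel" and st: "strictly_stationary M X"
  shows "distr M borel (X i) = distr M borel (X 1)"
proof -
  have *: "distr (distr M (borel \<Otimes>\<^sub>M borel) (\<lambda>\<omega>. (X j \<omega>, X j \<omega>))) borel fst = distr M borel (X j)" for j
    using X by (subst distr_distr) (auto simp: comp_def)
  show ?thesis
    using stationary_distr_pair[OF X st, of 1 "i - 1" 1] *[of i] *[of 1] by simp
qed

text \<open>Times start at 1, indices at 0. With the larger index outside, \<open>U_stat\<close> is
  a partial sum in \<open>j\<close>, as \<open>segment_max\<close> expects.\<close>

lemma U_stat_eq_sum: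
  "U_stat h X n \<omega> = (\<Sum>j\<in>{0..<0+n}. \<Sum>i<j. h (X (1 + int i) \<omega>) (X (1 + int j) \<omega>))"
proof -
  have "U_stat h X n \<omega> = (\<Sum>(j, i)\<in>Sigma {0..<0+n} (\<lambda>j. {..<j}). h (X (1 + int i) \<omega>) (X (1 + int j) \<omega>))"
    unfolding U_stat_def
    by (rule sum.reindex_bij_witness[of _ "\<lambda>(j, i). (1 + int i, 1 + int j)" "\<lambda>(i, j). (nat (j - 1), nat (i - 1))"])
      auto
  also have "\<dots> = (\<Sum>j\<in>{0..<0+n}. \<Sum>i<j. h (X (1 + int i) \<omega>) (X (1 + int j) \<omega>))"
    by (rule sum.Sigma[symmetric]) auto
  finally show ?thesis .
qed

text \<open>The quotients truncated at 1 have summable expectations, so by monotone convergence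
  their sum is almost surely finite and they tend to 0. Eventually they are below 1, where the
  truncation has no effect.\<close>

lemma AE_tendsto_zero_of_truncated:
  fixes D :: "nat \<Rightarrow> 'a \<Rightarrow> real"
  assumes [measurable]: "\<And>N. D N \<in> borel_measurable M" and D0: "\<And>N \<omega>. 0 \<le> D N \<omega>"
    and L: "\<And>N. 0 < L N" and sm: "summable w" and w0: "\<And>N. 0 \<le> w N"
    and bd: "\<And>N. (\<integral>\<^sup>+\<omega>. min (ennreal (D N \<omega>)) (ennreal (L N)) \<partial>M) \<le> ennreal (L N * w N)"
  shows "AE \<omega> in M. (\<lambda>N. D N \<omega> / L N) \<longlonglongrightarrow> 0"
proof -
  let ?u = "\<lambda>N \<omega>. min (D N \<omega> / L N) 1"
  have u0: "0 \<le> ?u N \<omega>" for N \<omega> using D0 L[of N] by simp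
  have ub: "(\<integral>\<^sup>+\<omega>. ennreal (?u N \<omega>) \<partial>M) \<le> ennreal (w N)" for N
  proof -
    have "ennreal (?u N \<omega>) = ennreal (1 / L N) * min (ennreal (D N \<omega>)) (ennreal (L N))" for \<omega>
    proof -
      have "ennreal (1 / L N) * min (ennreal (D N \<omega>)) (ennreal (L N)) = ennreal (1 / L N * min (D N \<omega>) (L N))"
        using L[of N] D0[of N \<omega>] by (simp add: ennreal_mult[symmetric] min_def)
      also have "1 / L N * min (D N \<omega>) (L N) = ?u N \<omega>"
        using L[of N] by (auto simp: min_def field_simps)
      finally show ?thesis by simp
    qed
    then have "(\<integral>\<^sup>+\<omega>. ennreal (?u N \<omega>) \<partial>M) = ennreal (1 / L N) * (\<integral>\<^sup>+\<omega>. min (ennreal (D N \<omega>)) (ennreal (L N)) \<partial>M)"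
      by (simp add: nn_integral_cmult)
    also have "\<dots> \<le> ennreal (1 / L N) * ennreal (L N * w N)" by (intro mult_left_mono bd) simp
    also have "\<dots> = ennreal (w N)" using L[of N] w0[of N] by (simp add: ennreal_mult[symmetric])
    finally show ?thesis .
  qed
  have "(\<integral>\<^sup>+\<omega>. (\<Sum>N. ennreal (?u N \<omega>)) \<partial>M) = (\<Sum>N. \<integral>\<^sup>+\<omega>. ennreal (?u N \<omega>) \<partial>M)"
    by (intro nn_integral_suminf) measurable
  also have "\<dots> \<le> (\<Sum>N. ennreal (w N))" by (intro suminf_le ub) auto
  also have "\<dots> = ennreal (\<Sum>N. w N)" using w0 sm by (intro suminf_ennreal2)
  finally have "(\<integral>\<^sup>+\<omega>. (\<Sum>N. ennreal (?u N \<omega>)) \<partial>M) \<noteq> \<infinity>"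
    by (auto simp: top_unique)
  then have "AE \<omega> in M. (\<Sum>N. ennreal (?u N \<omega>)) \<noteq> \<infinity>"
    by (intro nn_integral_noteq_infinite) measurable
  then show ?thesis
  proof eventually_elim
    fix \<omega> assume "(\<Sum>N. ennreal (?u N \<omega>)) \<noteq> \<infinity>"
    then have "summable (\<lambda>N. ?u N \<omega>)" using u0 by (intro summable_suminf_not_top) auto
    then have lim: "(\<lambda>N. ?u N \<omega>) \<longlonglongrightarrow> 0" by (rule summable_LIMSEQ_zero)
    then have "\<forall>\<^sub>F N in sequentially. ?u N \<omega> < 1" by (rule order_tendstoD(2)) simp
    then have "\<forall>\<^sub>F N in sequentially. ?u N \<omega> = D N \<omega> / L N" by eventually_elim (simp add: min_def split: if_splits)
    with lim show "(\<lambda>N. D N \<omega> / L N) \<longlonglongrightarrow> 0" by (rule Lim_transform_eventually)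
  qed
qed

text \<open>For \<open>2 ^ N \<le> n < 2 ^ Suc N\<close> the normalisations at \<open>n\<close> and
  at \<open>2 ^ Suc N\<close> differ at most by the factor \<open>2 powr b\<close>;
  \<open>D N\<close> is meant to be a maximum up to \<open>2 ^ Suc N\<close>.\<close>

lemma dyadic_to_full_limit:
  fixes u :: "nat \<Rightarrow> real" and D :: "nat \<Rightarrow> real"
  assumes b: "0 \<le> b" and u0: "\<And>n. 0 \<le> u n" and uD: "\<And>n N. n \<le> 2 ^ Suc N \<Longrightarrow> u n \<le> D N"
    and lim: "(\<lambda>N. D N / 2 powr (b * real (Suc N))) \<longlonglongrightarrow> 0"
  shows "(\<lambda>n. 1 / real n powr b * u n) \<longlonglongrightarrow> 0"
proof (rule LIMSEQ_I)
  fix e :: real assume e: "0 < e"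
  have "\<forall>\<^sub>F N in sequentially. D N / 2 powr (b * real (Suc N)) < e / 2 powr b"
    using lim e by (intro order_tendstoD(2)) auto
  then obtain N0 where N0: "\<And>N. N0 \<le> N \<Longrightarrow> D N / 2 powr (b * real (Suc N)) < e / 2 powr b"
    by (auto simp: eventually_sequentially)
  show "\<exists>no. \<forall>n\<ge>no. norm (1 / real n powr b * u n - 0) < e"
  proof (intro exI[of _ "2 ^ N0"] allI impI)
    fix n :: nat assume n: "2 ^ N0 \<le> n"
    have n1: "1 \<le> n" using n by (metis one_le_numeral one_le_power order_trans)
    then obtain N where N: "2 ^ N \<le> n" "n < 2 ^ Suc N"
      using ex_power_ivl1[of 2 n] by auto
    have "(2::nat) ^ N0 < 2 ^ Suc N" using n N(2) by linarith
    then have "N0 < Suc N" by (rule power_less_imp_less_exp[rotated]) simp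
    then have NN: "N0 \<le> N" by simp
    have "real (2 ^ N) \<le> real n" using N(1) by (rule of_nat_mono)
    then have "2 powr real N \<le> real n" by (simp add: powr_realpow)
    then have "(2 powr real N) powr b \<le> real n powr b" using b by (intro powr_mono2) auto
    then have le: "2 powr (b * real N) \<le> real n powr b" by (simp add: powr_powr mult.commute)
    have "1 / real n powr b * u n \<le> 1 / 2 powr (b * real N) * u n"
      using le u0 n1 by (intro mult_right_mono divide_left_mono) auto
    also have "\<dots> \<le> 1 / 2 powr (b * real N) * D N"
      using uD[of n N] N(2) by (intro mult_left_mono) auto
    also have "\<dots> = 2 powr b * (D N / 2 powr (b * real (Suc N)))"
      by (simp add: distrib_left powr_add)
    also have "\<dots> < 2 powr b * (e / 2 powr b)"
      by (intro mult_strict_left_mono N0 NN) simp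
    also have "\<dots> = e" by simp
    finally show "norm (1 / real n powr b * u n - 0) < e" using u0[of n] by (simp add: abs_of_nonneg)
  qed
qed

section \<open>Hilbert spaces as Banach spaces\<close>

text \<open>
  The sort \<open>{real_inner, complete_space}\<close> is not below \<open>banach\<close> in the class hierarchy, so the library on
  Bochner integration does not apply to it. The copy \<open>'h hilbert\<close> of the type \<open>'h\<close> is an instance of
  \<open>banach\<close>, and the statement is transported along the isometry \<open>Abs_hilbert\<close>.
\<close>

typedef (overloaded) 'h hilbert = "UNIV :: 'h set" by simp

setup_lifting type_definition_hilbert

instantiation hilbert :: (real_inner) real_inner
begin

lift_definition zero_hilbert :: "'a hilbert" is 0 .
lift_definition plus_hilbert :: "'a hilbert \<Rightarrow> 'a hilbert \<Rightarrow> 'a hilbert" is "(+)" .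
lift_definition minus_hilbert :: "'a hilbert \<Rightarrow> 'a hilbert \<Rightarrow> 'a hilbert" is "(-)" .
lift_definition uminus_hilbert :: "'a hilbert \<Rightarrow> 'a hilbert" is uminus .
lift_definition scaleR_hilbert :: "real \<Rightarrow> 'a hilbert \<Rightarrow> 'a hilbert" is scaleR .
lift_definition norm_hilbert :: "'a hilbert \<Rightarrow> real" is norm .
lift_definition dist_hilbert :: "'a hilbert \<Rightarrow> 'a hilbert \<Rightarrow> real" is dist .
lift_definition sgn_hilbert :: "'a hilbert \<Rightarrow> 'a hilbert" is sgn .
lift_definition inner_hilbert :: "'a hilbert \<Rightarrow> 'a hilbert \<Rightarrow> real" is inner .

definition uniformity_hilbert :: "('a hilbert \<times> 'a hilbert) filter" where
  "uniformity_hilbert = (INF e\<in>{0<..}. principal {(x, y). dist x y < e})"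

definition open_hilbert :: "'a hilbert set \<Rightarrow> bool" where
  "open_hilbert U \<longleftrightarrow> (\<forall>x\<in>U. \<forall>\<^sub>F (x', y) in uniformity. x' = x \<longrightarrow> y \<in> U)"

instance
proof
  show "dist x y = norm (x - y)" for x y :: "'a hilbert" by transfer (rule dist_norm)
  show "sgn x = scaleR (inverse (norm x)) x" for x :: "'a hilbert" by transfer (rule sgn_div_norm)
  show "norm x = sqrt (inner x x)" for x :: "'a hilbert" by transfer (rule norm_eq_sqrt_inner)
  show "inner x x = 0 \<longleftrightarrow> x = 0" for x :: "'a hilbert" by transfer (rule inner_eq_zero_iff)
qed (unfold uniformity_hilbert_def open_hilbert_def,
    (transfer, simp add: algebra_simps inner_commute inner_add_left)+)

end

lemma open_hilbert_vimage: "open S \<longleftrightarrow> open (Abs_hilbert -` S)" for S :: "'a::real_inner hilbert set"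
proof -
  have "Abs_hilbert y \<in> S" if "y \<in> Abs_hilbert -` S" for y using that by simp
  show ?thesis
    unfolding open_dist
  proof safe
    fix x assume *: "\<forall>x\<in>S. \<exists>e>0. \<forall>y. dist y x < e \<longrightarrow> y \<in> S" "Abs_hilbert x \<in> S"
    then obtain e where "e > 0" "\<forall>y. dist y (Abs_hilbert x) < e \<longrightarrow> y \<in> S" by blast
    then show "\<exists>e>0. \<forall>y. dist y x < e \<longrightarrow> y \<in> Abs_hilbert -` S"
      by (intro exI[of _ e]) (auto simp: dist_hilbert.abs_eq)
  next
    fix x assume *: "\<forall>x\<in>Abs_hilbert -` S. \<exists>e>0. \<forall>y. dist y x < e \<longrightarrow> y \<in> Abs_hilbert -` S" "x \<in> S"
    obtain x' where x: "x = Abs_hilbert x'" by (cases x) auto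
    with * obtain e where "e > 0" "\<forall>y. dist y x' < e \<longrightarrow> Abs_hilbert y \<in> S" by auto
    then show "\<exists>e>0. \<forall>y. dist y x < e \<longrightarrow> y \<in> S"
      unfolding x by (intro exI[of _ e]) (metis Abs_hilbert_cases dist_hilbert.abs_eq)
  qed
qed

instance hilbert :: ("{real_inner, complete_space}") banach
proof
  fix f :: "nat \<Rightarrow> 'a hilbert" assume f: "Cauchy f"
  have d: "dist (Rep_hilbert x) (Rep_hilbert y) = dist x y" for x y :: "'a hilbert" by transfer simp
  have "Cauchy (\<lambda>n. Rep_hilbert (f n))" using f unfolding Cauchy_def d .
  then obtain l where "(\<lambda>n. Rep_hilbert (f n)) \<longlonglongrightarrow> l"
    using Cauchy_convergent convergent_def by blast
  then have "f \<longlonglongrightarrow> Abs_hilbert l"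
    unfolding lim_sequentially by (simp add: d[symmetric] Abs_hilbert_inverse)
  then show "convergent f" by (rule convergentI)
qed

instance hilbert :: ("{real_inner, second_countable_topology}") second_countable_topology
proof
  obtain B :: "'a set set" where B: "countable B" "open = generate_topology B"
    using ex_countable_subbasis by blast
  let ?B = "(\<lambda>U. Rep_hilbert -` U) ` B"
  have inv: "Abs_hilbert -` (Rep_hilbert -` U) = U" for U :: "'a set"
    by (auto simp: Abs_hilbert_inverse)
  have inv': "Rep_hilbert -` (Abs_hilbert -` U) = U" for U :: "'a hilbert set"
    by (auto simp: Rep_hilbert_inverse)
  have 1: "generate_topology ?B (Rep_hilbert -` U)" if "generate_topology B U" for U
    using that
  proof induction
    case UNIV
    then show ?case by (simp add: generate_topology.UNIV)
  next
    case (Int a b)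
    then show ?case by (simp add: vimage_Int generate_topology.Int)
  next
    case (UN K)
    then have "generate_topology ?B (\<Union>((\<lambda>U. Rep_hilbert -` U) ` K))"
      by (intro generate_topology.UN) auto
    then show ?case by (simp add: vimage_Union)
  next
    case (Basis s)
    then show ?case by (intro generate_topology.Basis) auto
  qed
  have 2: "open S" if "generate_topology ?B S" for S
    using that
  proof induction
    case (Basis s)
    then obtain U where U: "s = Rep_hilbert -` U" "U \<in> B" by auto
    then have "open U" using B(2) generate_topology.Basis by metis
    then show ?case unfolding open_hilbert_vimage U(1) inv .
  qed auto
  have "open = generate_topology ?B"
  proof (intro ext iffI)
    fix S :: "'a hilbert set" assume "open S"
    then have "generate_topology B (Abs_hilbert -` S)" unfolding open_hilbert_vimage B(2) .
    from 1[OF this] show "generate_topology ?B S" unfolding inv' .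
  qed (rule 2)
  with B(1) show "\<exists>B::'a hilbert set set. countable B \<and> open = generate_topology B"
    by (intro exI[of _ ?B]) simp
qed

lemma norm_Abs_hilbert [simp]: "norm (Abs_hilbert x) = norm x"
  by (rule norm_hilbert.abs_eq)

lemma bounded_linear_Abs_hilbert: "bounded_linear Abs_hilbert"
  by (rule bounded_linear_intro[of _ 1]) (simp_all add: plus_hilbert.abs_eq scaleR_hilbert.abs_eq)

lemma measurable_Abs_hilbert [measurable]: "Abs_hilbert \<in> borel_measurable borel"
  by (intro borel_measurable_continuous_onI linear_continuous_on bounded_linear_Abs_hilbert)

lemma bounded_linear_Rep_hilbert: "bounded_linear Rep_hilbert"
  by (rule bounded_linear_intro[of _ 1])
    (simp_all add: plus_hilbert.rep_eq scaleR_hilbert.rep_eq norm_hilbert.rep_eq)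

lemma is_cond_exp_Abs_hilbert:
  fixes f g :: "'a \<Rightarrow> 'h::{real_inner, second_countable_topology}"
  assumes "is_cond_exp M F f g"
  shows "is_cond_exp M F (\<lambda>x. Abs_hilbert (f x)) (\<lambda>x. Abs_hilbert (g x))"
proof -
  have int: "integrable M f" "integrable M g" using assms by (auto simp: is_cond_exp_def)
  \<comment> \<open>As \<open>Abs_hilbert\<close> has a bounded linear inverse, it commutes with the
    integral for every \<open>k\<close>, integrable or not.\<close>
  have "(LINT \<omega>:A|M. Abs_hilbert (k \<omega>)) = Abs_hilbert (LINT \<omega>:A|M. k \<omega>)" for A and k :: "'a \<Rightarrow> 'h"
    using integral_bounded_linear'[OF bounded_linear_Abs_hilbert bounded_linear_Rep_hilbert,
        of M "\<lambda>\<omega>. indicator A \<omega> *\<^sub>R k \<omega>"]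
    by (simp add: set_lebesgue_integral_def scaleR_hilbert.abs_eq Abs_hilbert_inverse)
  moreover have "integrable M (\<lambda>x. Abs_hilbert (f x))" "integrable M (\<lambda>x. Abs_hilbert (g x))"
    using int integrable_bounded_linear[OF bounded_linear_Abs_hilbert] by auto
  moreover have "(\<lambda>x. Abs_hilbert (g x)) \<in> borel_measurable F"
    using assms measurable_compose[OF _ measurable_Abs_hilbert] by (auto simp: is_cond_exp_def)
  ultimately show ?thesis using assms unfolding is_cond_exp_def by simp
qed

lemma norm_U_stat_Abs_hilbert:
  "norm (U_stat (\<lambda>x y. Abs_hilbert (h x y)) X n \<omega>) = norm (U_stat h X n \<omega>)"
proof -
  interpret bounded_linear Abs_hilbert by (rule bounded_linear_Abs_hilbert)
  have "U_stat (\<lambda>x y. Abs_hilbert (h x y)) X n \<omega> = Abs_hilbert (U_stat h X n \<omega>)"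
    by (simp add: U_stat_def sum case_prod_unfold)
  then show ?thesis by simp
qed

section \<open>The strong law\<close>

lemma degenerate_from_copy:
  fixes h :: "'s::{metric_space, second_countable_topology} \<Rightarrow> 's \<Rightarrow> 'h::{real_inner, banach, second_countable_topology}"
    and \<xi> \<eta> :: "'b \<Rightarrow> 's"
  assumes "prob_space N" and \<xi>: "\<xi> \<in> N \<rightarrow>\<^sub>M borel" and \<eta>: "\<eta> \<in> N \<rightarrow>\<^sub>M borel"
    and d\<xi>: "distr N borel \<xi> = \<mu>"
    and joint: "\<mu> \<Otimes>\<^sub>M \<mu> = distr N (borel \<Otimes>\<^sub>M borel) (\<lambda>\<omega>. (\<xi> \<omega>, \<eta> \<omega>))"
    and h: "case_prod h \<in> borel \<Otimes>\<^sub>M borel \<rightarrow>\<^sub>M borel"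
    and c: "is_cond_exp N (vimage_algebra (space N) \<xi> borel) (\<lambda>\<omega>. h (\<xi> \<omega>) (\<eta> \<omega>)) (\<lambda>_. 0)"
  shows "integrable (\<mu> \<Otimes>\<^sub>M \<mu>) (case_prod h)"
    and "AE x in \<mu>. (\<integral>y. h x y \<partial>\<mu>) = 0"
proof -
  interpret N: prob_space N by fact
  interpret mu: prob_space \<mu> unfolding d\<xi>[symmetric] by (rule N.prob_space_distr[OF \<xi>])
  interpret MM: pair_prob_space \<mu> \<mu> ..
  have sets_mu [measurable_cong]: "sets \<mu> = sets borel" using d\<xi> by (metis sets_distr)
  have pr: "(\<lambda>\<omega>. (\<xi> \<omega>, \<eta> \<omega>)) \<in> N \<rightarrow>\<^sub>M borel \<Otimes>\<^sub>M borel" using \<xi> \<eta> by (intro measurable_Pair)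
  show int: "integrable (\<mu> \<Otimes>\<^sub>M \<mu>) (case_prod h)"
    unfolding joint using c pr h by (subst integrable_distr_eq) (auto simp: is_cond_exp_def)
  show "AE x in \<mu>. (\<integral>y. h x y \<partial>\<mu>) = 0"
  proof (rule AE_zero_of_set_integrals)
    show "integrable \<mu> (\<lambda>x. \<integral>y. h x y \<partial>\<mu>)" using MM.integrable_fst[OF int] .
    fix B assume "B \<in> sets \<mu>"
    then have [measurable]: "B \<in> sets borel" using sets_mu by simp
    let ?A = "\<xi> -` B \<inter> space N" and ?f = "\<lambda>z. indicator B (fst z) *\<^sub>R case_prod h z"
    have m: "{z\<in>space (\<mu> \<Otimes>\<^sub>M \<mu>). fst z \<in> B} \<in> sets (\<mu> \<Otimes>\<^sub>M \<mu>)" by measurable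
    have int': "integrable (\<mu> \<Otimes>\<^sub>M \<mu>) ?f"
      using integrable_mult_indicator[OF m int]
      by (rule Bochner_Integration.integrable_cong[THEN iffD1, rotated 2]) (auto simp: indicator_def)
    have "(\<integral>x. indicator B x *\<^sub>R (\<integral>y. h x y \<partial>\<mu>) \<partial>\<mu>) = (\<integral>x. (\<integral>y. indicator B x *\<^sub>R h x y \<partial>\<mu>) \<partial>\<mu>)"
      by (intro Bochner_Integration.integral_cong refl) (auto simp: indicator_def)
    also have "\<dots> = (\<integral>z. ?f z \<partial>(\<mu> \<Otimes>\<^sub>M \<mu>))" using MM.integral_fst'[OF int'] by simp
    also have "\<dots> = (\<integral>\<omega>. indicator B (\<xi> \<omega>) *\<^sub>R h (\<xi> \<omega>) (\<eta> \<omega>) \<partial>N)"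
      unfolding joint using pr h by (subst integral_distr) auto
    also have "\<dots> = (LINT \<omega>:?A|N. h (\<xi> \<omega>) (\<eta> \<omega>))"
      unfolding set_lebesgue_integral_def by (intro Bochner_Integration.integral_cong refl) (auto simp: indicator_def)
    also have "\<dots> = (LINT \<omega>:?A|N. (0 :: 'h))"
      using c in_vimage_algebra[OF \<open>B \<in> sets borel\<close>, of \<xi> "space N"] unfolding is_cond_exp_def by blast
    finally show "(\<integral>x. indicator B x *\<^sub>R (\<integral>y. h x y \<partial>\<mu>) \<partial>\<mu>) = 0" by simp
  qed
qed

lemma degenerate_kernel_from_copy:
  fixes h :: "'s::{metric_space, second_countable_topology} \<Rightarrow> 's \<Rightarrow> 'h::{real_inner, banach, second_countable_topology}"
    and \<xi> \<eta> :: "'b \<Rightarrow> 's" and t :: real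
  assumes "prob_space N" and \<xi>: "\<xi> \<in> N \<rightarrow>\<^sub>M borel" and \<eta>: "\<eta> \<in> N \<rightarrow>\<^sub>M borel"
    and d\<xi>: "distr N borel \<xi> = \<mu>" and d\<eta>: "distr N borel \<eta> = \<mu>"
    and ind: "prob_space.indep_var N borel \<xi> borel \<eta>"
    and h: "case_prod h \<in> borel \<Otimes>\<^sub>M borel \<rightarrow>\<^sub>M borel"
    and c1: "is_cond_exp N (vimage_algebra (space N) \<xi> borel) (\<lambda>\<omega>. h (\<xi> \<omega>) (\<eta> \<omega>)) (\<lambda>_. 0)"
    and c2: "is_cond_exp N (vimage_algebra (space N) \<eta> borel) (\<lambda>\<omega>. h (\<xi> \<omega>) (\<eta> \<omega>)) (\<lambda>_. 0)"
    and t: "1 < t" "t < 2"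
    and mom: "integrable N (\<lambda>\<omega>. norm (h (\<xi> \<omega>) (\<eta> \<omega>)) powr t)"
  obtains C where "degenerate_kernel \<mu> h t C"
proof -
  interpret N: prob_space N by fact
  interpret mu: prob_space \<mu> unfolding d\<xi>[symmetric] by (rule N.prob_space_distr[OF \<xi>])
  interpret MM: pair_prob_space \<mu> \<mu> ..
  have sets_mu: "sets \<mu> = sets borel" using d\<xi> by (metis sets_distr)
  then have sets2: "sets (\<mu> \<Otimes>\<^sub>M \<mu>) = sets (borel \<Otimes>\<^sub>M borel)" by (intro sets_pair_measure_cong)
  have h': "case_prod h \<in> borel_measurable (\<mu> \<Otimes>\<^sub>M \<mu>)"
    using h measurable_cong_sets[OF sets2 refl] by blast
  have pr: "(\<lambda>\<omega>. (\<xi> \<omega>, \<eta> \<omega>)) \<in> N \<rightarrow>\<^sub>M borel \<Otimes>\<^sub>M borel" using \<xi> \<eta> by (intro measurable_Pair)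
  have swap: "(\<lambda>z. (snd z, fst z)) \<in> borel \<Otimes>\<^sub>M borel \<rightarrow>\<^sub>M (borel \<Otimes>\<^sub>M borel :: ('s \<times> 's) measure)"
    by (intro measurable_Pair measurable_snd measurable_fst)
  have joint: "\<mu> \<Otimes>\<^sub>M \<mu> = distr N (borel \<Otimes>\<^sub>M borel) (\<lambda>\<omega>. (\<xi> \<omega>, \<eta> \<omega>))"
    using ind \<xi> \<eta> d\<xi> d\<eta> N.indep_var_distribution_eq[of borel \<xi> borel \<eta>] by simp
  \<comment> \<open>The product measure is symmetric, so it is also the law of the pair in reverse
    order; this allows the same lemma to be used for the second condition.\<close>
  have "\<mu> \<Otimes>\<^sub>M \<mu> = distr (\<mu> \<Otimes>\<^sub>M \<mu>) (\<mu> \<Otimes>\<^sub>M \<mu>) (\<lambda>(x, y). (y, x))" by (rule MM.distr_pair_swap)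
  also have "\<dots> = distr (\<mu> \<Otimes>\<^sub>M \<mu>) (borel \<Otimes>\<^sub>M borel) (\<lambda>z. (snd z, fst z))"
    by (intro distr_cong sets2 refl) (simp add: case_prod_unfold)
  also have "\<dots> = distr N (borel \<Otimes>\<^sub>M borel) (\<lambda>\<omega>. (\<eta> \<omega>, \<xi> \<omega>))"
    by (simp add: joint distr_distr[OF swap pr] comp_def)
  finally have joint': "\<mu> \<Otimes>\<^sub>M \<mu> = distr N (borel \<Otimes>\<^sub>M borel) (\<lambda>\<omega>. (\<eta> \<omega>, \<xi> \<omega>))" .
  note fst = degenerate_from_copy[OF assms(1) \<xi> \<eta> d\<xi> joint h c1]
  have "case_prod (\<lambda>x y. h y x) \<in> borel \<Otimes>\<^sub>M borel \<rightarrow>\<^sub>M borel"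
    using measurable_compose[OF swap h] by (simp add: case_prod_unfold)
  from degenerate_from_copy(2)[OF assms(1) \<eta> \<xi> d\<eta> joint' this c2]
  have deg1: "AE y in \<mu>. (\<integral>x. h x y \<partial>\<mu>) = 0" .
  define E where "E = (\<integral>\<omega>. norm (h (\<xi> \<omega>) (\<eta> \<omega>)) powr t \<partial>N)"
  have "(\<integral>\<^sup>+x. \<integral>\<^sup>+y. ennreal (norm (h x y) powr t) \<partial>\<mu> \<partial>\<mu>) = (\<integral>\<^sup>+z. ennreal (norm (case_prod h z) powr t) \<partial>(\<mu> \<Otimes>\<^sub>M \<mu>))"
    using h' by (subst mu.nn_integral_fst[symmetric]) auto
  also have "\<dots> = (\<integral>\<^sup>+\<omega>. ennreal (norm (h (\<xi> \<omega>) (\<eta> \<omega>)) powr t) \<partial>N)"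
    unfolding joint using pr h by (subst nn_integral_distr) auto
  also have "\<dots> = ennreal E" unfolding E_def using mom by (intro nn_integral_eq_integral) auto
  \<comment> \<open>The moment itself may vanish, whereas the kernel locale asks for a positive
    bound.\<close>
  also have "\<dots> \<le> ennreal (max 1 E)" by (intro ennreal_leI) simp
  finally have "(\<integral>\<^sup>+x. \<integral>\<^sup>+y. ennreal (norm (h x y) powr t) \<partial>\<mu> \<partial>\<mu>) \<le> ennreal (max 1 E)" .
  then have "degenerate_kernel \<mu> h t (max 1 E)"
    by (intro degenerate_kernel.intro degenerate_kernel_axioms.intro mu.prob_space_axioms h' fst deg1 t) auto
  then show ?thesis by (rule that)
qed

context mixing_kernel
begin

text \<open>Every term of \<open>segment_bound\<close> is written as a power of 2 and compared with
  \<open>L * x\<close>, where \<open>x = 2 powr (- \<eta> * N)\<close>: \<open>e1\<close>,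
  \<open>e2\<close> and \<open>e3\<close> correspond to the three exponent conditions in
  turn.\<close>

lemma dyadic_moment_bound:
  assumes p: "1 < p" "p < 2"
    and B: "0 \<le> B" "\<And>m. 0 < m \<Longrightarrow> beta_mixing M X m \<le> B * real m powr (- s)" and s: "0 < s"
    and ex: "0 < c" "c < 1" "0 < \<alpha>"
      "1 + c - 2 / p + \<alpha> * (1 - t / 2) \<le> - \<eta>" "1 - c - s * c \<le> - \<eta>" "2 - 2 / p + \<alpha> * (1 - t) \<le> - \<eta>"
    and N: "0 < N"
  shows "(\<integral>\<^sup>+\<omega>. min (ennreal (segment_max 1 (2 ^ N) \<omega>)) (ennreal (2 powr (2 / p * real N))) \<partial>M)
    \<le> ennreal (2 powr (2 / p * real N) *
        ((3 * C0 + 4 * B * 2 powr (1 + s) + 2 * C + 4 * sqrt C) * ((real N)\<^sup>2 * 2 powr (- \<eta> * real N))))"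
proof -
  \<comment> \<open>\<open>q = 2 ^ g\<close> is \<open>n powr c\<close> rounded down to a power of
    two, so that \<open>2 ^ N = 2 ^ K * (2 * q)\<close> holds exactly; \<open>c < 1\<close> ensures
    \<open>g < N\<close>.\<close>
  define g where "g = nat \<lfloor>c * real N\<rfloor>"
  have cN: "0 \<le> c * real N" using ex N by simp
  have g1: "real g \<le> c * real N" and g2: "c * real N < real g + 1"
    using cN by (auto simp: g_def of_nat_nat)
  have "c * real N < real N" using ex N by simp
  then have gN: "g < N" using g1 by linarith
  define K where "K = N - 1 - g"
  have K: "N = K + 1 + g" using gN by (simp add: K_def)
  define q where "q = (2::nat) ^ g"
  define L where "L = 2 powr (2 / p * real N)"
  define a where "a = 2 powr (\<alpha> * real N)"
  define x where "x = 2 powr (- \<eta> * real N)"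
  let ?b = "beta_mixing M X q"
  have q0: "0 < q" and L0: "0 < L" and a0: "0 < a" and x0: "0 \<le> x" by (simp_all add: q_def L_def a_def x_def)
  have seg: "2 ^ K * (2 * q) = 2 ^ N" by (simp add: K q_def power_add)
  define n where "n = (2::real) ^ N"
  define Q where "Q = real q"
  have n_eq: "n = 2 powr real N" by (simp add: n_def powr_realpow)
  have Q_eq: "Q = 2 powr real g" by (simp add: Q_def q_def powr_realpow)
  have nK: "n = 2 ^ K * (2 * Q)" using arg_cong[OF seg, of real] by (simp add: n_def Q_def)
  have Q0: "0 < Q" using q0 by (simp add: Q_def)
  have n0: "0 < n" by (simp add: n_def)
  have b0: "0 \<le> ?b" by (rule beta_mixing_nonneg[OF prob_M X_meas])
  have pow: "2 powr u \<le> x * 2 powr v" if "u \<le> v - \<eta> * real N" for u v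
    using that by (simp add: x_def powr_add[symmetric])
  have a1: "1 \<le> a powr (1 - t / 2)"
    unfolding a_def powr_powr using ex t by (intro ge_one_powr_ge_zero) auto
  have e1: "n * Q * a powr (1 - t / 2) \<le> x * L"
  proof -
    have "n * Q * a powr (1 - t / 2) = 2 powr (real N + real g + \<alpha> * real N * (1 - t / 2))"
      by (simp add: n_eq Q_eq a_def powr_powr powr_add)
    also have "\<dots> \<le> x * L"
      unfolding L_def
    proof (rule pow)
      have "(1 + c - 2 / p + \<alpha> * (1 - t / 2)) * real N \<le> - \<eta> * real N"
        using ex(4) by (intro mult_right_mono) auto
      then show "real N + real g + \<alpha> * real N * (1 - t / 2) \<le> 2 / p * real N - \<eta> * real N"
        using g1 by (simp add: algebra_simps)
    qed
    finally show ?thesis .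
  qed
  \<comment> \<open>The cost of close indices; it follows from \<open>e1\<close> because
    \<open>a powr (1 - t / 2) \<ge> 1\<close>.\<close>
  have e1': "n * Q \<le> x * L"
  proof -
    have "n * Q * 1 \<le> n * Q * a powr (1 - t / 2)" using a1 n0 Q0 by (intro mult_left_mono) auto
    with e1 show ?thesis by simp
  qed
  \<comment> \<open>Rounding \<open>c * N\<close> down loses less than 1 in the exponent of
    \<open>q\<close>; as \<open>q\<close> enters with the power \<open>- (1 + s)\<close>, this costs
    at most \<open>2 powr (1 + s)\<close>.\<close>
  have e2: "n * ?b / Q \<le> B * 2 powr (1 + s) * x"
  proof -
    have "n * ?b / Q \<le> n * (B * Q powr (- s)) / Q"
      using B(2)[OF q0] n0 Q0 by (intro divide_right_mono mult_left_mono) (auto simp: Q_def)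
    also have "\<dots> = B * 2 powr (real N - s * real g - real g)"
      by (simp add: n_eq Q_eq powr_powr powr_diff powr_minus powr_add field_simps)
    also have "\<dots> \<le> B * (x * 2 powr (1 + s))"
    proof (intro mult_left_mono B(1) pow)
      have "(1 - c - s * c) * real N \<le> - \<eta> * real N"
        using ex(5) by (intro mult_right_mono) auto
      moreover have "(1 + s) * (c * real N) \<le> (1 + s) * (real g + 1)"
        using g2 s by (intro mult_left_mono) auto
      ultimately show "real N - s * real g - real g \<le> 1 + s - \<eta> * real N"
        by (simp add: algebra_simps)
    qed
    finally show ?thesis by (simp add: mult_ac)
  qed
  have e3: "n * n * a powr (1 - t) \<le> x * L"
  proof -
    have "n * n * a powr (1 - t) = 2 powr (real N + real N + \<alpha> * real N * (1 - t))"
      by (simp only: n_eq a_def powr_powr powr_add)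
    also have "\<dots> \<le> x * L"
      unfolding L_def
    proof (rule pow)
      have "(2 - 2 / p + \<alpha> * (1 - t)) * real N \<le> - \<eta> * real N"
        using ex(6) by (intro mult_right_mono) auto
      then show "real N + real N + \<alpha> * real N * (1 - t) \<le> 2 / p * real N - \<eta> * real N"
        by (simp add: algebra_simps)
    qed
    finally show ?thesis .
  qed
  have N1: "1 \<le> real N" and KN: "real K + 1 \<le> real N" using N K by auto
  have N2: "real N \<le> (real N)\<^sup>2" using N1 by (simp add: power2_eq_square)
  let ?A = "a powr (1 - t) * C" and ?D = "a powr (1 - t / 2) * sqrt C"
  have A0: "0 \<le> ?A" and D0: "0 \<le> ?D" using C by auto
  have "2 ^ K * (4 * Q\<^sup>2 * C0 + K * (2 * Q\<^sup>2 * C0 + 8 * ?b * L + Q\<^sup>2 * (8 * 2 ^ K * ?A + 8 * (real K + 1) * ?D)))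
      = 2 * (n * Q * C0) + K * (n * Q * C0 + 4 * (n * ?b / Q) * L + 2 * (n * n * ?A) + 4 * (real K + 1) * (n * Q * ?D))"
    using Q0 by (simp add: nK field_simps power2_eq_square)
  also have "\<dots> \<le> 2 * (x * L * C0) + K * (x * L * C0 + 4 * (B * 2 powr (1 + s) * x) * L + 2 * (x * L * C) + 4 * (real K + 1) * (x * L * sqrt C))"
    using e1 e1' e2 e3 C0 C L0
    by (intro add_mono mult_left_mono mult_right_mono order_refl)
      (auto simp: mult.assoc[symmetric] intro!: mult_right_mono)
  also have "\<dots> = x * L * (2 * C0 + K * (C0 + 4 * B * 2 powr (1 + s) + 2 * C) + K * (real K + 1) * (4 * sqrt C))"
    by (simp add: algebra_simps)
  \<comment> \<open>One factor \<open>N\<close> comes from the depth of the recursion, the other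
    from the logarithm in the maximal inequality.\<close>
  also have "\<dots> \<le> x * L * ((real N)\<^sup>2 * (2 * C0) + (real N)\<^sup>2 * (C0 + 4 * B * 2 powr (1 + s) + 2 * C) + (real N)\<^sup>2 * (4 * sqrt C))"
  proof (intro mult_left_mono add_mono mult_right_mono)
    show "2 * C0 \<le> (real N)\<^sup>2 * (2 * C0)" using N1 N2 C0 mult_right_mono[of 1 "(real N)\<^sup>2" "2 * C0"] by simp
    show "real K \<le> (real N)\<^sup>2" using N2 KN by simp
    have "real K * (real K + 1) \<le> real N * real N" using KN by (intro mult_mono) auto
    then show "real K * (real K + 1) \<le> (real N)\<^sup>2" by (simp add: power2_eq_square)
  qed (use C0 C B x0 L0 in auto)
  also have "\<dots> = L * ((3 * C0 + 4 * B * 2 powr (1 + s) + 2 * C + 4 * sqrt C) * ((real N)\<^sup>2 * x))"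
    by (simp add: algebra_simps)
  finally have final: "2 ^ K * (4 * Q\<^sup>2 * C0 + K * (2 * Q\<^sup>2 * C0 + 8 * ?b * L + Q\<^sup>2 * (8 * 2 ^ K * ?A + 8 * (real K + 1) * ?D)))
      \<le> L * ((3 * C0 + 4 * B * 2 powr (1 + s) + 2 * C + 4 * sqrt C) * ((real N)\<^sup>2 * x))" .
  have "(\<integral>\<^sup>+\<omega>. min (ennreal (segment_max 1 (2 ^ K * (2 * q)) \<omega>)) (ennreal L) \<partial>M)
      \<le> ennreal (2 ^ K * (4 * Q\<^sup>2 * C0 + K * (2 * Q\<^sup>2 * C0 + 8 * ?b * L + Q\<^sup>2 * (8 * 2 ^ K * ?A + 8 * (real K + 1) * ?D))))"
    unfolding Q_def by (rule segment_bound[OF q0 L0 a0]) auto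
  also note ennreal_leI[OF final]
  finally show ?thesis unfolding seg L_def x_def .
qed

end

lemma (in mixing_kernel) U_stat_strong_law:
  fixes p \<delta> :: real
  assumes p: "1 < p" "p < 2" and \<delta>: "0 < \<delta>" "p + \<delta> < 2" and t_def: "t = p + \<delta>"
    and mix: "summable (\<lambda>k. real (Suc k) powr (p - 1 + p * (p - 1) / \<delta>) * beta_mixing M X (Suc k))"
  shows "AE \<omega> in M. (\<lambda>n. 1 / real n powr (2 / p) * norm (U_stat h X n \<omega>)) \<longlonglongrightarrow> 0"
proof -
  define s where "s = p + p * (p - 1) / \<delta>"
  have s1: "1 < s"
  proof -
    have "0 < p * (p - 1) / \<delta>" using p \<delta> by simp
    then show ?thesis using p by (simp add: s_def)
  qed
  obtain B where B: "0 \<le> B" "\<And>m. 0 < m \<Longrightarrow> beta_mixing M X m \<le> B * real m powr (- s)"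
  proof (rule antimono_summable_decay[of s "beta_mixing M X"])
    show "summable (\<lambda>k. real (Suc k) powr (s - 1) * beta_mixing M X (Suc k))"
      using mix by (simp add: s_def add_diff_eq diff_add_eq)
  qed (use s1 beta_mixing_antimono[OF prob_M X_meas] beta_mixing_nonneg[OF prob_M X_meas] in auto)
  obtain c \<alpha> e where ex: "0 < c" "c < 1" "0 < \<alpha>" "0 < e"
      "1 + c - 2 / p + \<alpha> * (1 - t / 2) \<le> - e" "1 - c - s * c \<le> - e" "2 - 2 / p + \<alpha> * (1 - t) \<le> - e"
    using exponents_exist[OF p \<delta>] unfolding t_def s_def by metis
  define w where "w n = (3 * C0 + 4 * B * 2 powr (1 + s) + 2 * C + 4 * sqrt C) * ((real n)\<^sup>2 * 2 powr (- e * real n))" for n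
  have w0: "0 \<le> w n" for n using B(1) C0 C by (simp add: w_def)
  have "summable w" unfolding w_def[abs_def] by (rule summable_square_geometric[OF ex(4)])
  then have sm: "summable (\<lambda>n. w (Suc n))" by (simp only: summable_Suc_iff)
  have "AE \<omega> in M. (\<lambda>n. segment_max 1 (2 ^ Suc n) \<omega> / 2 powr (2 / p * real (Suc n))) \<longlonglongrightarrow> 0"
  proof (rule AE_tendsto_zero_of_truncated[where w="\<lambda>n. w (Suc n)"])
    show "(\<integral>\<^sup>+\<omega>. min (ennreal (segment_max 1 (2 ^ Suc n) \<omega>)) (ennreal (2 powr (2 / p * real (Suc n)))) \<partial>M)
        \<le> ennreal (2 powr (2 / p * real (Suc n)) * w (Suc n))" for n
      unfolding w_def using s1 by (intro dyadic_moment_bound[OF p B _ ex(1-3,5-7)]) auto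
  qed (use sm w0 in \<open>auto simp: segment_max_def max_partial_nonneg\<close>)
  then show ?thesis
  proof eventually_elim
    fix \<omega> assume lim: "(\<lambda>n. segment_max 1 (2 ^ Suc n) \<omega> / 2 powr (2 / p * real (Suc n))) \<longlonglongrightarrow> 0"
    show "(\<lambda>n. 1 / real n powr (2 / p) * norm (U_stat h X n \<omega>)) \<longlonglongrightarrow> 0"
    proof (rule dyadic_to_full_limit[OF _ _ _ lim])
      show "norm (U_stat h X n \<omega>) \<le> segment_max 1 (2 ^ Suc k) \<omega>" if "n \<le> 2 ^ Suc k" for n k
        unfolding U_stat_eq_sum segment_max_def by (rule max_partial_ge[OF that])
    qed (use p in auto)
  qed
qed

theorem theorem1p7:
  fixes M :: "'a measure" and N :: "'b measure" and \<pi> :: "'b \<Rightarrow> 'a"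
    and X :: "int \<Rightarrow> 'a \<Rightarrow> 's::{metric_space, second_countable_topology}"
    and X' :: "'b \<Rightarrow> 's"
    and h :: "'s \<Rightarrow> 's \<Rightarrow> 'h::{real_inner, complete_space, second_countable_topology}"
    and p \<delta> :: real
  assumes "prob_space M"
    and "\<And>i. X i \<in> M \<rightarrow>\<^sub>M borel"
    and "strictly_stationary M X"
    and "(\<lambda>(x, y). h x y) \<in> borel \<Otimes>\<^sub>M borel \<rightarrow>\<^sub>M borel"
    \<comment> \<open>\<open>X'\<close> is an independent copy of \<open>X 1\<close>, living on an extension \<open>(N, \<pi>)\<close> of \<open>M\<close> (possibly \<open>M\<close> itself)\<close>
    and "prob_space N" and "\<pi> \<in> N \<rightarrow>\<^sub>M M" and "distr N M \<pi> = M"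
    and "X' \<in> N \<rightarrow>\<^sub>M borel"
    and "distr N borel X' = distr M borel (X 1)"
    and "prob_space.indep_var N borel (\<lambda>\<omega>. X 1 (\<pi> \<omega>)) borel X'"
    and "is_cond_exp N (vimage_algebra (space N) (\<lambda>\<omega>. X 1 (\<pi> \<omega>)) borel)
           (\<lambda>\<omega>. h (X 1 (\<pi> \<omega>)) (X' \<omega>)) (\<lambda>_. 0)"
    and "is_cond_exp N (vimage_algebra (space N) X' borel)
           (\<lambda>\<omega>. h (X 1 (\<pi> \<omega>)) (X' \<omega>)) (\<lambda>_. 0)"
    and "1 < p" and "p < 2" and "\<delta> > 0" and "p + \<delta> < 2"
    and "integrable N (\<lambda>\<omega>. norm (h (X 1 (\<pi> \<omega>)) (X' \<omega>)) powr (p + \<delta>))"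
    and "(SUP j\<in>{2..}. \<integral>\<^sup>+\<omega>. ennreal (norm (h (X 1 \<omega>) (X j \<omega>))) \<partial>M) < \<infinity>"
    and "summable (\<lambda>k. real (Suc k) powr (p - 1 + p * (p - 1) / \<delta>) * beta_mixing M X (Suc k))"
  shows "AE \<omega> in M. (\<lambda>n. 1 / real n powr (2 / p) * norm (U_stat h X n \<omega>)) \<longlonglongrightarrow> 0"
proof -
  interpret MP: prob_space M by fact
  note X = assms(2) and \<pi> = assms(6) and st = assms(3)
  define \<mu> where "\<mu> = distr M borel (X 1)"
  \<comment> \<open>Passage to the Banach copy of the Hilbert space. Norms are unchanged, so the
    moment hypotheses carry over; only measurability and the conditional expectations have to be
    translated.\<close>
  define h' where "h' x y = Abs_hilbert (h x y)" for x y
  have nh [simp]: "norm (h' x y) = norm (h x y)" for x y by (simp add: h'_def)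
  have mh: "case_prod h' \<in> borel \<Otimes>\<^sub>M borel \<rightarrow>\<^sub>M borel"
    using measurable_compose[OF assms(4) measurable_Abs_hilbert] by (simp add: h'_def case_prod_unfold)
  have "distr N borel (\<lambda>\<omega>. X 1 (\<pi> \<omega>)) = distr (distr N M \<pi>) borel (X 1)"
    by (simp add: distr_distr[OF X \<pi>] comp_def)
  then have d: "distr N borel (\<lambda>\<omega>. X 1 (\<pi> \<omega>)) = \<mu>" using assms(7) by (simp add: \<mu>_def)
  obtain C where kernel: "degenerate_kernel \<mu> h' (p + \<delta>) C"
  proof (rule degenerate_kernel_from_copy[OF assms(5) measurable_compose[OF \<pi> X] assms(8) d _ assms(10) mh])
    show "is_cond_exp N (vimage_algebra (space N) (\<lambda>\<omega>. X 1 (\<pi> \<omega>)) borel) (\<lambda>\<omega>. h' (X 1 (\<pi> \<omega>)) (X' \<omega>)) (\<lambda>_. 0)"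
      using is_cond_exp_Abs_hilbert[OF assms(11)] by (simp add: zero_hilbert_def h'_def)
    show "is_cond_exp N (vimage_algebra (space N) X' borel) (\<lambda>\<omega>. h' (X 1 (\<pi> \<omega>)) (X' \<omega>)) (\<lambda>_. 0)"
      using is_cond_exp_Abs_hilbert[OF assms(12)] by (simp add: zero_hilbert_def h'_def)
  qed (use assms in \<open>simp_all add: \<mu>_def\<close>)
  define S where "S = (SUP j\<in>{2..}. \<integral>\<^sup>+\<omega>. ennreal (norm (h (X 1 \<omega>) (X j \<omega>))) \<partial>M)"
  define C0 where "C0 = enn2real S"
  have SC0: "S = ennreal C0" using assms(18) by (simp add: S_def C0_def)
  have near: "(\<integral>\<^sup>+\<omega>. ennreal (norm (h' (X i \<omega>) (X j \<omega>))) \<partial>M) \<le> ennreal C0" if "i < j" for i j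
  proof -
    have pr: "(\<lambda>\<omega>. (X i \<omega>, X j \<omega>)) \<in> M \<rightarrow>\<^sub>M borel \<Otimes>\<^sub>M borel" for i j
      using X by (intro measurable_Pair)
    have tr: "(\<integral>\<^sup>+\<omega>. ennreal (norm (h (X i \<omega>) (X j \<omega>))) \<partial>M)
        = (\<integral>\<^sup>+z. ennreal (norm (case_prod h z)) \<partial>distr M (borel \<Otimes>\<^sub>M borel) (\<lambda>\<omega>. (X i \<omega>, X j \<omega>)))" for i j
      using pr assms(4) by (subst nn_integral_distr) auto
    \<comment> \<open>Stationarity moves the pair \<open>(i, j)\<close> to
      \<open>(1, j - i + 1)\<close>, whose second index is at least 2 and thus in the range of the
      supremum.\<close>
    have "distr M (borel \<Otimes>\<^sub>M borel) (\<lambda>\<omega>. (X i \<omega>, X j \<omega>)) = distr M (borel \<Otimes>\<^sub>M borel) (\<lambda>\<omega>. (X 1 \<omega>, X (j - i + 1) \<omega>))"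
      using stationary_distr_pair[OF X st, of 1 "i - 1" "j - i + 1"] by simp
    then have "(\<integral>\<^sup>+\<omega>. ennreal (norm (h (X i \<omega>) (X j \<omega>))) \<partial>M)
        = (\<integral>\<^sup>+\<omega>. ennreal (norm (h (X 1 \<omega>) (X (j - i + 1) \<omega>))) \<partial>M)" by (simp only: tr)
    also have "\<dots> \<le> S" unfolding S_def using that by (intro SUP_upper) auto
    finally show ?thesis by (simp only: SC0 nh)
  qed
  interpret degenerate_kernel \<mu> h' "p + \<delta>" C by (rule kernel)
  interpret mixing_kernel \<mu> h' "p + \<delta>" C M X C0
  proof
    show "distr M borel (X i) = \<mu>" for i unfolding \<mu>_def by (rule stationary_distr[OF X st])
  qed (use X near MP.prob_space_axioms in \<open>auto simp: C0_def MP.emeasure_space_1\<close>)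
  have "AE \<omega> in M. (\<lambda>n. 1 / real n powr (2 / p) * norm (U_stat h' X n \<omega>)) \<longlonglongrightarrow> 0"
    by (rule U_stat_strong_law[OF assms(13-16) refl assms(19)])
  then show ?thesis by (simp only: h'_def[abs_def] norm_U_stat_Abs_hilbert)
qed

end
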